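(* Let $d$ be the figure eight knot diagram: an oriented knot diagram in the plane with four crossings $1,2,3,4$ such that, travelling once along the knot in the direction of its orientation, one passes in cyclic order: under at $1$, over at $2$, under at $3$, over at $1$, under at $4$, over at $3$, under at $2$, over at $4$, where crossings $2$ and $3$ are positive and crossings $1$ and $4$ are negative. Let $\bar d$ be its inverse, i.e. the same diagram with the orientation of the strand reversed. Then every sequence of Reidemeister moves and orientation-preserving diffeomorphisms of the plane transforming $d$ into $\bar d$ contains at least one ascending $\Omega_3$-move and at least one descending $\Omega_3$-move. In particular, $d$ cannot be transformed into $\bar d$ without at least two $\Omega_3$-moves.
   Context: A knot diagram is the image of an immersion of the oriented circle $S^1$ in $\mathbb{R}^2$ whose only multiple points are transversal double points (crossings), together with the induced orientation and over/under information at each crossing. The sign of a crossing is $+1$ if (direction of overpassing strand, direction of underpassing strand) is a positively oriented basis of $\mathbb{R}^2$, and $-1$ otherwise. A Reidemeister move changes a knot diagram only inside a disk $C\subset\mathbb{R}^2$ (the changing disk); up to diffeomorphism (possibly orientation-reversing) of the disk it is one of the following, in either direction. $\Omega_1$: an embedded arc is replaced by an arc with a single kink (one crossing, of either type). $\Omega_2$: two disjoint arcs are replaced by two arcs crossing each other in exactly two points and bounding a bigon, one of the arcs being over at both crossings. $\Omega_3$: three arcs crossing pairwise exactly once, one of which (the top strand) is over at both its crossings, one (the bottom strand) under at both, and the remaining one (the middle strand) under the top and over the bottom, are replaced by the configuration obtained by sliding one strand across the crossing of the other two, with over/under relations kept. An $\Omega_3$-move is called descending if, moving along the knot in the direction of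 its orientation, the three strands in the changing disk are passed in the cyclic order top-middle-bottom; otherwise it is called ascending. *)

theory Defs
  imports "HOL-Analysis.Analysis"
begin

text \<open>Smooth (infinitely often differentiable) maps; meaningful for open \<open>U\<close>.\<close>

primrec Ck_on :: "nat \<Rightarrow> 'a::real_normed_vector set \<Rightarrow> ('a \<Rightarrow> 'b::real_normed_vector) \<Rightarrow> bool" where
  "Ck_on 0 U f \<longleftrightarrow> continuous_on U f"
| "Ck_on (Suc k) U f \<longleftrightarrow>
     (\<forall>x\<in>U. f differentiable (at x)) \<and>
     (\<forall>v. Ck_on k U (\<lambda>x. frechet_derivative f (at x) v))"

definition smooth_on :: "'a::real_normed_vector set \<Rightarrow> ('a \<Rightarrow> 'b::real_normed_vector) \<Rightarrow> bool" where
  "smooth_on U f \<longleftrightarrow> (\<forall>k. Ck_on k U f)"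

type_synonym plane = "real^2"

definition diffeomorphism :: "plane set \<Rightarrow> plane set \<Rightarrow> (plane \<Rightarrow> plane) \<Rightarrow> bool" where
  "diffeomorphism U V f \<longleftrightarrow>
     open U \<and> open V \<and> bij_betw f U V \<and> smooth_on U f \<and> smooth_on V (inv_into U f)"


text \<open>
  The circle is \<open>\<real>/\<int>\<close>, so a parametrized oriented diagram is a 1-periodic curve, together with
  the set of those parameters at which the curve is the overpassing strand of a crossing.
\<close>

record diagram =
  curve :: "real \<Rightarrow> plane"
  over :: "real set"

definition velocity :: "diagram \<Rightarrow> real \<Rightarrow> plane" where
  "velocity D t = vector_derivative (curve D) (at t)"

definition meets :: "diagram \<Rightarrow> real \<Rightarrow> real \<Rightarrow> bool" where
  "meets D s t \<longleftrightarrow> curve D s = curve D t \<and> s - t \<notin> \<int>"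

text \<open>
  The \<open>over\<close> component contains crossing parameters only, so that it carries no information
  beyond the over/under information at the crossings.
\<close>

definition knot_diagram :: "diagram \<Rightarrow> bool" where
  "knot_diagram D \<longleftrightarrow>
     smooth_on UNIV (curve D) \<and>
     (\<forall>t. curve D (t + 1) = curve D t) \<and>
     (\<forall>t. velocity D t \<noteq> 0) \<and>
     (\<forall>s t. meets D s t \<longrightarrow> det (vector [velocity D s, velocity D t] :: real^2^2) \<noteq> 0) \<and>
     (\<forall>r s t. meets D r s \<and> meets D s t \<longrightarrow> r - t \<in> \<int>) \<and>
     (\<forall>t. t + 1 \<in> over D \<longleftrightarrow> t \<in> over D) \<and>
     (\<forall>t\<in>over D. \<exists>s. meets D s t) \<and>
     (\<forall>s t. meets D s t \<longrightarrow> (s \<in> over D \<longleftrightarrow> t \<notin> over D))"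

definition crossing_sign :: "diagram \<Rightarrow> real \<Rightarrow> real \<Rightarrow> real" where
  "crossing_sign D t_over t_under =
     sgn (det (vector [velocity D t_over, velocity D t_under] :: real^2^2))"

definition reverse_diagram :: "diagram \<Rightarrow> diagram" where
  "reverse_diagram D = \<lparr>curve = (\<lambda>t. curve D (- t)), over = {t. - t \<in> over D}\<rparr>"

text \<open>Parametrizations of one and the same oriented diagram.\<close>

definition same_diagram :: "diagram \<Rightarrow> diagram \<Rightarrow> bool" where
  "same_diagram D E \<longleftrightarrow>
     (\<exists>h :: real \<Rightarrow> real. smooth_on UNIV h \<and> (\<forall>t. deriv h t > 0) \<and> (\<forall>t. h (t + 1) = h t + 1) \<and>
       (\<forall>t. curve E t = curve D (h t)) \<and> (\<forall>t. t \<in> over E \<longleftrightarrow> h t \<in> over D))"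

definition plane_diffeo_move :: "diagram \<Rightarrow> diagram \<Rightarrow> bool" where
  "plane_diffeo_move D E \<longleftrightarrow>
     (\<exists>f. diffeomorphism UNIV UNIV f \<and> (\<forall>x. det (matrix (frechet_derivative f (at x))) > 0) \<and>
       curve E = f \<circ> curve D \<and> over E = over D)"


definition lifts :: "real set \<Rightarrow> real set" where
  "lifts S = {t + of_int k | t k. t \<in> S}"

text \<open>
  The part of the diagram in the disk \<open>\<phi> ` cball 0 1\<close> consists of \<open>n\<close> strands, which are listed in
  the (cyclic) order in which they are passed: strand \<open>i\<close> has the parameter interval \<open>[a i, b i]\<close>.
\<close>

definition strands_in_disk ::
    "(plane \<Rightarrow> plane) \<Rightarrow> nat \<Rightarrow> (nat \<Rightarrow> real) \<Rightarrow> (nat \<Rightarrow> real) \<Rightarrow> diagram \<Rightarrow> bool" where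
  "strands_in_disk \<phi> n a b D \<longleftrightarrow>
     (\<forall>i<n. a i < b i) \<and> (\<forall>i. Suc i < n \<longrightarrow> b i < a (Suc i)) \<and> b (n - 1) < a 0 + 1 \<and>
     (\<forall>t. curve D t \<in> \<phi> ` cball 0 1 \<longleftrightarrow> t \<in> lifts (\<Union>i<n. {a i..b i})) \<and>
     (\<forall>t. curve D t \<in> \<phi> ` ball 0 1 \<longleftrightarrow> t \<in> lifts (\<Union>i<n. {a i<..<b i}))"

definition changed_in_disk ::
    "(plane \<Rightarrow> plane) \<Rightarrow> nat \<Rightarrow> (nat \<Rightarrow> real) \<Rightarrow> (nat \<Rightarrow> real) \<Rightarrow> diagram \<Rightarrow> diagram \<Rightarrow> bool" where
  "changed_in_disk \<phi> n a b D E \<longleftrightarrow>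
     (\<exists>U V. cball 0 1 \<subseteq> U \<and> diffeomorphism U V \<phi>) \<and>
     strands_in_disk \<phi> n a b D \<and> strands_in_disk \<phi> n a b E \<and>
     (\<forall>t. t \<notin> lifts (\<Union>i<n. {a i..b i}) \<longrightarrow>
        curve E t = curve D t \<and> (t \<in> over E \<longleftrightarrow> t \<in> over D))"

definition strand_over :: "diagram \<Rightarrow> real set \<Rightarrow> real set \<Rightarrow> bool" where
  "strand_over D S T \<longleftrightarrow> (\<forall>s\<in>S. \<forall>t\<in>T. curve D s = curve D t \<longrightarrow> s \<in> over D \<and> t \<notin> over D)"

text \<open>
  The move creating a kink. An arc properly immersed in a disk with a single transversal double
  point is always an arc with a kink.
\<close>

definition omega1 :: "diagram \<Rightarrow> diagram \<Rightarrow> bool" where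
  "omega1 D E \<longleftrightarrow>
     (\<exists>\<phi> a b. changed_in_disk \<phi> 1 a b D E \<and>
       inj_on (curve D) {a 0..b 0} \<and>
       card {(s, t). a 0 \<le> s \<and> s < t \<and> t \<le> b 0 \<and> curve E s = curve E t} = 1)"

definition graph_in_disk :: "(real \<Rightarrow> real) \<Rightarrow> plane set" where
  "graph_in_disk h = range (\<lambda>x. vector [x, h x]) \<inter> cball 0 1"

text \<open>
  The move creating a bigon. In the model disk, strand 0 is the horizontal diameter and strand 1 is
  pushed from the line at height 1/2 to the graph of \<open>h\<close>, which meets the diameter twice
  (transversally, since the new diagram is a knot diagram). Which strand comes first is
  immaterial, as the numbering of the strands is cyclic.
\<close>

definition omega2 :: "diagram \<Rightarrow> diagram \<Rightarrow> bool" where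
  "omega2 D E \<longleftrightarrow>
     (\<exists>\<phi> a b h. changed_in_disk \<phi> 2 a b D E \<and>
       smooth_on UNIV h \<and> (\<forall>x. \<bar>h x\<bar> \<le> 1/2) \<and> (\<forall>x. \<bar>x\<bar> \<ge> 1/2 \<longrightarrow> h x = 1/2) \<and>
       card {x. h x = 0} = 2 \<and>
       curve D ` {a 0..b 0} = \<phi> ` graph_in_disk (\<lambda>x. 0) \<and>
       curve D ` {a 1..b 1} = \<phi> ` graph_in_disk (\<lambda>x. 1/2) \<and>
       curve E ` {a 0..b 0} = \<phi> ` graph_in_disk (\<lambda>x. 0) \<and>
       curve E ` {a 1..b 1} = \<phi> ` graph_in_disk h \<and>
       (strand_over E {a 0..b 0} {a 1..b 1} \<or> strand_over E {a 1..b 1} {a 0..b 0}))"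

text \<open>
  In the model of the triangle move, two strands are the diagonals and the third one, the graph of
  a function of slope less than 1 in absolute value, is slid across the origin.
  The condition on \<open>h\<close> and \<open>h'\<close> allows both directions, so the relation is symmetric.
  The permutation \<open>p\<close> allows each of the top, middle and bottom strands in each position of the model.
  Numbering the strands cyclically from the top strand (strand 0), the middle strand has number
  \<open>m\<close> and the bottom strand number \<open>l\<close>.
\<close>

definition omega3_model :: "(real \<Rightarrow> real) \<Rightarrow> nat \<Rightarrow> plane set" where
  "omega3_model h j = graph_in_disk (if j = 0 then (\<lambda>x. x) else if j = 1 then (\<lambda>x. - x) else h)"

definition omega3_function :: "(real \<Rightarrow> real) \<Rightarrow> bool" where
  "omega3_function h \<longleftrightarrow>
     smooth_on UNIV h \<and> (\<forall>x. \<bar>deriv h x\<bar> < 1) \<and> (\<forall>x. \<bar>x\<bar> \<ge> 1/2 \<longrightarrow> h x = 0)"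

definition omega3 :: "nat \<Rightarrow> nat \<Rightarrow> diagram \<Rightarrow> diagram \<Rightarrow> bool" where
  "omega3 m l D E \<longleftrightarrow>
     (\<exists>\<phi> a b h h' p. changed_in_disk \<phi> 3 a b D E \<and>
       omega3_function h \<and> omega3_function h' \<and> h 0 * h' 0 < 0 \<and> bij_betw p {..<3} {..<3} \<and>
       (\<forall>i<3. curve D ` {a i..b i} = \<phi> ` omega3_model h (p i)) \<and>
       (\<forall>i<3. curve E ` {a i..b i} = \<phi> ` omega3_model h' (p i)) \<and>
       (\<forall>F\<in>{D, E}.
          strand_over F {a 0..b 0} {a m..b m} \<and>
          strand_over F {a 0..b 0} {a l..b l} \<and>
          strand_over F {a m..b m} {a l..b l}))"


datatype orientation = Ascending | Descending

datatype move_kind = Plane_Diffeo | Omega1 | Omega2 | Omega3 orientation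

fun basic_move :: "move_kind \<Rightarrow> diagram \<Rightarrow> diagram \<Rightarrow> bool" where
  "basic_move Plane_Diffeo D E \<longleftrightarrow> plane_diffeo_move D E"
| "basic_move Omega1 D E \<longleftrightarrow> omega1 D E \<or> omega1 E D"
| "basic_move Omega2 D E \<longleftrightarrow> omega2 D E \<or> omega2 E D"
| "basic_move (Omega3 Descending) D E \<longleftrightarrow> omega3 1 2 D E"
| "basic_move (Omega3 Ascending) D E \<longleftrightarrow> omega3 2 1 D E"

definition move :: "move_kind \<Rightarrow> diagram \<Rightarrow> diagram \<Rightarrow> bool" where
  "move k D E \<longleftrightarrow> (\<exists>D' E'. same_diagram D D' \<and> basic_move k D' E' \<and> same_diagram E' E)"

text \<open>
  \<open>code\<close> lists, for the successive passages through crossings, the label of the crossing and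
  whether the passage is an overpass; \<open>\<epsilon>\<close> assigns to each label the sign of its crossing.
\<close>

definition has_gauss_code :: "diagram \<Rightarrow> (nat \<times> bool) list \<Rightarrow> (nat \<Rightarrow> real) \<Rightarrow> bool" where
  "has_gauss_code D code \<epsilon> \<longleftrightarrow>
     (\<exists>t. (\<forall>i j. i < j \<and> j < length code \<longrightarrow> t i < t j) \<and>
       t (length code - 1) < t 0 + 1 \<and>
       {u. \<exists>s. meets D s u} = lifts (t ` {..<length code}) \<and>
       (\<forall>i<length code. t i \<in> over D \<longleftrightarrow> snd (code ! i)) \<and>
       (\<forall>i<length code. \<forall>j<length code.
          curve D (t i) = curve D (t j) \<longleftrightarrow> fst (code ! i) = fst (code ! j)) \<and>
       (\<forall>i<length code. \<forall>j<length code.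
          fst (code ! i) = fst (code ! j) \<and> snd (code ! i) \<and> \<not> snd (code ! j) \<longrightarrow>
          crossing_sign D (t i) (t j) = \<epsilon> (fst (code ! i))))"

definition figure_eight :: "diagram \<Rightarrow> bool" where
  "figure_eight D \<longleftrightarrow> knot_diagram D \<and>
     has_gauss_code D
       [(1, False), (2, True), (3, False), (1, True), (4, False), (3, True), (2, False), (4, True)]
       (\<lambda>c. if c = 2 \<or> c = 3 then 1 else - 1)"

end

theory Submission
  imports Defs
begin

text \<open>
  The theorem is proved with a weighted count of subdiagrams. An arrow of a diagram is a pair of
  parameters of one crossing, the overpass first. The figure eight diagram itself is a pattern of four
  arrows: eight points \<open>t 0 < \<dots> < t 7\<close> on the circle, alternately under and over, such
  that the under point at an even place \<open>i\<close> is joined with the over point at the place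
  \<open>i + 3\<close>. The inverse diagram is the pattern with \<open>i - 3\<close> in place of \<open>i
  + 3\<close>. For \<open>p = 3\<close> and \<open>p = -3\<close>, let the count of a diagram be the
  number of occurrences of the pattern among its arrows, each weighted with the product of its four signs
  (\<open>figure_count p\<close>).

  All that matters for invariance is that over and under points alternate in the pattern, and the distance
  3 between the ends of an arrow.

  \<^item> The ends of a kink are neighbours on the circle. In the pattern the ends of an arrow never are,
    so a kink belongs to no occurrence (\<open>pattern_count_kink\<close>).

  \<^item> The two arrows of a bigon have neighbouring over points and neighbouring under points, and
    opposite signs. An occurrence cannot use both, since neighbours in it are of different kinds;
    exchanging the one for the other is an involution that reverses the sign, so that the occurrences
    which use one of them cancel (\<open>pattern_count_bigon\<close>).

  \<^item> In a triangle, each of the three strands carries two crossing points, and the move interchanges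
    these. It does no harm to an occurrence that uses at most one point of each strand. If it uses two
    points of a strand, then they are neighbours in it, one over and one under, hence the strand is the
    middle one. With \<open>p = 3\<close>, the other ends of the two arrows are then passed in the order
    top, bottom after the middle strand, which is the order of an ascending move. So the count with
    \<open>p = 3\<close> is unchanged by descending moves, and likewise the count with \<open>p =
    -3\<close> by ascending ones (\<open>pattern_count_triangle\<close>).

  The figure eight diagram contains its own pattern, always with weight 1, and not the one of its inverse;
  for the inverse diagram it is the other way round (\<open>figure_eight_counts\<close>). Therefore a
  sequence from the one to the other must change both counts, the first one at an ascending move and the
  second one at a descending move.

  It remains to read off the arrows and their signs from curves and moves. The arrows outside the disk of
  a move are common to both diagrams. Inside the disk, a strand whose image is the graph of a function in
  the model is traversed monotonically, by Rolle's theorem, because its velocity does not vanish. So the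
  sign of a crossing is determined by the orientation of the model chart, by the directions in which the
  two strands are traversed, and by the slopes of the two graphs (\<open>graph_crossing_sign\<close>). The
  directions are the same before and after the move, because the end points of the strands do not move.
\<close>

section \<open>Occurrences of the figure eight pattern\<close>

definition arrows :: "diagram \<Rightarrow> (real \<times> real) set" where
  "arrows D = {(s, u). meets D s u \<and> s \<in> over D}"

text \<open>
  An occurrence is a bi-infinite sequence, the lift to the line of eight points on the circle. This makes
  the condition on the partners uniform, without a case distinction at the end of the period.
\<close>

definition occurrences :: "int \<Rightarrow> (real \<times> real) set \<Rightarrow> (int \<Rightarrow> real) set" where
  "occurrences p R =
     {t. (\<forall>i. t i < t (i + 1)) \<and> (\<forall>i. t (i + 8) = t i + 1) \<and> (\<forall>i. even i \<longrightarrow> (t (i + p), t i) \<in> R)}"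

definition weight :: "int \<Rightarrow> (real \<Rightarrow> real \<Rightarrow> real) \<Rightarrow> (int \<Rightarrow> real) \<Rightarrow> real" where
  "weight p \<sigma> t = (\<Prod>i\<in>{0, 2, 4, 6}. \<sigma> (t (i + p)) (t i))"

text \<open>
  A sequence and its translates by integers are the same occurrence on the circle. The base point singles
  out one of them. The four rotations of the pattern by an even number of places are symmetries of it, so
  that every set of four arrows is counted four times; this is harmless.
\<close>

definition based_occurrences :: "int \<Rightarrow> (real \<times> real) set \<Rightarrow> real \<Rightarrow> (int \<Rightarrow> real) set" where
  "based_occurrences p R x = {t \<in> occurrences p R. x \<le> t 0 \<and> t 0 < x + 1}"

definition pattern_count :: "int \<Rightarrow> (real \<Rightarrow> real \<Rightarrow> real) \<Rightarrow> (real \<times> real) set \<Rightarrow> real \<Rightarrow> real" where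
  "pattern_count p \<sigma> R x = (\<Sum>t\<in>based_occurrences p R x. weight p \<sigma> t)"

definition periodic_arrows :: "(real \<times> real) set \<Rightarrow> bool" where
  "periodic_arrows R \<longleftrightarrow> (\<forall>s u k l. (s + of_int k, u + of_int l) \<in> R \<longleftrightarrow> (s, u) \<in> R)"

definition periodic_sign :: "(real \<Rightarrow> real \<Rightarrow> real) \<Rightarrow> bool" where
  "periodic_sign \<sigma> \<longleftrightarrow> (\<forall>s u k l. \<sigma> (s + of_int k) (u + of_int l) = \<sigma> s u)"

text \<open>
  The parameters of all crossings form a union of translates; this is the finiteness of the number of
  crossings.
\<close>

definition locally_finite :: "(real \<times> real) set \<Rightarrow> bool" where
  "locally_finite R \<longleftrightarrow> (\<forall>x y. finite (Field R \<inter> {x..y}))"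

lemma occurrences_less:
  assumes "t \<in> occurrences p R" "i < j"
  shows "t i < t j"
  using assms(2)
proof (induction j rule: int_gr_induct)
  case base
  then show ?case using assms(1) by (simp add: occurrences_def)
next
  case (step j)
  moreover have "t j < t (j + 1)" using assms(1) by (simp add: occurrences_def)
  ultimately show ?case by linarith
qed

lemma occurrences_le:
  assumes "t \<in> occurrences p R" "i \<le> j"
  shows "t i \<le> t j"
  using occurrences_less[OF assms(1), of i j] assms(2) by (cases "i = j") auto

lemma occurrences_less_iff:
  assumes "t \<in> occurrences p R"
  shows "t i < t j \<longleftrightarrow> i < j"
  using occurrences_less[OF assms] by (metis less_asym' linorder_neqE)

lemma shift_by_periods:
  fixes t :: "int \<Rightarrow> real"
  assumes "\<And>i. t (i + 8) = t i + 1"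
  shows "t (i + 8 * k) = t i + of_int k"
proof (induction k rule: int_induct[where k = 0])
  case base
  then show ?case by simp
next
  case (step1 k)
  have "t (i + 8 * (k + 1)) = t ((i + 8 * k) + 8)" by (simp add: algebra_simps)
  then show ?case using step1 assms[of "i + 8 * k"] by simp
next
  case (step2 k)
  have "t (i + 8 * k) = t ((i + 8 * (k - 1)) + 8)" by (simp add: algebra_simps)
  then show ?case using step2 assms[of "i + 8 * (k - 1)"] by simp
qed

lemma occurrences_period:
  assumes "t \<in> occurrences p R"
  shows "t (i + 8 * k) = t i + of_int k"
  using assms by (intro shift_by_periods) (simp add: occurrences_def)

lemma occurrences_int_diff:
  assumes t: "t \<in> occurrences p R" and "t i = t j + of_int k"
  shows "i = j + 8 * k"
  using assms occurrences_period[OF t, of j k] occurrences_less_iff[OF t]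
  by (metis less_irrefl linorder_neqE)

lemma occurrences_arrow:
  assumes "t \<in> occurrences p R" "even i"
  shows "(t (i + p), t i) \<in> R"
  using assms by (simp add: occurrences_def)

lemma occurrences_Range: 
  assumes "t \<in> occurrences p R" "even i"
  shows "t i \<in> Range R"
  using occurrences_arrow[OF assms] by blast

lemma occurrences_Domain: 
  assumes "t \<in> occurrences p R" "odd i" "odd p"
  shows "t i \<in> Domain R"
  using occurrences_arrow[OF assms(1), of "i - p"] assms by auto

lemma occurrences_Field: 
  assumes "t \<in> occurrences p R" "odd p"
  shows "t i \<in> Field R"
  using occurrences_Range[OF assms(1)] occurrences_Domain[OF assms(1) _ assms(2)]
  by (auto simp: Field_def)

lemma occurrences_translate:
  assumes "t \<in> occurrences p R" "periodic_arrows R"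
  shows "(\<lambda>i. t i + of_int k) \<in> occurrences p R"
  using assms by (auto simp: occurrences_def periodic_arrows_def)

lemma weight_translate:
  assumes "periodic_sign \<sigma>"
  shows "weight p \<sigma> (\<lambda>i. t i + of_int k) = weight p \<sigma> t"
  using assms by (simp add: weight_def periodic_sign_def)

lemma pattern_count_base:
  assumes "periodic_arrows R" "periodic_sign \<sigma>"
  shows "pattern_count p \<sigma> R x = pattern_count p \<sigma> R y"
proof -
  define sh where "sh = (\<lambda>y (t :: int \<Rightarrow> real) i. t i + of_int (- \<lfloor>t 0 - y\<rfloor>))"
  have sh_app: "sh y t i = t i + of_int (- \<lfloor>t 0 - y\<rfloor>)" for y t i
    by (simp add: sh_def)
  have sh_weight: "weight p \<sigma> (sh y t) = weight p \<sigma> t" for y t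
    unfolding sh_def by (rule weight_translate[OF assms(2)])
  have sh_in: "sh y t \<in> based_occurrences p R y" if "t \<in> based_occurrences p R x" for t x y
  proof -
    have "y \<le> sh y t 0" "sh y t 0 < y + 1"
      unfolding sh_def by (simp, linarith) (simp, linarith)
    then show ?thesis
      using that occurrences_translate[OF _ assms(1)]
      by (simp add: based_occurrences_def sh_def del: of_int_minus)
  qed
  have sh_sh: "sh x (sh y t) = t" if t: "t \<in> based_occurrences p R x" for t x y
  proof -
    have "\<lfloor>t 0 - x\<rfloor> = 0"
      using t by (simp add: based_occurrences_def floor_eq_iff)
    moreover have "sh y t 0 - x = (t 0 - x) - of_int \<lfloor>t 0 - y\<rfloor>" by (simp add: sh_def)
    ultimately have "\<lfloor>sh y t 0 - x\<rfloor> = - \<lfloor>t 0 - y\<rfloor>"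
      by (simp only: floor_diff_of_int)
    then have "sh x (sh y t) i = sh y t i + of_int \<lfloor>t 0 - y\<rfloor>" for i
      by (subst sh_app) simp
    then show ?thesis by (intro ext) (simp add: sh_app[of y t])
  qed
  show ?thesis
    unfolding pattern_count_def
    by (rule sum.reindex_bij_witness[where i = "sh x" and j = "sh y"])
      (auto intro: sh_in sh_sh simp: sh_weight)
qed

text \<open>
  An occurrence is determined by its first eight entries, which lie within two periods after the base
  point.
\<close>

lemma finite_based_occurrences:
  assumes "locally_finite R" "odd p"
  shows "finite (based_occurrences p R x)"
proof (rule inj_on_finite)
  let ?F = "Field R \<inter> {x..x + 2}"
  show "inj_on (\<lambda>t. map t [0..7]) (based_occurrences p R x)"
  proof (rule inj_onI)
    fix t u assume t: "t \<in> based_occurrences p R x" and u: "u \<in> based_occurrences p R x"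
      and eq: "map t [0..7] = map u [0..7]"
    show "t = u"
    proof
      fix i :: int
      have "i mod 8 \<in> set [0..7]" by simp
      with eq have "t (i mod 8) = u (i mod 8)" by (metis map_eq_conv)
      then show "t i = u i"
        using t u occurrences_period[of t p R "i mod 8" "i div 8"]
          occurrences_period[of u p R "i mod 8" "i div 8"]
        by (simp add: based_occurrences_def)
    qed
  qed
  show "(\<lambda>t. map t [0..7]) ` based_occurrences p R x \<subseteq> {xs. set xs \<subseteq> ?F \<and> length xs = 8}"
  proof clarsimp
    fix t assume "t \<in> based_occurrences p R x"
    then have t: "t \<in> occurrences p R" and 0: "x \<le> t 0" "t 0 < x + 1"
      by (auto simp: based_occurrences_def)
    show "t ` {0..7} \<subseteq> Field R \<and> t ` {0..7} \<subseteq> {x..x + 2}"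
    proof (intro conjI image_subsetI)
      fix i :: int assume i: "i \<in> {0..7}"
      show "t i \<in> Field R" by (rule occurrences_Field[OF t assms(2)])
      have "t 8 = t 0 + 1" using occurrences_period[OF t, of 0 1] by simp
      moreover have "t 0 \<le> t i" "t i < t 8" 
        using i occurrences_less_iff[OF t, of i 0] occurrences_less_iff[OF t, of i 8] by auto
      ultimately show "t i \<in> {x..x + 2}" using 0 by auto
    qed
  qed
  show "finite {xs. set xs \<subseteq> ?F \<and> length xs = 8}"
    using assms(1) by (intro finite_lists_length_eq) (simp add: locally_finite_def)
qed

section \<open>Strands and maps that respect them\<close>

text \<open>
  The parameter intervals of the strands in a disk, in the order in which they are passed within one
  period; \<open>strand q k\<close> below is the translate by \<open>k\<close> of the interval with number
  \<open>q\<close>.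
\<close>

locale strand_family =
  fixes n :: nat and a b :: "nat \<Rightarrow> real"
  assumes nonempty: "0 < n"
    and strand_less: "i < n \<Longrightarrow> a i < b i"
    and strand_next: "Suc i < n \<Longrightarrow> b i < a (Suc i)"
    and strand_last: "b (n - 1) < a 0 + 1"
begin

definition strand :: "nat \<Rightarrow> int \<Rightarrow> real set" where
  "strand q k = {a q + of_int k..b q + of_int k}"

definition window :: "real set" where
  "window = (\<Union>q<n. {a q..b q})"

definition covered :: "real set" where
  "covered = (\<Union>q<n. \<Union>k. strand q k)"

lemma covered_lifts: "covered = lifts (\<Union>q<n. {a q..b q})"
proof
  show "covered \<subseteq> lifts (\<Union>q<n. {a q..b q})"
  proof
    fix x assume "x \<in> covered"
    then obtain q k where q: "q < n" "x \<in> strand q k" by (auto simp: covered_def)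
    then have "x - of_int k \<in> (\<Union>q<n. {a q..b q})" by (auto simp: strand_def algebra_simps)
    moreover have "x = (x - of_int k) + of_int k" by simp
    ultimately show "x \<in> lifts (\<Union>q<n. {a q..b q})" unfolding lifts_def by blast
  qed
  show "lifts (\<Union>q<n. {a q..b q}) \<subseteq> covered"
  proof
    fix x assume "x \<in> lifts (\<Union>q<n. {a q..b q})"
    then obtain y k q where "x = y + of_int k" "q < n" "y \<in> {a q..b q}" by (auto simp: lifts_def)
    then have "q < n" "x \<in> strand q k" by (auto simp: strand_def)
    then show "x \<in> covered" by (auto simp: covered_def)
  qed
qed

lemma strand_order:
  assumes "r < n" "q < r"
  shows "b q < a r"
  using assms
proof (induction r)
  case 0
  then show ?case by simp
next
  case (Suc r)
  show ?case
  proof (cases "q = r")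
    case True
    then show ?thesis using strand_next Suc.prems by simp
  next
    case False
    then have "b q < a r" "a r < b r" "b r < a (Suc r)"
      using Suc strand_less strand_next by auto
    then show ?thesis by linarith
  qed
qed

lemma strand_bounds:
  assumes "q < n"
  shows "a 0 \<le> a q" "b q < a 0 + 1"
proof -
  show "a 0 \<le> a q"
  proof (cases "q = 0")
    case False
    then show ?thesis using strand_order[of q 0] strand_less[of 0] assms by auto
  qed simp
  show "b q < a 0 + 1"
  proof (cases "q = n - 1")
    case True
    then show ?thesis using strand_last by simp
  next
    case False
    then have "b q < a (n - 1)" "a (n - 1) < b (n - 1)"
      using strand_order[of "n - 1" q] strand_less[of "n - 1"] assms by auto
    then show ?thesis using strand_last by linarith
  qed
qed

lemma strand_separated:
  assumes "q < n" "r < n" and lt: "k < l \<or> k = l \<and> q < r"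
    and "x \<in> strand q k" "y \<in> strand r l"
  shows "x < y"
  using lt
proof
  assume "k < l"
  then have "real_of_int k + 1 \<le> real_of_int l" by linarith
  then show ?thesis
    using assms strand_bounds(2)[of q] strand_bounds(1)[of r] by (auto simp: strand_def)
next
  assume "k = l \<and> q < r"
  then show ?thesis using strand_order[of r q] assms by (auto simp: strand_def)
qed

lemma strand_unique:
  assumes "q < n" "r < n" "x \<in> strand q k" "x \<in> strand r l"
  shows "q = r" "k = l"
  using strand_separated[of q r k l x x] strand_separated[of r q l k x x] assms
  by (metis less_irrefl linorder_neqE)+

lemma strand_translate: "x + of_int l \<in> strand q (k + l) \<longleftrightarrow> x \<in> strand q k"
  by (auto simp: strand_def)

lemma strand_floor:
  assumes "q < n" "x \<in> strand q k"
  shows "\<lfloor>x - a 0\<rfloor> = k"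
  using strand_bounds[OF assms(1)] assms(2) by (auto simp: strand_def floor_eq_iff)

lemma strand_0: "strand q 0 = {a q..b q}"
  by (simp add: strand_def)

text \<open>
  The effect of a move on the parameters of crossings: it may rearrange points within a strand, but
  touches nothing else.
\<close>

definition strand_map :: "(real \<Rightarrow> real) \<Rightarrow> bool" where
  "strand_map \<tau> \<longleftrightarrow> (\<forall>x k. \<tau> (x + of_int k) = \<tau> x + of_int k) \<and>
     (\<forall>q<n. \<forall>k. \<tau> ` strand q k \<subseteq> strand q k) \<and> (\<forall>x. x \<notin> covered \<longrightarrow> \<tau> x = x)"

lemma strand_map_fixed: "strand_map \<tau> \<Longrightarrow> x \<notin> covered \<Longrightarrow> \<tau> x = x"
  by (simp add: strand_map_def)

lemma strand_map_strand: "strand_map \<tau> \<Longrightarrow> q < n \<Longrightarrow> x \<in> strand q k \<Longrightarrow> \<tau> x \<in> strand q k"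
  by (simp add: strand_map_def image_subset_iff)

text \<open>
  Since the strands are disjoint intervals that are mapped to themselves, order can be lost only within
  one strand.
\<close>

lemma strand_map_less:
  assumes \<tau>: "strand_map \<tau>" and "x < y"
    and apart: "\<And>q k. q < n \<Longrightarrow> x \<in> strand q k \<Longrightarrow> y \<notin> strand q k"
  shows "\<tau> x < \<tau> y"
proof -
  note in_strand = strand_map_strand[OF \<tau>] and fixed = strand_map_fixed[OF \<tau>]
  show ?thesis
  proof (cases "x \<in> covered")
    case True
    then obtain q k where q: "q < n" "x \<in> strand q k" by (auto simp: covered_def)
    have \<tau>x: "\<tau> x \<in> strand q k" using in_strand q .
    show ?thesis
    proof (cases "y \<in> covered")
      case True
      then obtain r l where r: "r < n" "y \<in> strand r l" by (auto simp: covered_def)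
      have "k < l \<or> k = l \<and> q < r"
        using strand_separated[of r q l k y x] q r apart[of q k] \<open>x < y\<close>
        by (metis less_asym linorder_neqE)
      then show ?thesis using strand_separated q r \<tau>x in_strand by blast
    next
      case False
      then have "y \<notin> strand q k" using q by (auto simp: covered_def)
      then show ?thesis using q \<tau>x \<open>x < y\<close> fixed[OF False] by (auto simp: strand_def)
    qed
  next
    case False
    show ?thesis
    proof (cases "y \<in> covered")
      case True
      then obtain r l where r: "r < n" "y \<in> strand r l" by (auto simp: covered_def)
      have "\<tau> y \<in> strand r l" using in_strand r .
      moreover have "x \<notin> strand r l" using r False by (auto simp: covered_def)
      ultimately show ?thesis using r \<open>x < y\<close> fixed[OF False] by (auto simp: strand_def)
    next
      case False': False
      then show ?thesis using fixed False \<open>x < y\<close> by simp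
    qed
  qed
qed

text \<open>
  No two neighbours of the sequence lie in one strand. For an occurrence this already means that it has at
  most one point in each strand modulo 1, as \<open>spread_once\<close> shows.
\<close>

definition spread :: "(int \<Rightarrow> real) \<Rightarrow> bool" where
  "spread t \<longleftrightarrow> (\<forall>i. \<forall>q<n. \<forall>k. t i \<in> strand q k \<longrightarrow> t (i + 1) \<notin> strand q k)"

text \<open>
  Of two points in one strand modulo 1, each one can be taken to be the earlier one. In one of the two
  cases they lie in the same interval, together with all points of the sequence between them.
\<close>

lemma spread_once:
  assumes t: "t \<in> occurrences p R" and "spread t"
    and q: "q < n" "t i \<in> strand q k" "t j \<in> strand q l" and ij: "i < j" "j < i + 8"
  shows False
proof -
  have tij: "t i < t j" using occurrences_less[OF t] ij by blast
  have t8: "t (i + 8) = t i + 1" using occurrences_period[OF t, of i 1] by simp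
  have tji: "t j < t i + 1" using occurrences_less[OF t ij(2)] t8 by simp
  have "\<not> l < k" using strand_separated[of q q l k "t j" "t i"] q tij by auto
  moreover have i1: "t (i + 8) \<in> strand q (k + 1)"
    using q(2) strand_translate[of "t i" 1 q k] t8 by simp
  then have "\<not> k + 1 < l" using strand_separated[of q q "k + 1" l "t (i + 8)" "t j"] q t8 tji by auto
  ultimately consider "l = k" | "l = k + 1" by linarith
  then show False
  proof cases
    case 1
    have "t i < t (i + 1)" "t (i + 1) \<le> t j"
      using occurrences_less[OF t, of i "i + 1"] occurrences_le[OF t, of "i + 1" j] ij by auto
    then have "t (i + 1) \<in> strand q k" using q 1 by (auto simp: strand_def)
    then show ?thesis using \<open>spread t\<close> q unfolding spread_def by blast
  next
    case 2
    have "t j < t (j + 1)" "t (j + 1) \<le> t (i + 8)"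
      using occurrences_less[OF t, of j "j + 1"] occurrences_le[OF t, of "j + 1" "i + 8"] ij by auto
    then have "t (j + 1) \<in> strand q (k + 1)" using q 2 i1 by (auto simp: strand_def)
    then show ?thesis using \<open>spread t\<close> q 2 unfolding spread_def by blast
  qed
qed

lemma occurrences_transport:
  assumes t: "t \<in> occurrences p R" and sp: "spread t" and \<tau>: "strand_map \<tau>"
    and R: "\<And>s u. (s, u) \<in> R \<Longrightarrow> (\<tau> s, \<tau> u) \<in> R'"
  shows "\<tau> \<circ> t \<in> occurrences p R'"
proof -
  have "\<tau> (t i) < \<tau> (t (i + 1))" for i
    using sp occurrences_less[OF t, of i "i + 1"] unfolding spread_def
    by (intro strand_map_less[OF \<tau>]) auto
  moreover have "\<tau> (t (i + 8)) = \<tau> (t i) + 1" for i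
  proof -
    have "t (i + 8) = t i + of_int 1" using occurrences_period[OF t, of i 1] by simp
    then show ?thesis using \<tau> unfolding strand_map_def by (metis of_int_1)
  qed
  ultimately show ?thesis using t R by (simp add: occurrences_def)
qed

lemma strand_map_window:
  assumes \<tau>: "strand_map \<tau>" and x: "a 0 \<le> x" "x < a 0 + 1"
  shows "a 0 \<le> \<tau> x" "\<tau> x < a 0 + 1"
proof -
  have "a 0 \<le> \<tau> x \<and> \<tau> x < a 0 + 1"
  proof (cases "x \<in> covered")
    case True
    then obtain q k where q: "q < n" "x \<in> strand q k" by (auto simp: covered_def)
    have "\<lfloor>x - a 0\<rfloor> = 0" using x by (simp add: floor_eq_iff)
    then have "k = 0" using strand_floor[OF q] by simp
    then have "\<tau> x \<in> {a q..b q}" using \<tau> q unfolding strand_map_def strand_0[symmetric] by blast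
    then show ?thesis using strand_bounds[OF q(1)] by auto
  next
    case False
    then show ?thesis using \<tau> x by (auto simp: strand_map_def)
  qed
  then show "a 0 \<le> \<tau> x" "\<tau> x < a 0 + 1" by auto
qed

lemma based_occurrences_transport:
  assumes t: "t \<in> based_occurrences p R (a 0)" and sp: "spread t" and \<tau>: "strand_map \<tau>"
    and R: "\<And>s u. (s, u) \<in> R \<Longrightarrow> (\<tau> s, \<tau> u) \<in> R'"
  shows "\<tau> \<circ> t \<in> based_occurrences p R' (a 0)"
  using occurrences_transport[OF _ sp \<tau> R] strand_map_window[OF \<tau>, of "t 0"] t
  by (auto simp: based_occurrences_def)

definition periodic_extension :: "(real \<Rightarrow> real) \<Rightarrow> real \<Rightarrow> real" where
  "periodic_extension g x = g (x - of_int \<lfloor>x - a 0\<rfloor>) + of_int \<lfloor>x - a 0\<rfloor>"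

lemma periodic_extension_translate:
  "periodic_extension g (x + of_int k) = periodic_extension g x + of_int k"
proof -
  have "x + of_int k - a 0 = (x - a 0) + of_int k" by simp
  then have "\<lfloor>x + of_int k - a 0\<rfloor> = \<lfloor>x - a 0\<rfloor> + k" by (simp only: floor_add_int)
  then show ?thesis by (simp add: periodic_extension_def)
qed

lemma periodic_extension_strand:
  assumes "q < n" "x \<in> strand q k"
  shows "periodic_extension g x = g (x - of_int k) + of_int k"
  by (simp add: periodic_extension_def strand_floor[OF assms])

lemma periodic_extension_window:
  assumes "x \<in> window"
  shows "periodic_extension g x = g x"
  using assms periodic_extension_strand[of _ x 0 g] by (auto simp: window_def strand_0)

lemma covered_translate: "x + of_int k \<in> covered \<longleftrightarrow> x \<in> covered"
proof -
  have "x + of_int k \<in> covered" if "x \<in> covered" for x k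
    using that strand_translate unfolding covered_def by blast
  from this[of "x + of_int k" "- k"] this[of x k] show ?thesis by auto
qed

lemma strand_map_periodic_extension:
  assumes g: "\<And>q. q < n \<Longrightarrow> g ` {a q..b q} \<subseteq> {a q..b q}" and fixed: "\<And>x. x \<notin> window \<Longrightarrow> g x = x"
  shows "strand_map (periodic_extension g)"
  unfolding strand_map_def
proof (intro conjI allI impI)
  fix q k assume q: "q < n"
  show "periodic_extension g ` strand q k \<subseteq> strand q k"
  proof (rule image_subsetI)
    fix x assume x: "x \<in> strand q k"
    then have "x - of_int k \<in> {a q..b q}" by (auto simp: strand_def)
    then have "g (x - of_int k) \<in> {a q..b q}" using g[OF q] by blast
    then show "periodic_extension g x \<in> strand q k"
      unfolding periodic_extension_strand[OF q x] by (auto simp: strand_def)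
  qed
next
  fix x assume x: "x \<notin> covered"
  moreover have "window \<subseteq> covered" by (auto simp: window_def covered_def simp flip: strand_0)
  ultimately have "x - of_int \<lfloor>x - a 0\<rfloor> \<notin> window"
    using covered_translate[of x "- \<lfloor>x - a 0\<rfloor>"] by auto
  then show "periodic_extension g x = x" by (simp add: periodic_extension_def fixed)
qed (rule periodic_extension_translate)

end

section \<open>The pattern count under local changes of the arrows\<close>

definition translates :: "(real \<times> real) set \<Rightarrow> (real \<times> real) set" where
  "translates K = {(s + of_int k, u + of_int l) | s u k l. (s, u) \<in> K}"

lemma translatesI: "(s, u) \<in> K \<Longrightarrow> (s + of_int k, u + of_int l) \<in> translates K"
  unfolding translates_def by blast

lemma translatesE:
  assumes "(x, y) \<in> translates K"
  obtains s u k l where "(s, u) \<in> K" "x = s + of_int k" "y = u + of_int l"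
  using assms unfolding translates_def by blast

lemma periodic_Domain:
  assumes "periodic_arrows R" "x \<in> Domain R"
  shows "x + of_int k \<in> Domain R"
proof -
  obtain y where "(x, y) \<in> R" using assms(2) by blast
  then have "(x + of_int k, y + of_int 0) \<in> R" using assms(1) unfolding periodic_arrows_def by blast
  then show ?thesis by blast
qed

lemma periodic_Range:
  assumes "periodic_arrows R" "x \<in> Range R"
  shows "x + of_int k \<in> Range R"
proof -
  obtain y where "(y, x) \<in> R" using assms(2) by blast
  then have "(y + of_int 0, x + of_int k) \<in> R" using assms(1) unfolding periodic_arrows_def by blast
  then show ?thesis by blast
qed

lemma occurrences_mono: "R \<subseteq> R' \<Longrightarrow> occurrences p R \<subseteq> occurrences p R'"
  by (auto simp: occurrences_def)

lemma based_occurrences_mono: "R \<subseteq> R' \<Longrightarrow> based_occurrences p R x \<subseteq> based_occurrences p R' x"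
  using occurrences_mono[of R R' p] by (auto simp: based_occurrences_def)

lemma weight_cong:
  assumes t: "t \<in> occurrences p R" and "\<And>s u. (s, u) \<in> R \<Longrightarrow> \<sigma>' (f s) (f u) = \<sigma> s u"
  shows "weight p \<sigma>' (f \<circ> t) = weight p \<sigma> t"
proof -
  have "\<sigma>' (f (t (i + p))) (f (t i)) = \<sigma> (t (i + p)) (t i)" if "even i" for i
    using occurrences_arrow[OF t that] by (rule assms(2))
  then show ?thesis unfolding weight_def comp_def by (intro prod.cong) auto
qed

lemma pattern_count_cong:
  assumes "\<And>s u. (s, u) \<in> R \<Longrightarrow> \<sigma>' s u = \<sigma> s u"
  shows "pattern_count p \<sigma>' R x = pattern_count p \<sigma> R x"
  unfolding pattern_count_def
proof (rule sum.cong)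
  fix t assume "t \<in> based_occurrences p R x"
  then have "weight p \<sigma>' (id \<circ> t) = weight p \<sigma> t"
    using assms by (intro weight_cong[of t p R]) (auto simp: based_occurrences_def)
  then show "weight p \<sigma>' t = weight p \<sigma> t" by simp
qed simp

context strand_family
begin

lemma translates_strand:
  assumes K: "K \<subseteq> window \<times> window" and xy: "(x, y) \<in> translates K"
  shows "x \<in> covered" "y \<in> covered"
proof -
  obtain s u k l where su: "(s, u) \<in> K" "x = s + of_int k" "y = u + of_int l"
    using xy by (rule translatesE)
  moreover have "window \<subseteq> covered" by (auto simp: window_def covered_def simp flip: strand_0)
  ultimately show "x \<in> covered" "y \<in> covered" using K covered_translate by auto
qed

lemma translates_map:
  assumes K: "K \<subseteq> window \<times> window" "\<And>s u. (s, u) \<in> K \<Longrightarrow> (g s, g u) \<in> K'"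
    and xy: "(x, y) \<in> translates K"
  shows "(periodic_extension g x, periodic_extension g y) \<in> translates K'"
proof -
  obtain s u k l where su: "(s, u) \<in> K" "x = s + of_int k" "y = u + of_int l"
    using xy by (rule translatesE)
  then have "periodic_extension g x = g s + of_int k" "periodic_extension g y = g u + of_int l"
    using K periodic_extension_window by (auto simp: periodic_extension_translate)
  then show ?thesis using translatesI[OF K(2)[OF su(1)]] by simp
qed

lemma translates_inverse:
  assumes K: "K \<subseteq> window \<times> window" "K' \<subseteq> window \<times> window"
    "\<And>s u. (s, u) \<in> K \<Longrightarrow> (g s, g u) \<in> K' \<and> g' (g s) = s \<and> g' (g u) = u"
    and x: "x \<in> Field (translates K)"
  shows "periodic_extension g' (periodic_extension g x) = x"
proof -
  obtain z k where z: "z \<in> Field K" "x = z + of_int k"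
    using x unfolding Field_def by (fastforce elim: translatesE)
  then have "z \<in> window" "g z \<in> window" "g' (g z) = z"
    using K unfolding Field_def by blast+
  then show ?thesis using z by (simp add: periodic_extension_translate periodic_extension_window)
qed

lemma sign_translates:
  assumes K: "K \<subseteq> window \<times> window" "\<And>s u. (s, u) \<in> K \<Longrightarrow> \<sigma>' (g s) (g u) = c * \<sigma> s u"
    and \<sigma>: "periodic_sign \<sigma>" "periodic_sign \<sigma>'"
    and xy: "(x, y) \<in> translates K"
  shows "\<sigma>' (periodic_extension g x) (periodic_extension g y) = c * \<sigma> x y"
proof -
  obtain s u k l where su: "(s, u) \<in> K" "x = s + of_int k" "y = u + of_int l"
    using xy by (rule translatesE)
  then have "periodic_extension g x = g s + of_int k" "periodic_extension g y = g u + of_int l"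
    using K periodic_extension_window by (auto simp: periodic_extension_translate)
  then show ?thesis using K(2)[OF su(1)] \<sigma> su by (simp add: periodic_sign_def)
qed

text \<open>
  The two sets of arrows agree outside the strands, and \<open>g\<close> carries the arrows inside of the
  first to those of the second. If occurrences are spread, then \<open>g\<close> does not disturb their
  order and induces a bijection between the occurrences.
\<close>

lemma pattern_count_slide:
  assumes R: "R = Ro \<union> translates K" and R': "R' = Ro \<union> translates K'"
    and odd: "odd p"
    and Ro: "Field Ro \<inter> covered = {}"
    and K: "K \<subseteq> window \<times> window" "K' \<subseteq> window \<times> window"
    and g: "\<And>q. q < n \<Longrightarrow> g ` {a q..b q} \<subseteq> {a q..b q}" "\<And>x. x \<notin> window \<Longrightarrow> g x = x"
    and g': "\<And>q. q < n \<Longrightarrow> g' ` {a q..b q} \<subseteq> {a q..b q}" "\<And>x. x \<notin> window \<Longrightarrow> g' x = x"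
    and gK: "\<And>s u. (s, u) \<in> K \<Longrightarrow> (g s, g u) \<in> K' \<and> g' (g s) = s \<and> g' (g u) = u"
    and gK': "\<And>s u. (s, u) \<in> K' \<Longrightarrow> (g' s, g' u) \<in> K \<and> g (g' s) = s \<and> g (g' u) = u"
    and \<sigma>: "periodic_sign \<sigma>" "periodic_sign \<sigma>'"
    and \<sigma>Ro: "\<And>s u. (s, u) \<in> Ro \<Longrightarrow> \<sigma>' s u = \<sigma> s u"
    and \<sigma>K: "\<And>s u. (s, u) \<in> K \<Longrightarrow> \<sigma>' (g s) (g u) = \<sigma> s u"
    and spread: "\<And>t. t \<in> occurrences p R \<Longrightarrow> spread t" "\<And>t. t \<in> occurrences p R' \<Longrightarrow> spread t"
  shows "pattern_count p \<sigma> R (a 0) = pattern_count p \<sigma>' R' (a 0)"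
proof -
  let ?\<tau> = "periodic_extension g" and ?\<tau>' = "periodic_extension g'"
  have \<tau>: "strand_map ?\<tau>" "strand_map ?\<tau>'"
    using strand_map_periodic_extension g g' by auto
  have fixed: "?\<tau> x = x" "?\<tau>' x = x" if "x \<in> Field Ro" for x
    using strand_map_fixed[OF \<tau>(1), of x] strand_map_fixed[OF \<tau>(2), of x] that Ro by auto
  have fixed2: "?\<tau> s = s \<and> ?\<tau> u = u \<and> ?\<tau>' s = s \<and> ?\<tau>' u = u" if "(s, u) \<in> Ro" for s u
    using fixed FieldI1[OF that] FieldI2[OF that] by simp
  have RR': "(?\<tau> s, ?\<tau> u) \<in> R'" if "(s, u) \<in> R" for s u
    using that unfolding R
  proof
    assume "(s, u) \<in> translates K"
    then have "(?\<tau> s, ?\<tau> u) \<in> translates K'" using gK by (intro translates_map[OF K(1)]) auto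
    then show ?thesis by (simp add: R')
  qed (simp add: fixed2 R')
  have R'R: "(?\<tau>' s, ?\<tau>' u) \<in> R" if "(s, u) \<in> R'" for s u
    using that unfolding R'
  proof
    assume "(s, u) \<in> translates K'"
    then have "(?\<tau>' s, ?\<tau>' u) \<in> translates K" using gK' by (intro translates_map[OF K(2)]) auto
    then show ?thesis by (simp add: R)
  qed (simp add: fixed2 R)
  have inv: "?\<tau>' (?\<tau> x) = x" if "x \<in> Field R" for x
  proof (cases "x \<in> Field Ro")
    case False
    then have "x \<in> Field (translates K)" using that by (simp add: R Field_Un)
    then show ?thesis using translates_inverse[OF K gK] by blast
  qed (simp add: fixed)
  have inv': "?\<tau> (?\<tau>' x) = x" if "x \<in> Field R'" for x
  proof (cases "x \<in> Field Ro")
    case False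
    then have "x \<in> Field (translates K')" using that by (simp add: R' Field_Un)
    then show ?thesis using translates_inverse[OF K(2,1) gK'] by blast
  qed (simp add: fixed)
  have \<sigma>\<tau>: "\<sigma>' (?\<tau> s) (?\<tau> u) = \<sigma> s u" if "(s, u) \<in> R" for s u
    using that unfolding R
  proof
    assume su: "(s, u) \<in> Ro"
    then have "s \<in> Field Ro" "u \<in> Field Ro" by (auto simp: Field_def)
    then show ?thesis using fixed \<sigma>Ro[OF su] by simp
  next
    assume "(s, u) \<in> translates K"
    then show ?thesis using sign_translates[OF K(1) _ \<sigma>, of g 1] \<sigma>K by simp
  qed
  show ?thesis
    unfolding pattern_count_def
  proof (rule sum.reindex_bij_witness[where i = "\<lambda>t. ?\<tau>' \<circ> t" and j = "\<lambda>t. ?\<tau> \<circ> t"])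
    fix t assume t: "t \<in> based_occurrences p R (a 0)"
    then have t': "t \<in> occurrences p R" by (simp add: based_occurrences_def)
    show "?\<tau>' \<circ> (?\<tau> \<circ> t) = t"
      using inv occurrences_Field[OF t' odd] by auto
    show "?\<tau> \<circ> t \<in> based_occurrences p R' (a 0)"
      using based_occurrences_transport[OF t spread(1)[OF t'] \<tau>(1) RR'] .
    show "weight p \<sigma>' (?\<tau> \<circ> t) = weight p \<sigma> t"
      by (rule weight_cong[OF t']) (rule \<sigma>\<tau>)
  next
    fix t assume t: "t \<in> based_occurrences p R' (a 0)"
    then have t': "t \<in> occurrences p R'" by (simp add: based_occurrences_def)
    show "?\<tau> \<circ> (?\<tau>' \<circ> t) = t"
      using inv' occurrences_Field[OF t' odd] by auto
    show "?\<tau>' \<circ> t \<in> based_occurrences p R (a 0)"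
      using based_occurrences_transport[OF t spread(2)[OF t'] \<tau>(2) R'R] .
  qed
qed

lemma Field_covered_translates:
  assumes R: "R = Ro \<union> translates K" and Ro: "Field Ro \<inter> covered = {}"
    and K: "K \<subseteq> window \<times> window"
    and x: "q < n" "x \<in> strand q k" "x \<in> Field R"
  shows "\<exists>z. z \<in> Field K \<and> z \<in> {a q..b q} \<and> x = z + of_int k"
proof -
  have "x \<in> covered" using x by (auto simp: covered_def)
  then have "x \<in> Field (translates K)" using x Ro unfolding R Field_Un by blast
  then obtain z l where z: "z \<in> Field K" "x = z + of_int l"
    unfolding Field_def by (fastforce elim: translatesE)
  then have "z \<in> window" using K unfolding Field_def by blast
  then obtain r where r: "r < n" "z \<in> strand r 0" by (auto simp: window_def strand_0)
  then have "x \<in> strand r l" using z strand_translate[of z l r 0] by simp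
  then have "r = q" "l = k" using strand_unique r x by blast+
  then show ?thesis using r z by (auto simp: strand_0)
qed

text \<open>
  Both ends of the kink lie in one strand and are the only crossing points there, so that in an occurrence
  they would be at neighbouring places.
\<close>

lemma pattern_count_kink:
  assumes R: "R = Ro \<union> translates {(s0, u0)}" and p: "p = 3 \<or> p = - 3"
    and Ro: "Field Ro \<inter> covered = {}"
    and q: "q < n" "s0 \<in> {a q..b q}" "u0 \<in> {a q..b q}"
    and \<sigma>Ro: "\<And>s u. (s, u) \<in> Ro \<Longrightarrow> \<sigma>' s u = \<sigma> s u"
  shows "pattern_count p \<sigma>' R x = pattern_count p \<sigma> Ro x"
proof -
  have K: "{(s0, u0)} \<subseteq> window \<times> window" using q by (auto simp: window_def)
  have "t \<in> occurrences p Ro" if t: "t \<in> occurrences p R" for t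
  proof (rule ccontr)
    assume "t \<notin> occurrences p Ro"
    then obtain i where i: "even i" "(t (i + p), t i) \<notin> Ro"
      using t by (auto simp: occurrences_def)
    then have "(t (i + p), t i) \<in> translates {(s0, u0)}"
      using occurrences_arrow[OF t i(1)] R by blast
    then obtain k l where kl: "t (i + p) = s0 + of_int k" "t i = u0 + of_int l"
      by (auto elim: translatesE)
    then have "t (i + p) \<in> strand q k" "t i \<in> strand q l"
      using q by (auto simp: strand_def)
    \<comment> \<open>The ends of the kink are only three places apart in the occurrence, in one strand modulo 1.\<close>
    then have "\<not> spread t"
      using spread_once[OF t _ q(1), of i l "i + p" k] spread_once[OF t _ q(1), of "i + p" k i l] p by auto
    then obtain j r m where j: "r < n" "t j \<in> strand r m" "t (j + 1) \<in> strand r m"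
      unfolding spread_def by blast
    have odd: "odd p" using p by auto
    have cases: "t j' = s0 + of_int m \<or> t j' = u0 + of_int m" if "t j' \<in> strand r m" for j'
      using Field_covered_translates[OF R Ro K j(1) that occurrences_Field[OF t odd]]
      by (auto simp: Field_def)
    have "t j \<noteq> t (j + 1)" using occurrences_less[OF t, of j "j + 1"] by simp
    then consider "t j = s0 + of_int m" "t (j + 1) = u0 + of_int m"
      | "t j = u0 + of_int m" "t (j + 1) = s0 + of_int m"
      using cases j by metis
    then show False
    proof cases
      case 1
      then have "j = i + p + 8 * (m - k)" "j + 1 = i + 8 * (m - l)"
        using kl occurrences_int_diff[OF t, of j "i + p" "m - k"]
          occurrences_int_diff[OF t, of "j + 1" i "m - l"] by auto
      \<comment> \<open>Two neighbouring places joined by an arrow would require \<open>p\<close> to be 1 or -1 modulo 8.\<close>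
      then show ?thesis using p by presburger
    next
      case 2
      then have "j = i + 8 * (m - l)" "j + 1 = i + p + 8 * (m - k)"
        using kl occurrences_int_diff[OF t, of j i "m - l"]
          occurrences_int_diff[OF t, of "j + 1" "i + p" "m - k"] by auto
      then show ?thesis using p by presburger
    qed
  qed
  then have "occurrences p R = occurrences p Ro"
    using occurrences_mono[of Ro R p] R by blast
  then have "based_occurrences p R x = based_occurrences p Ro x"
    by (simp add: based_occurrences_def)
  then show ?thesis
    using pattern_count_cong[OF \<sigma>Ro] by (simp add: pattern_count_def)
qed

text \<open>
  Neighbours in an occurrence are of different kinds, one over and one under.
\<close>

lemma spread_of_uniform_strands:
  assumes t: "t \<in> occurrences p R" and odd: "odd p" and per: "periodic_arrows R"
    and uniform: "\<And>q. q < n \<Longrightarrow> Domain R \<inter> {a q..b q} = {} \<or> Range R \<inter> {a q..b q} = {}"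
  shows "spread t"
proof (rule ccontr)
  assume "\<not> spread t"
  then obtain i q k where i: "q < n" "t i \<in> strand q k" "t (i + 1) \<in> strand q k"
    unfolding spread_def by blast
  have sub: "x - of_int k \<in> {a q..b q}" if "x \<in> strand q k" for x
    using that by (auto simp: strand_def)
  have no: "x \<notin> Domain R \<or> y \<notin> Range R" if xy: "x \<in> strand q k" "y \<in> strand q k" for x y
  proof (rule ccontr)
    assume "\<not> (x \<notin> Domain R \<or> y \<notin> Range R)"
    then have "x - of_int k \<in> Domain R" "y - of_int k \<in> Range R"
      using periodic_Domain[OF per, of x "- k"] periodic_Range[OF per, of y "- k"] by auto
    then show False using uniform[OF i(1)] sub[OF xy(1)] sub[OF xy(2)] by blast
  qed
  show False
  proof (cases "even i")
    case True
    then show ?thesis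
      using no[OF i(3,2)] occurrences_Range[OF t, of i] occurrences_Domain[OF t _ odd, of "i + 1"] by auto
  next
    case False
    then show ?thesis
      using no[OF i(2,3)] occurrences_Range[OF t, of "i + 1"] occurrences_Domain[OF t _ odd, of i] by auto
  qed
qed

end

context strand_family
begin

lemma interval_unique:
  assumes "q < n" "r < n" "x \<in> {a q..b q}" "x \<in> {a r..b r}"
  shows "q = r"
  using strand_unique(1)[of q r x 0 0] assms by (simp add: strand_0)

text \<open>
  The exchange of the two arrows is an involution on the occurrences that use one of them. Such an
  occurrence uses exactly one of them, because each of the two strands carries points of one kind only, so
  that the exchange changes exactly one of the four signs.
\<close>

lemma pattern_count_bigon:
  assumes R: "R = Ro \<union> translates {(s1, u1), (s2, u2)}" and odd: "odd p"
    and Ro: "Field Ro \<inter> covered = {}"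
    and PQ: "P < n" "Q < n" "P \<noteq> Q"
    and s: "s1 \<in> {a P..b P}" "s2 \<in> {a P..b P}" "s1 \<noteq> s2"
    and u: "u1 \<in> {a Q..b Q}" "u2 \<in> {a Q..b Q}" "u1 \<noteq> u2"
    and per: "periodic_arrows R" "periodic_sign \<sigma>" and fin: "locally_finite R"
    and disj: "Domain R \<inter> Range R = {}"
    and \<sigma>Ro: "\<And>s u. (s, u) \<in> Ro \<Longrightarrow> \<sigma>' s u = \<sigma> s u"
    and opposite: "\<sigma> s1 u1 = - \<sigma> s2 u2"
  shows "pattern_count p \<sigma> R (a 0) = pattern_count p \<sigma>' Ro (a 0)"
proof -
  define K where "K = {(s1, u1), (s2, u2)}"
  have R: "R = Ro \<union> translates K" using R by (simp add: K_def)
  have KW: "K \<subseteq> window \<times> window" using PQ s u by (auto simp: K_def window_def)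
  have su: "s \<noteq> u" if "s \<in> {a P..b P}" "u \<in> {a Q..b Q}" for s u
    using that interval_unique PQ by blast
  have ne: "s1 \<noteq> u1" "s1 \<noteq> u2" "s2 \<noteq> u1" "s2 \<noteq> u2" using su s u by auto
  have K_R: "K \<subseteq> R" using translatesI[of _ _ K 0 0] by (auto simp: R)
  have uniform: "Domain R \<inter> {a q..b q} = {} \<or> Range R \<inter> {a q..b q} = {}" if q: "q < n" for q
  proof -
    have "x = s1 \<or> x = s2 \<or> x = u1 \<or> x = u2" if "x \<in> Field R" "x \<in> {a q..b q}" for x
      using Field_covered_translates[OF R Ro KW q, of x 0] that by (auto simp: strand_0 K_def Field_def)
    then have pts: "(x \<in> {s1, s2} \<and> q = P) \<or> (x \<in> {u1, u2} \<and> q = Q)" if "x \<in> Field R" "x \<in> {a q..b q}" for x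
      using that interval_unique[OF q PQ(1)] interval_unique[OF q PQ(2)] s(1,2) u(1,2) by (metis insertCI)
    have K_ends: "s1 \<in> Domain R" "s2 \<in> Domain R" "u1 \<in> Range R" "u2 \<in> Range R"
      using K_R by (auto simp: K_def)
    show ?thesis
    proof (cases "q = Q")
      case True
      then have "x \<notin> Domain R" if "x \<in> {a q..b q}" for x
        using pts[OF _ that] K_ends disj PQ(3) unfolding Field_def by blast
      then show ?thesis by blast
    next
      case False
      then have "x \<notin> Range R" if "x \<in> {a q..b q}" for x
        using pts[OF _ that] K_ends disj unfolding Field_def by blast
      then show ?thesis by blast
    qed
  qed
  have spread: "spread t" if "t \<in> occurrences p R" for t
    using spread_of_uniform_strands[OF that odd per(1) uniform] .
  define g where "g = (\<lambda>x. if x = s1 then s2 else if x = s2 then s1 else if x = u1 then u2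
    else if x = u2 then u1 else x)"
  let ?\<tau> = "periodic_extension g"
  have \<tau>: "strand_map ?\<tau>"
  proof (rule strand_map_periodic_extension)
    show "g ` {a q..b q} \<subseteq> {a q..b q}" if q: "q < n" for q
    proof (rule image_subsetI)
      fix x assume x: "x \<in> {a q..b q}"
      consider "x \<in> {s1, s2}" "q = P" | "x \<in> {u1, u2}" "q = Q" | "x \<notin> {s1, s2, u1, u2}"
        using x interval_unique[OF q PQ(1) x] interval_unique[OF q PQ(2) x] s(1,2) u(1,2) by blast
      then show "g x \<in> {a q..b q}"
      proof cases
        case 1
        then have "g x \<in> {s1, s2}" by (auto simp: g_def)
        then show ?thesis using 1 s by blast
      next
        case 2
        then have "g x \<in> {u1, u2}" using ne by (auto simp: g_def)
        then show ?thesis using 2 u by blast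
      next
        case 3
        then have "g x = x" by (auto simp: g_def)
        then show ?thesis using x by simp
      qed
    qed
    show "g x = x" if "x \<notin> window" for x
      using that s u PQ by (auto simp: g_def window_def)
  qed
  have gK: "(g s, g u) \<in> K \<and> g (g s) = s \<and> g (g u) = u" if "(s, u) \<in> K" for s u
    using that s(3) u(3) ne by (auto simp: K_def g_def)
  note fixed = strand_map_fixed[OF \<tau>]
  have moves: "?\<tau> x \<in> covered" if "x \<in> covered" for x
    using strand_map_strand[OF \<tau>, of _ x] that by (auto simp: covered_def)
  have Ro_fixed: "?\<tau> s = s \<and> ?\<tau> u = u" if "(s, u) \<in> Ro" for s u
    using fixed[of s] fixed[of u] FieldI1[OF that] FieldI2[OF that] Ro by auto
  have RR: "(?\<tau> s, ?\<tau> u) \<in> R" if "(s, u) \<in> R" for s u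
    using that unfolding R
  proof
    assume "(s, u) \<in> translates K"
    then have "(?\<tau> s, ?\<tau> u) \<in> translates K" using gK by (intro translates_map[OF KW]) auto
    then show "(?\<tau> s, ?\<tau> u) \<in> Ro \<union> translates K" by simp
  qed (simp add: Ro_fixed)
  have inv: "?\<tau> (?\<tau> x) = x" if "x \<in> Field R" for x
  proof (cases "x \<in> Field Ro")
    case True
    then have "x \<notin> covered" using Ro by blast
    then show ?thesis by (simp add: fixed)
  next
    case False
    then have "x \<in> Field (translates K)" using that by (simp add: R Field_Un)
    then show ?thesis using translates_inverse[OF KW KW gK] by blast
  qed
  have flip: "\<sigma> (?\<tau> s) (?\<tau> u) = - \<sigma> s u" if "(s, u) \<in> translates K" for s u
  proof -
    have g: "g s1 = s2" "g s2 = s1" "g u1 = u2" "g u2 = u1"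
      using s(3) u(3) ne by (simp_all add: g_def)
    have "\<sigma> (g s) (g u) = - 1 * \<sigma> s u" if "(s, u) \<in> K" for s u
    proof -
      from that consider "s = s1" "u = u1" | "s = s2" "u = u2" by (auto simp: K_def)
      then show ?thesis by cases (simp_all add: g opposite)
    qed
    from sign_translates[OF KW this per(2,2) that] show ?thesis by simp
  qed
  define A where "A = based_occurrences p R (a 0)"
  \<comment> \<open>The occurrences that use one of the two arrows.\<close>
  define B where "B = A - based_occurrences p Ro (a 0)"
  have A_occ: "t \<in> occurrences p R" if "t \<in> A" for t
    using that by (simp add: A_def based_occurrences_def)
  have \<tau>\<tau>: "?\<tau> \<circ> (?\<tau> \<circ> t) = t" if "t \<in> A" for t
    using inv occurrences_Field[OF A_occ[OF that] odd] by auto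
  have B_closed: "?\<tau> \<circ> t \<in> B" if t: "t \<in> B" for t
  proof -
    have tA: "t \<in> A" using t by (simp add: B_def)
    have "?\<tau> \<circ> t \<in> A"
      using based_occurrences_transport[OF _ spread[OF A_occ[OF tA]] \<tau> RR] tA by (simp add: A_def)
    moreover have False if "?\<tau> \<circ> t \<in> occurrences p Ro"
    proof -
      have "?\<tau> (t i) \<notin> covered" for i
        using occurrences_Field[OF that odd, of i] Ro by auto
      then have "?\<tau> (t i) = t i" for i using moves fixed by blast
      then have "?\<tau> \<circ> t = t" by auto
      then show False using that t tA by (auto simp: B_def A_def based_occurrences_def)
    qed
    ultimately show ?thesis by (auto simp: B_def based_occurrences_def)
  qed
  have B_weight: "weight p \<sigma> (?\<tau> \<circ> t) = - weight p \<sigma> t" if t: "t \<in> B" for t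
  proof -
    have occ: "t \<in> occurrences p R" using t A_occ by (simp add: B_def)
    define I where "I = {0, 2, 4, 6 :: int}"
    have "t \<notin> occurrences p Ro" using t by (auto simp: B_def A_def based_occurrences_def)
    then obtain j where j: "even j" "(t (j + p), t j) \<notin> Ro"
      using occ by (auto simp: occurrences_def)
    \<comment> \<open>The place, among those in the weight, at which one of the two arrows is used.\<close>
    define i0 where "i0 = j mod 8"
    have i0: "i0 \<in> I" unfolding I_def i0_def using j(1) by (auto, presburger)
    have "(t (j + p), t j) \<in> translates K" using occurrences_arrow[OF occ j(1)] j(2) R by blast
    then have "t j \<in> covered" using translates_strand[OF KW] by blast
    moreover have "t j = t i0 + of_int (j div 8)"
      using occurrences_period[OF occ, of i0 "j div 8"] by (simp add: i0_def)
    ultimately have i0_cov: "t i0 \<in> covered" using covered_translate by simp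
    have even_I: "even i" if "i \<in> I" for i using that by (auto simp: I_def)
    have range_K: "(t (i + p), t i) \<in> translates K \<and> (\<exists>k. t i \<in> strand Q k)" if "i \<in> I" "t i \<in> covered" for i
    proof -
      have "(t (i + p), t i) \<in> R" using occurrences_arrow[OF occ even_I[OF that(1)]] .
      then have K: "(t (i + p), t i) \<in> translates K"
        using that(2) Ro unfolding R Field_def by blast
      then obtain k where "t i = u1 + of_int k \<or> t i = u2 + of_int k"
        by (auto simp: K_def elim!: translatesE)
      then have "t i \<in> strand Q k" using u by (auto simp: strand_def)
      with K show ?thesis by blast
    qed
    have others: "\<sigma> (?\<tau> (t (i + p))) (?\<tau> (t i)) = \<sigma> (t (i + p)) (t i)" if i: "i \<in> I" "i \<noteq> i0" for i
    proof -
      have "t i \<notin> covered"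
      proof
        assume "t i \<in> covered"
        then obtain k l where "t i \<in> strand Q k" "t i0 \<in> strand Q l"
          using range_K i i0 i0_cov by blast
        moreover have "i < i0 \<and> i0 < i + 8 \<or> i0 < i \<and> i < i0 + 8" using i i0 by (auto simp: I_def)
        ultimately show False using spread_once[OF occ spread[OF occ] PQ(2)] by blast
      qed
      then have "(t (i + p), t i) \<in> Ro"
        using occurrences_arrow[OF occ even_I[OF i(1)]] translates_strand[OF KW] R by blast
      then show ?thesis using Ro_fixed by simp
    qed
    have I: "finite I" by (simp add: I_def)
    have "weight p \<sigma> (?\<tau> \<circ> t) = (\<Prod>i\<in>I. \<sigma> (?\<tau> (t (i + p))) (?\<tau> (t i)))"
      by (simp add: weight_def I_def)
    also have "\<dots> = \<sigma> (?\<tau> (t (i0 + p))) (?\<tau> (t i0)) * (\<Prod>i\<in>I - {i0}. \<sigma> (?\<tau> (t (i + p))) (?\<tau> (t i)))"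
      by (rule prod.remove[OF I i0])
    also have "\<dots> = - \<sigma> (t (i0 + p)) (t i0) * (\<Prod>i\<in>I - {i0}. \<sigma> (t (i + p)) (t i))"
      using flip range_K[OF i0 i0_cov] others by (auto intro!: prod.cong)
    also have "\<dots> = - (\<Prod>i\<in>I. \<sigma> (t (i + p)) (t i))"
      using prod.remove[OF I i0, of "\<lambda>i. \<sigma> (t (i + p)) (t i)"] by simp
    finally show ?thesis by (simp add: weight_def I_def)
  qed
  have "(\<Sum>t\<in>B. weight p \<sigma> t) = (\<Sum>t\<in>B. - weight p \<sigma> t)"
    by (rule sum.reindex_bij_witness[where i = "\<lambda>t. ?\<tau> \<circ> t" and j = "\<lambda>t. ?\<tau> \<circ> t"])
      (use \<tau>\<tau> B_closed B_weight in \<open>auto simp: B_def\<close>)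
  then have B0: "(\<Sum>t\<in>B. weight p \<sigma> t) = 0" by (simp add: sum_negf)
  have "finite A" unfolding A_def by (rule finite_based_occurrences[OF fin odd])
  moreover have "based_occurrences p Ro (a 0) \<subseteq> A"
    unfolding A_def by (rule based_occurrences_mono) (auto simp: R)
  ultimately have "pattern_count p \<sigma> R (a 0) = pattern_count p \<sigma> Ro (a 0)"
    using B0 sum.subset_diff[of "based_occurrences p Ro (a 0)" A "weight p \<sigma>"]
    by (simp add: pattern_count_def A_def B_def)
  also have "\<dots> = pattern_count p \<sigma>' Ro (a 0)" using pattern_count_cong \<sigma>Ro by metis
  finally show ?thesis .
qed

text \<open>
  Within one period the strands are passed in the cyclic order 0, 1, 2, and not in the order 2, 1, 0.
\<close>

lemma cyclic_order_contradiction: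
  assumes n: "n = 3" and x: "x \<in> strand 2 j" and y: "y \<in> strand 1 k" and z: "z \<in> strand 0 l"
    and "x < y" "y < z" "z < x + 1"
  shows False
proof -
  have "j < k" using strand_separated[of 1 2 k j y x] assms by fastforce
  moreover have "k < l" using strand_separated[of 0 1 l k z y] assms by fastforce
  moreover have "x + 1 \<in> strand 2 (j + 1)" using strand_translate[of x 1 2 j] x by simp
  then have "\<not> j + 1 < l" using strand_separated[of 2 0 "j + 1" l "x + 1" z] assms by fastforce
  ultimately show False by linarith
qed

text \<open>
  The strand 0 is the top strand, \<open>m\<close> the middle and \<open>l\<close> the bottom one;
  \<open>X q r\<close> is the parameter on the strand \<open>q\<close> of its crossing with the strand
  \<open>r\<close>.
\<close>

definition triangle :: "(nat \<Rightarrow> nat \<Rightarrow> real) \<Rightarrow> nat \<Rightarrow> nat \<Rightarrow> (real \<times> real) set" where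
  "triangle X m l = {(X 0 m, X m 0), (X 0 l, X l 0), (X m l, X l m)}"

lemma triangleE:
  assumes "(s, u) \<in> triangle X m l"
  obtains q r where "(q, r) \<in> {(0, m), (0, l), (m, l)}" "s = X q r" "u = X r q"
proof -
  consider "s = X 0 m" "u = X m 0" | "s = X 0 l" "u = X l 0" | "s = X m l" "u = X l m"
    using assms by (auto simp: triangle_def)
  then show ?thesis
  proof cases
    case 1
    then show ?thesis by (intro that[of 0 m]) simp_all
  next
    case 2
    then show ?thesis by (intro that[of 0 l]) simp_all
  next
    case 3
    then show ?thesis by (intro that[of m l]) simp_all
  qed
qed

definition strand_points :: "(nat \<Rightarrow> nat \<Rightarrow> real) \<Rightarrow> bool" where
  "strand_points X \<longleftrightarrow> (\<forall>q<n. \<forall>r<n. q \<noteq> r \<longrightarrow> X q r \<in> {a q..b q} \<and> (\<forall>r'<n. r' \<noteq> q \<longrightarrow> X q r = X q r' \<longrightarrow> r = r'))"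

lemma strand_points_in:
  assumes "strand_points X" "q < n" "r < n" "q \<noteq> r"
  shows "X q r \<in> {a q..b q}"
  using assms(1)[unfolded strand_points_def, rule_format, OF assms(2-)] by (rule conjunct1)

lemma strand_points_inj:
  assumes "strand_points X" "q < n" "r < n" "q \<noteq> r" "r' < n" "r' \<noteq> q" "X q r = X q r'"
  shows "r = r'"
  using assms(1)[unfolded strand_points_def, rule_format, OF assms(2-4)] assms(5-) by blast

lemma windowI: "q < n \<Longrightarrow> x \<in> {a q..b q} \<Longrightarrow> x \<in> window"
  unfolding window_def by blast

text \<open>
  This is where the two kinds of triangle moves differ. Top and bottom strand carry points of one kind, so
  only the middle strand could contain two neighbours of an occurrence. Their partners lie on the top and
  on the bottom strand, and \<open>p\<close> determines the cyclic order of the three strands: it is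
  middle, top, bottom for \<open>p = 3\<close> and middle, bottom, top for \<open>p = -3\<close>. The
  assumption says that it is the opposite one.
\<close>

lemma spread_triangle:
  assumes n: "n = 3" and R: "R = Ro \<union> translates (triangle X m l)"
    and Ro: "Field Ro \<inter> covered = {}" and X: "strand_points X"
    and ml: "m = 1 \<and> l = 2 \<and> p = 3 \<or> m = 2 \<and> l = 1 \<and> p = - 3"
    and t: "t \<in> occurrences p R"
  shows "spread t"
proof (rule ccontr)
  assume "\<not> spread t"
  then obtain i q k where i: "q < n" "t i \<in> strand q k" "t (i + 1) \<in> strand q k"
    unfolding spread_def by blast
  have odd: "odd p" using ml by auto
  have X_in: "X q r \<in> {a q..b q}" if "q < 3" "r < 3" "q \<noteq> r" for q r
  proof -
    have "q < n" "r < n" using that n by auto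
    then show ?thesis using strand_points_in[OF X] that(3) by simp
  qed
  have found: "\<exists>q r j j'. (q, r) \<in> {(0, m), (0, l), (m, l)} \<and> x \<in> strand q j \<and> y \<in> strand r j'"
    if "(x, y) \<in> R" "x \<in> covered \<or> y \<in> covered" for x y
  proof -
    have "(x, y) \<in> translates (triangle X m l)" using that(1,2) Ro unfolding R Field_def by blast
    then obtain s u k' k'' where su: "(s, u) \<in> triangle X m l" "x = s + of_int k'" "y = u + of_int k''"
      by (rule translatesE)
    obtain q r where qr: "(q, r) \<in> {(0, m), (0, l), (m, l)}" "s = X q r" "u = X r q"
      using su(1) by (rule triangleE)
    then have "s \<in> {a q..b q}" "u \<in> {a r..b r}" using X_in[of q r] X_in[of r q] ml by auto
    then have "x \<in> strand q k'" "y \<in> strand r k''" using su by (auto simp: strand_def)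
    with qr(1) show ?thesis
      by (intro exI[of _ q] exI[of _ r] exI[of _ k'] exI[of _ k''] conjI)
  qed
  have q_cov: "t i \<in> covered" "t (i + 1) \<in> covered" using i by (auto simp: covered_def)
  \<comment> \<open>The under point and the over point among the two neighbours.\<close>
  define e where "e = (if even i then i else i + 1)"
  define o' where "o' = (if even i then i + 1 else i)"
  have eo: "t e \<in> strand q k" "t o' \<in> strand q k" "t e \<in> covered" "t o' \<in> covered" "even e" "even (o' - p)"
    using i q_cov odd by (auto simp: e_def o'_def)
  have "(t (e + p), t e) \<in> R" using occurrences_arrow[OF t eo(5)] .
  from found[OF this] obtain \<alpha> \<beta> k1 k2
    where 1: "(\<alpha>, \<beta>) \<in> {(0, m), (0, l), (m, l)}" "t (e + p) \<in> strand \<alpha> k1" "t e \<in> strand \<beta> k2"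
    using eo(3) by blast
  have "(t o', t (o' - p)) \<in> R" using occurrences_arrow[OF t eo(6)] by simp
  from found[OF this] obtain \<alpha>' \<beta>' k3 k4
    where 2: "(\<alpha>', \<beta>') \<in> {(0, m), (0, l), (m, l)}" "t o' \<in> strand \<alpha>' k3" "t (o' - p) \<in> strand \<beta>' k4"
    using eo(4) by blast
  have "\<beta> < n" "\<alpha>' < n" using 1(1) 2(1) ml n by auto
  then have "\<beta> = q" "\<alpha>' = q" using strand_unique(1) i(1) eo 1(3) 2(2) by blast+
  then have q: "q = m" "\<alpha> = 0" "\<beta>' = l" using 1(1) 2(1) ml by auto
  have T: "t (e + p) \<in> strand 0 k1" "t (o' - p) \<in> strand l k4" using 1(2) 2(3) q by auto
  have t8: "t (j + 8) = t j + 1" for j using occurrences_period[OF t, of j 1] by simp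
  have T': "t (e + p + 8) \<in> strand 0 (k1 + 1)"
    using T(1) strand_translate[of "t (e + p)" 1 0 k1] t8 by simp
  show False
    using ml
  proof
    assume a: "m = 1 \<and> l = 2 \<and> p = 3"
    have "o' - p < i" "i < e + p" "e + p < o' - p + 8" using a by (auto simp: e_def o'_def)
    then show False
      using cyclic_order_contradiction[OF n, of "t (o' - p)" k4 "t i" k "t (e + p)" k1] T i q a
        occurrences_less[OF t] t8[of "o' - p"] by metis
  next
    assume a: "m = 2 \<and> l = 1 \<and> p = - 3"
    have "i < o' - p" "o' - p < e + p + 8" "e + p + 8 < i + 8" using a by (auto simp: e_def o'_def)
    then show False
      using cyclic_order_contradiction[OF n, of "t i" k "t (o' - p)" k4 "t (e + p + 8)" "k1 + 1"] T T' i q a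
        occurrences_less[OF t] t8[of i] by metis
  qed
qed

text \<open>
  The map that takes the crossing points \<open>X q r\<close> of one diagram to the corresponding points
  \<open>Y q r\<close> of another and fixes all other parameters.
\<close>

definition transfer :: "(nat \<Rightarrow> nat \<Rightarrow> real) \<Rightarrow> (nat \<Rightarrow> nat \<Rightarrow> real) \<Rightarrow> real \<Rightarrow> real" where
  "transfer X Y z = (if \<exists>q<n. \<exists>r<n. q \<noteq> r \<and> z = X q r
     then THE w. \<exists>q<n. \<exists>r<n. q \<noteq> r \<and> z = X q r \<and> w = Y q r else z)"

lemma transfer_point:
  assumes X: "strand_points X" and qr: "q < n" "r < n" "q \<noteq> r"
  shows "transfer X Y (X q r) = Y q r"
proof -
  have "q' = q \<and> r' = r" if "q' < n" "r' < n" "q' \<noteq> r'" "X q r = X q' r'" for q' r'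
  proof -
    have "X q r \<in> {a q..b q}" "X q' r' \<in> {a q'..b q'}"
      by (rule strand_points_in[OF X qr], rule strand_points_in[OF X that(1-3)])
    then have q: "q' = q" using interval_unique[OF qr(1) that(1), of "X q r"] that(4) by simp
    then have "r = r'" using strand_points_inj[OF X qr that(2)] that(3,4) by simp
    with q show ?thesis by simp
  qed
  then have "(THE w. \<exists>q'<n. \<exists>r'<n. q' \<noteq> r' \<and> X q r = X q' r' \<and> w = Y q' r') = Y q r"
    using qr by (intro the_equality) blast+
  moreover have "\<exists>q'<n. \<exists>r'<n. q' \<noteq> r' \<and> X q r = X q' r'" using qr by blast
  ultimately show ?thesis unfolding transfer_def by simp
qed

lemma transfer_strand:
  assumes X: "strand_points X" and Y: "strand_points Y" and "q < n"
  shows "transfer X Y ` {a q..b q} \<subseteq> {a q..b q}"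
proof (rule image_subsetI)
  fix z assume z: "z \<in> {a q..b q}"
  show "transfer X Y z \<in> {a q..b q}"
  proof (cases "\<exists>q<n. \<exists>r<n. q \<noteq> r \<and> z = X q r")
    case True
    then obtain q' r where r: "q' < n" "r < n" "q' \<noteq> r" "z = X q' r" by blast
    then have "z \<in> {a q'..b q'}" using strand_points_in[OF X r(1-3)] by simp
    then have "q' = q" using interval_unique[OF r(1) assms(3)] z by blast
    then show ?thesis using transfer_point[OF X r(1-3)] strand_points_in[OF Y r(1-3)] r(4) by simp
  next
    case False
    then have "transfer X Y z = z" unfolding transfer_def by (rule if_not_P)
    then show ?thesis using z by simp
  qed
qed

lemma transfer_fixed:
  assumes X: "strand_points X" and "z \<notin> window"
  shows "transfer X Y z = z"
proof -
  have "\<not> (\<exists>q<n. \<exists>r<n. q \<noteq> r \<and> z = X q r)"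
    using strand_points_in[OF X] windowI assms(2) by blast
  then show ?thesis unfolding transfer_def by (rule if_not_P)
qed

lemma pattern_count_triangle:
  assumes n: "n = 3"
    and R: "R = Ro \<union> translates (triangle X m l)" and R': "R' = Ro \<union> translates (triangle Y m l)"
    and ml: "m = 1 \<and> l = 2 \<and> p = 3 \<or> m = 2 \<and> l = 1 \<and> p = - 3"
    and Ro: "Field Ro \<inter> covered = {}" and XY: "strand_points X" "strand_points Y"
    and \<sigma>: "periodic_sign \<sigma>" "periodic_sign \<sigma>'"
    and \<sigma>Ro: "\<And>s u. (s, u) \<in> Ro \<Longrightarrow> \<sigma>' s u = \<sigma> s u"
    and \<sigma>XY: "\<And>q r. q < n \<Longrightarrow> r < n \<Longrightarrow> q \<noteq> r \<Longrightarrow> (X q r, X r q) \<in> R \<Longrightarrow> \<sigma>' (Y q r) (Y r q) = \<sigma> (X q r) (X r q)"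
  shows "pattern_count p \<sigma> R (a 0) = pattern_count p \<sigma>' R' (a 0)"
proof (rule pattern_count_slide[OF R R' _ Ro, where g = "transfer X Y" and g' = "transfer Y X"])
  have in_tri: "\<exists>q r. q < n \<and> r < n \<and> q \<noteq> r \<and> s = Z q r \<and> u = Z r q \<and> (\<forall>Z. (Z q r, Z r q) \<in> triangle Z m l)"
    if "(s, u) \<in> triangle Z m l" for s u Z
  proof -
    from that obtain q r where qr: "(q, r) \<in> {(0, m), (0, l), (m, l)}" "s = Z q r" "u = Z r q"
      by (rule triangleE)
    then have "q < n" "r < n" "q \<noteq> r" using ml n by auto
    moreover have "\<forall>Z. (Z q r, Z r q) \<in> triangle Z m l" using qr(1) by (auto simp: triangle_def)
    ultimately show ?thesis using qr(2,3) by (intro exI[of _ q] exI[of _ r] conjI)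
  qed
  have in_window: "triangle Z m l \<subseteq> window \<times> window" if Z: "strand_points Z" for Z
  proof (rule subrelI)
    fix s u assume "(s, u) \<in> triangle Z m l"
    then obtain q r where "q < n" "r < n" "q \<noteq> r" "s = Z q r" "u = Z r q" using in_tri by blast
    then show "(s, u) \<in> window \<times> window"
      using windowI[OF _ strand_points_in[OF Z]] by simp
  qed
  show "odd p" using ml by auto
  show "triangle X m l \<subseteq> window \<times> window" "triangle Y m l \<subseteq> window \<times> window"
    using in_window XY by simp_all
  show "(transfer X Y s, transfer X Y u) \<in> triangle Y m l \<and>
      transfer Y X (transfer X Y s) = s \<and> transfer Y X (transfer X Y u) = u"
    if "(s, u) \<in> triangle X m l" for s u
  proof -
    from in_tri[OF that] obtain q r where "q < n" "r < n" "q \<noteq> r" "s = X q r" "u = X r q" "(Y q r, Y r q) \<in> triangle Y m l"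
      by blast
    then show ?thesis using transfer_point XY by simp
  qed
  show "(transfer Y X s, transfer Y X u) \<in> triangle X m l \<and>
      transfer X Y (transfer Y X s) = s \<and> transfer X Y (transfer Y X u) = u"
    if "(s, u) \<in> triangle Y m l" for s u
  proof -
    from in_tri[OF that] obtain q r where "q < n" "r < n" "q \<noteq> r" "s = Y q r" "u = Y r q" "(X q r, X r q) \<in> triangle X m l"
      by blast
    then show ?thesis using transfer_point XY by simp
  qed
  show "\<sigma>' (transfer X Y s) (transfer X Y u) = \<sigma> s u" if su: "(s, u) \<in> triangle X m l" for s u
  proof -
    from in_tri[OF su] obtain q r where qr: "q < n" "r < n" "q \<noteq> r" "s = X q r" "u = X r q"
      by blast
    have "(s, u) \<in> R" using translatesI[OF su, of 0 0] R by simp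
    then show ?thesis using qr transfer_point XY \<sigma>XY by simp
  qed
  show "\<And>t. t \<in> occurrences p R \<Longrightarrow> spread t" "\<And>t. t \<in> occurrences p R' \<Longrightarrow> spread t"
    using spread_triangle[OF n R Ro XY(1) ml] spread_triangle[OF n R' Ro XY(2) ml] by auto
qed (use transfer_strand transfer_fixed XY \<sigma> \<sigma>Ro in auto)

end

section \<open>Regular diagrams\<close>

text \<open>
  What is used of a knot diagram. Reparametrizations preserve this by the ordinary chain rule, whereas
  smoothness would require one of higher order.
\<close>

definition regular_diagram :: "diagram \<Rightarrow> bool" where
  "regular_diagram D \<longleftrightarrow>
     (\<forall>t. curve D differentiable (at t)) \<and>
     (\<forall>t. curve D (t + 1) = curve D t) \<and>
     (\<forall>t. velocity D t \<noteq> 0) \<and>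
     (\<forall>s t. meets D s t \<longrightarrow> det (vector [velocity D s, velocity D t] :: real^2^2) \<noteq> 0) \<and>
     (\<forall>r s t. meets D r s \<and> meets D s t \<longrightarrow> r - t \<in> \<int>) \<and>
     (\<forall>t. t + 1 \<in> over D \<longleftrightarrow> t \<in> over D) \<and>
     (\<forall>s t. meets D s t \<longrightarrow> (s \<in> over D \<longleftrightarrow> t \<notin> over D))"

lemma smooth_on_differentiable: "smooth_on U f \<Longrightarrow> x \<in> U \<Longrightarrow> f differentiable (at x)"
  unfolding smooth_on_def by (drule spec[of _ "Suc 0"]) simp

lemma regular_of_knot_diagram: "knot_diagram D \<Longrightarrow> regular_diagram D"
  unfolding knot_diagram_def regular_diagram_def using smooth_on_differentiable[of UNIV "curve D"] by simp

lemma shift_int: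
  assumes "\<And>t. P (t + 1 :: real) = P t"
  shows "P (t + of_int k) = P t"
proof (induction k rule: int_induct[where k = 0])
  case (step1 k)
  have "P (t + of_int (k + 1)) = P ((t + of_int k) + 1)" by (simp add: add.assoc)
  then show ?case using step1 assms by simp
next
  case (step2 k)
  have "P (t + of_int k) = P ((t + of_int (k - 1)) + 1)" by simp
  then show ?case using step2 assms[of "t + of_int (k - 1)"] by simp
qed simp

locale regular =
  fixes D :: diagram
  assumes regular: "regular_diagram D"
begin

lemma curve_translate [simp]: "curve D (t + of_int k) = curve D t"
  using regular by (intro shift_int[of "curve D"]) (simp add: regular_diagram_def)

lemma over_translate [simp]: "t + of_int k \<in> over D \<longleftrightarrow> t \<in> over D"
  using regular by (intro shift_int[of "\<lambda>t. t \<in> over D"]) (simp add: regular_diagram_def)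

lemma curve_derivative: "(curve D has_vector_derivative velocity D t) (at t)"
  using regular unfolding regular_diagram_def velocity_def vector_derivative_works[symmetric] by blast

lemma velocity_translate [simp]: "velocity D (t + of_int k) = velocity D t"
proof -
  have "((\<lambda>x. x + of_int k) has_vector_derivative 1) (at t)" for t :: real
    by (auto intro!: derivative_eq_intros)
  from vector_diff_chain_at[OF this curve_derivative[of "t + of_int k"]]
  have "(curve D has_vector_derivative velocity D (t + of_int k)) (at t)"
    by (simp add: comp_def)
  then show ?thesis
    using vector_derivative_unique_at curve_derivative by blast
qed

lemma velocity_nonzero: "velocity D t \<noteq> 0"
  using regular by (simp add: regular_diagram_def)

lemma transversal: "meets D s t \<Longrightarrow> det (vector [velocity D s, velocity D t] :: real^2^2) \<noteq> 0"
  using regular by (simp add: regular_diagram_def)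

lemma no_triple: "meets D r s \<Longrightarrow> meets D s t \<Longrightarrow> r - t \<in> \<int>"
  using regular unfolding regular_diagram_def by blast

lemma over_under: "meets D s t \<Longrightarrow> s \<in> over D \<longleftrightarrow> t \<notin> over D"
  using regular unfolding regular_diagram_def by blast

lemma meets_translate [simp]: "meets D (s + of_int k) (t + of_int l) \<longleftrightarrow> meets D s t"
proof -
  have "s + of_int k - (t + of_int l) \<in> \<int> \<longleftrightarrow> s - t \<in> \<int>"
  proof
    assume "s + of_int k - (t + of_int l) \<in> \<int>"
    then have "s + of_int k - (t + of_int l) + of_int (l - k) \<in> \<int>" by (intro Ints_add Ints_of_int)
    then show "s - t \<in> \<int>" by simp
  next
    assume "s - t \<in> \<int>"
    then have "s - t + of_int (k - l) \<in> \<int>" by (intro Ints_add Ints_of_int)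
    then show "s + of_int k - (t + of_int l) \<in> \<int>" by (simp add: algebra_simps)
  qed
  then show ?thesis by (simp add: meets_def)
qed

lemma periodic_arrows: "periodic_arrows (arrows D)"
  by (simp add: periodic_arrows_def arrows_def)

lemma periodic_sign: "periodic_sign (crossing_sign D)"
  by (simp add: periodic_sign_def crossing_sign_def)

lemma over_if_Domain: "x \<in> Domain (arrows D) \<Longrightarrow> x \<in> over D"
  by (auto simp: arrows_def)

lemma not_over_if_Range: "x \<in> Range (arrows D) \<Longrightarrow> x \<notin> over D"
  using over_under by (auto simp: arrows_def)

lemma Domain_Range: "Domain (arrows D) \<inter> Range (arrows D) = {}"
  using over_if_Domain not_over_if_Range by blast

end

lemma meets_sym: "meets D s t \<longleftrightarrow> meets D t s"
proof -
  have "s - t \<in> \<int> \<longleftrightarrow> t - s \<in> \<int>" by (metis Ints_minus minus_diff_eq)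
  then show ?thesis by (auto simp: meets_def)
qed

text \<open>
  The base point 0 is arbitrary, see \<open>figure_count_base\<close>; in the proofs it is placed at the
  beginning of the first strand in the disk of a move.
\<close>

definition figure_count :: "int \<Rightarrow> diagram \<Rightarrow> real" where
  "figure_count p D = pattern_count p (crossing_sign D) (arrows D) 0"

lemma (in regular) figure_count_base:
  "figure_count p D = pattern_count p (crossing_sign D) (arrows D) x"
  unfolding figure_count_def by (rule pattern_count_base[OF periodic_arrows periodic_sign])

section \<open>Reparametrization\<close>

definition reparametrization :: "(real \<Rightarrow> real) \<Rightarrow> bool" where
  "reparametrization h \<longleftrightarrow>
     (\<forall>t. \<exists>d>0. (h has_real_derivative d) (at t)) \<and> (\<forall>t. h (t + 1) = h t + 1)"

lemma reparametrization_less: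
  assumes "reparametrization h" "s < t"
  shows "h s < h t"
proof (rule DERIV_pos_imp_increasing[OF assms(2)])
  show "\<exists>y. (h has_real_derivative y) (at x) \<and> y > 0" for x
    using assms(1) unfolding reparametrization_def by blast
qed

lemma reparametrization_less_iff: "reparametrization h \<Longrightarrow> h s < h t \<longleftrightarrow> s < t"
  using reparametrization_less[of h s t] reparametrization_less[of h t s]
  by (cases s t rule: linorder_cases) auto

lemma reparametrization_inj: "reparametrization h \<Longrightarrow> h s = h t \<longleftrightarrow> s = t"
  using reparametrization_less[of h s t] reparametrization_less[of h t s]
  by (cases s t rule: linorder_cases) auto

lemma reparametrization_translate: "reparametrization h \<Longrightarrow> h (t + of_int k) = h t + of_int k"
  using shift_int[of "\<lambda>t. h t - t" t k] by (simp add: reparametrization_def)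

lemma reparametrization_isCont: "reparametrization h \<Longrightarrow> isCont h t"
  unfolding reparametrization_def using DERIV_isCont by blast

lemma reparametrization_surj:
  assumes "reparametrization h"
  shows "\<exists>t. h t = y"
proof -
  let ?k = "\<lfloor>y - h 0\<rfloor>"
  have "h (0 + of_int ?k) \<le> y" "y \<le> h (0 + of_int (?k + 1))"
    unfolding reparametrization_translate[OF assms] by linarith+
  then show ?thesis
    using IVT[of h "of_int ?k" y "of_int (?k + 1)"] reparametrization_isCont[OF assms] by auto
qed

lemma reparametrization_inverse:
  assumes h: "reparametrization h"
  obtains g where "reparametrization g" "\<And>t. h (g t) = t" "\<And>t. g (h t) = t"
proof
  define g where "g = (\<lambda>y. SOME t. h t = y)"
  show hg: "h (g t) = t" for t
    unfolding g_def using reparametrization_surj[OF h] by (rule someI_ex)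
  show gh: "g (h t) = t" for t
    using hg[of "h t"] reparametrization_inj[OF h] by simp
  show "reparametrization g"
    unfolding reparametrization_def
  proof (intro conjI allI)
    fix t
    have cont: "isCont g (h (g t))"
      by (rule isCont_inverse_function[of 1]) (auto simp: gh reparametrization_isCont[OF h])
    obtain d where d: "d > 0" "(h has_real_derivative d) (at (g t))"
      using h unfolding reparametrization_def by blast
    have "(g has_real_derivative inverse d) (at t)"
      using DERIV_inverse_function[of h d g t "t - 1" "t + 1"] d cont hg by simp
    then show "\<exists>d>0. (g has_real_derivative d) (at t)" using d by (intro exI[of _ "inverse d"]) simp
    have "h (g (t + 1)) = h (g t + 1)" using h hg by (simp add: reparametrization_def)
    then show "g (t + 1) = g t + 1" using reparametrization_inj[OF h] by simp
  qed
qed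

definition reparametrized :: "diagram \<Rightarrow> diagram \<Rightarrow> bool" where
  "reparametrized D E \<longleftrightarrow> (\<exists>h. reparametrization h \<and> curve E = curve D \<circ> h \<and> over E = h -` over D)"

lemma reparametrized_of_same_diagram: "same_diagram D E \<Longrightarrow> reparametrized D E"
proof -
  assume "same_diagram D E"
  then obtain h where h: "smooth_on UNIV h" "\<forall>t. deriv h t > 0" "\<forall>t. h (t + 1) = h t + 1"
    "\<forall>t. curve E t = curve D (h t)" "\<forall>t. t \<in> over E \<longleftrightarrow> h t \<in> over D"
    unfolding same_diagram_def by blast
  have "(h has_real_derivative deriv h t) (at t)" for t
    using smooth_on_differentiable[OF h(1), of t] DERIV_deriv_iff_real_differentiable by blast
  then have "reparametrization h" using h unfolding reparametrization_def by blast
  then show ?thesis unfolding reparametrized_def using h by (intro exI[of _ h]) auto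
qed

lemma reparametrized_sym:
  assumes "reparametrized D E"
  shows "reparametrized E D"
proof -
  obtain h where h: "reparametrization h" "curve E = curve D \<circ> h" "over E = h -` over D"
    using assms unfolding reparametrized_def by blast
  obtain g where "reparametrization g" "\<And>t. h (g t) = t" "\<And>t. g (h t) = t"
    using reparametrization_inverse[OF h(1)] by blast
  then show ?thesis
    unfolding reparametrized_def using h by (intro exI[of _ g]) (auto simp: fun_eq_iff)
qed

lemma Ints_reparametrization:
  assumes h: "reparametrization h"
  shows "h s - h t \<in> \<int> \<longleftrightarrow> s - t \<in> \<int>"
proof
  assume "s - t \<in> \<int>"
  then obtain k where "s - t = of_int k" by (auto elim: Ints_cases)
  then have "s = t + of_int k" by simp
  then show "h s - h t \<in> \<int>" using reparametrization_translate[OF h] by simp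
next
  assume "h s - h t \<in> \<int>"
  then obtain k where "h s - h t = of_int k" by (auto elim: Ints_cases)
  then have "h s = h (t + of_int k)" using reparametrization_translate[OF h] by simp
  then show "s - t \<in> \<int>" using reparametrization_inj[OF h] by simp
qed

lemma det_vector_2: "det (vector [v, w] :: real^2^2) = v $ 1 * w $ 2 - v $ 2 * w $ 1"
  by (simp add: det_2)

context
  fixes D E :: diagram and h :: "real \<Rightarrow> real"
  assumes D: "regular_diagram D" and h: "reparametrization h"
    and E: "curve E = curve D \<circ> h" "over E = h -` over D"
begin

lemma reparametrized_derivative:
  "\<exists>d>0. (curve E has_vector_derivative d *\<^sub>R velocity D (h t)) (at t)"
proof -
  obtain d where d: "d > 0" "(h has_real_derivative d) (at t)"
    using h unfolding reparametrization_def by blast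
  then show ?thesis
    using vector_diff_chain_at[OF _ regular.curve_derivative, of h d t D] D E
    by (intro exI[of _ d]) (simp add: regular_def has_real_derivative_iff_has_vector_derivative)
qed

lemma reparametrized_velocity: "\<exists>d>0. velocity E t = d *\<^sub>R velocity D (h t)"
  using reparametrized_derivative[of t] unfolding velocity_def by (metis vector_derivative_at)

lemma reparametrized_meets: "meets E s t \<longleftrightarrow> meets D (h s) (h t)"
  unfolding meets_def E using Ints_reparametrization[OF h] by simp

lemma reparametrized_det:
  "sgn (det (vector [velocity E s, velocity E t] :: real^2^2)) =
   sgn (det (vector [velocity D (h s), velocity D (h t)] :: real^2^2))"
proof -
  obtain c d where cd: "c > 0" "velocity E s = c *\<^sub>R velocity D (h s)"
      "d > 0" "velocity E t = d *\<^sub>R velocity D (h t)"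
    using reparametrized_velocity by metis
  have "det (vector [velocity E s, velocity E t] :: real^2^2) =
      (c * d) * det (vector [velocity D (h s), velocity D (h t)] :: real^2^2)"
    by (simp add: cd det_vector_2 algebra_simps)
  then show ?thesis using cd by (simp only: sgn_mult) simp
qed

lemma reparametrized_regular: "regular_diagram E"
  unfolding regular_diagram_def
proof (intro conjI allI impI)
  fix r s t
  show "curve E differentiable (at t)"
    using reparametrized_derivative[of t] differentiableI_vector by blast
  show "curve E (t + 1) = curve E t" "t + 1 \<in> over E \<longleftrightarrow> t \<in> over E"
    using D h unfolding E regular_diagram_def reparametrization_def by auto
  show "velocity E t \<noteq> 0"
    using reparametrized_velocity[of t] D unfolding regular_diagram_def by auto
  show "det (vector [velocity E s, velocity E t] :: real^2^2) \<noteq> 0" if "meets E s t"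
    using reparametrized_det[of s t] regular.transversal[of D "h s" "h t"] that D
    by (metis reparametrized_meets regular_def sgn_0_0)
  show "r - t \<in> \<int>" if "meets E r s \<and> meets E s t"
    using that regular.no_triple[of D "h r" "h s" "h t"] D
    by (simp add: reparametrized_meets regular_def Ints_reparametrization[OF h])
  show "s \<in> over E \<longleftrightarrow> t \<notin> over E" if "meets E s t"
    using that regular.over_under[of D "h s" "h t"] D by (simp add: reparametrized_meets regular_def E)
qed

lemma reparametrized_arrows: "(s, u) \<in> arrows E \<longleftrightarrow> (h s, h u) \<in> arrows D"
  unfolding arrows_def by (simp add: reparametrized_meets) (simp add: E)

lemma reparametrized_count: "figure_count p E = figure_count p D"
proof -
  obtain g where g: "reparametrization g" and hg: "\<And>t. h (g t) = t" and gh: "\<And>t. g (h t) = t"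
    using reparametrization_inverse[OF h] by blast
  have "pattern_count p (crossing_sign E) (arrows E) 0 =
      pattern_count p (crossing_sign D) (arrows D) (h 0)"
    unfolding pattern_count_def
  proof (rule sum.reindex_bij_witness[where i = "\<lambda>t. g \<circ> t" and j = "\<lambda>t. h \<circ> t"])
    fix t assume t: "t \<in> based_occurrences p (arrows E) 0"
    show "g \<circ> (h \<circ> t) = t" using gh by auto
    have "h (t 0) < h (0 + 1) \<longleftrightarrow> t 0 < 0 + 1" "h 0 \<le> h (t 0) \<longleftrightarrow> 0 \<le> t 0"
      using reparametrization_less_iff[OF h] by (simp_all add: not_less[symmetric])
    moreover have "h (0 + 1) = h 0 + 1" using h unfolding reparametrization_def by blast
    ultimately show "h \<circ> t \<in> based_occurrences p (arrows D) (h 0)"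
      using t h reparametrization_less[OF h] reparametrized_arrows
      by (auto simp: based_occurrences_def occurrences_def reparametrization_def)
    show "weight p (crossing_sign D) (h \<circ> t) = weight p (crossing_sign E) t"
      by (simp add: weight_def crossing_sign_def reparametrized_det)
  next
    fix t assume t: "t \<in> based_occurrences p (arrows D) (h 0)"
    show "h \<circ> (g \<circ> t) = t" using hg by auto
    have "g (t 0) < g (h 0 + 1) \<longleftrightarrow> t 0 < h 0 + 1" "g (h 0) \<le> g (t 0) \<longleftrightarrow> h 0 \<le> t 0"
      using reparametrization_less_iff[OF g] by (simp_all add: not_less[symmetric])
    moreover have "g (h 0 + 1) = 1" using g gh[of 0] by (simp add: reparametrization_def)
    ultimately show "g \<circ> t \<in> based_occurrences p (arrows E) 0"
      using t g reparametrization_less[OF g] reparametrized_arrows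
      by (auto simp: based_occurrences_def occurrences_def reparametrization_def gh hg)
  qed
  then show ?thesis
    using regular.figure_count_base[of D p "h 0"] D by (simp add: figure_count_def regular_def)
qed

lemma reparametrized_locally_finite:
  assumes "locally_finite (arrows D)"
  shows "locally_finite (arrows E)"
  unfolding locally_finite_def
proof (intro allI)
  fix x y
  have "h ` (Field (arrows E) \<inter> {x..y}) \<subseteq> Field (arrows D) \<inter> {h x..h y}"
    using reparametrized_arrows reparametrization_less_iff[OF h]
    by (auto simp: Field_def not_less[symmetric])
  moreover have "inj_on h A" for A using reparametrization_inj[OF h] by (auto intro: inj_onI)
  ultimately show "finite (Field (arrows E) \<inter> {x..y})"
    using assms unfolding locally_finite_def by (meson inj_on_finite)
qed

end

text \<open>
  As the inverse of a reparametrization is one as well, it suffices to transport each property in one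
  direction.
\<close>

lemma reparametrized_invariants:
  assumes "reparametrized D E" "regular_diagram D"
  shows "regular_diagram E" "figure_count p E = figure_count p D"
    "locally_finite (arrows E) \<longleftrightarrow> locally_finite (arrows D)"
proof -
  have 1: "regular_diagram E \<and> figure_count p E = figure_count p D \<and>
      (locally_finite (arrows D) \<longrightarrow> locally_finite (arrows E))"
    if "reparametrized D E" "regular_diagram D" for D E
  proof -
    obtain h where h: "reparametrization h" "curve E = curve D \<circ> h" "over E = h -` over D"
      using \<open>reparametrized D E\<close> unfolding reparametrized_def by blast
    show ?thesis
      using reparametrized_regular[OF that(2) h] reparametrized_count[OF that(2) h]
        reparametrized_locally_finite[OF that(2) h] by blast
  qed
  from 1[OF assms] 1[OF reparametrized_sym[OF assms(1)]]
  show "regular_diagram E" "figure_count p E = figure_count p D"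
    "locally_finite (arrows E) \<longleftrightarrow> locally_finite (arrows D)" by auto
qed

section \<open>Diffeomorphisms of the plane\<close>

lemma det_linear_image:
  fixes L :: "plane \<Rightarrow> plane"
  assumes "linear L"
  shows "det (vector [L v, L w] :: real^2^2) = det (matrix L) * det (vector [v, w] :: real^2^2)"
proof -
  have "matrix L *v v = L v" "matrix L *v w = L w"
    using matrix_vector_mul(2)[OF assms] by (auto dest: fun_cong)
  then have "L v $ i = matrix L $ i $ 1 * v $ 1 + matrix L $ i $ 2 * v $ 2"
    "L w $ i = matrix L $ i $ 1 * w $ 1 + matrix L $ i $ 2 * w $ 2" for i
    by (auto simp: matrix_vector_mult_def sum_2 vec_eq_iff)
  then show ?thesis
    by (simp add: det_vector_2 det_2 algebra_simps)
qed

lemma plane_diffeo_invariants: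
  assumes D: "regular_diagram D" and m: "plane_diffeo_move D E"
  shows "figure_count p E = figure_count p D" "locally_finite (arrows E) \<longleftrightarrow> locally_finite (arrows D)"
proof -
  obtain f where f: "diffeomorphism UNIV UNIV f" "\<And>x. det (matrix (frechet_derivative f (at x))) > 0"
      and E: "curve E = f \<circ> curve D" "over E = over D"
    using m unfolding plane_diffeo_move_def by blast
  have "inj f" using f(1) by (auto simp: diffeomorphism_def bij_betw_def)
  then have meets: "meets E s t \<longleftrightarrow> meets D s t" for s t
    by (auto simp: meets_def E inj_eq)
  then have arrows: "arrows E = arrows D" by (simp add: arrows_def E)
  have f': "(f has_derivative frechet_derivative f (at x)) (at x)" for x
    using f(1) smooth_on_differentiable[of UNIV f x]
    by (simp add: diffeomorphism_def frechet_derivative_works)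
  have vel: "velocity E t = frechet_derivative f (at (curve D t)) (velocity D t)" for t
  proof -
    have "(curve D has_derivative (\<lambda>h. h *\<^sub>R velocity D t)) (at t)"
      using regular.curve_derivative[of D t] D by (simp add: regular_def has_vector_derivative_def)
    from diff_chain_at[OF this f']
    have "(curve E has_derivative (\<lambda>h. h *\<^sub>R frechet_derivative f (at (curve D t)) (velocity D t))) (at t)"
      using has_derivative_linear[OF f', of "curve D t"]
      by (simp add: E comp_def linear_scale)
    then show ?thesis
      unfolding velocity_def by (intro vector_derivative_at) (simp add: has_vector_derivative_def)
  qed
  have sign: "crossing_sign E s t = crossing_sign D s t" if "curve D s = curve D t" for s t
    using f(2)[of "curve D t"] has_derivative_linear[OF f', of "curve D t"] that
    by (simp add: crossing_sign_def vel det_linear_image sgn_mult)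
  have "crossing_sign E s u = crossing_sign D s u" if "(s, u) \<in> arrows D" for s u
    using sign that by (simp add: arrows_def meets_def)
  then show "figure_count p E = figure_count p D"
    unfolding figure_count_def arrows by (rule pattern_count_cong)
  show "locally_finite (arrows E) \<longleftrightarrow> locally_finite (arrows D)" by (simp add: arrows)
qed

section \<open>Strands along graphs\<close>

locale chart =
  fixes \<phi> :: "plane \<Rightarrow> plane" and U V :: "plane set"
  assumes disk_subset: "cball 0 1 \<subseteq> U" and diffeo: "diffeomorphism U V \<phi>"
begin

abbreviation d\<phi> :: "plane \<Rightarrow> plane \<Rightarrow> plane" where
  "d\<phi> x \<equiv> frechet_derivative \<phi> (at x)"

definition chart_inv :: "plane \<Rightarrow> plane" where
  "chart_inv = inv_into U \<phi>"

lemma chart_inv_chart [simp]: "x \<in> U \<Longrightarrow> chart_inv (\<phi> x) = x"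
  using diffeo by (simp add: diffeomorphism_def chart_inv_def bij_betw_def)

lemma chart_in: "x \<in> U \<Longrightarrow> \<phi> x \<in> V"
  using diffeo by (auto simp: diffeomorphism_def bij_betw_def)

lemma chart_derivative: "x \<in> U \<Longrightarrow> (\<phi> has_derivative d\<phi> x) (at x)"
  using diffeo smooth_on_differentiable[of U \<phi> x]
  by (simp add: diffeomorphism_def frechet_derivative_works)

lemma chart_inv_derivative:
  "y \<in> V \<Longrightarrow> (chart_inv has_derivative frechet_derivative chart_inv (at y)) (at y)"
  using diffeo smooth_on_differentiable[of V chart_inv y]
  by (simp add: diffeomorphism_def frechet_derivative_works chart_inv_def)

lemma det_chart_nonzero:
  assumes x: "x \<in> U"
  shows "det (matrix (d\<phi> x)) \<noteq> 0"
proof -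
  have U: "open U" using diffeo by (simp add: diffeomorphism_def)
  let ?e = "frechet_derivative chart_inv (at (\<phi> x))"
  have "(chart_inv \<circ> \<phi> has_derivative ?e \<circ> d\<phi> x) (at x)"
    by (rule diff_chain_at[OF chart_derivative[OF x] chart_inv_derivative[OF chart_in[OF x]]])
  then have "(id has_derivative ?e \<circ> d\<phi> x) (at x)"
    by (rule has_derivative_transform_within_open[OF _ U x]) simp
  then have "?e \<circ> d\<phi> x = id"
    using has_derivative_id has_derivative_unique by blast
  then have "inj (d\<phi> x)" by (metis inj_on_id inj_on_imageI2)
  then show ?thesis
    using det_nz_iff_inj[of "d\<phi> x"] has_derivative_linear[OF chart_derivative[OF x]] by blast
qed

text \<open>
  The determinant is continuous and has no zero on the connected disk.
\<close>

lemma sgn_det_chart: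
  assumes "x \<in> cball 0 1"
  shows "sgn (det (matrix (d\<phi> x))) = sgn (det (matrix (d\<phi> 0)))"
proof -
  define f where "f = (\<lambda>x. det (matrix (d\<phi> x)))"
  have "Ck_on (Suc 0) U \<phi>"
    using diffeo by (simp add: diffeomorphism_def smooth_on_def)
  then have "continuous_on U (\<lambda>x. d\<phi> x v)" for v by simp
  then have "continuous_on (cball 0 1) (\<lambda>x. d\<phi> x v)" for v
    using disk_subset continuous_on_subset by blast
  then have "continuous_on (cball 0 1) f"
    unfolding f_def det_2 matrix_def by (auto intro!: continuous_intros)
  then have "connected (f ` cball 0 1)"
    by (intro connected_continuous_image) (auto intro: convex_connected)
  moreover have "0 \<notin> f ` cball 0 1" using det_chart_nonzero disk_subset by (auto simp: f_def)
  moreover have "f x \<in> f ` cball 0 1" "f 0 \<in> f ` cball 0 1" using assms by auto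
  ultimately have "\<not> (f x \<le> 0 \<and> 0 \<le> f 0)" "\<not> (f 0 \<le> 0 \<and> 0 \<le> f x)"
    using connectedD_interval by metis+
  then show ?thesis by (auto simp: f_def sgn_if)
qed

text \<open>
  The first coordinate in the model disk. Along a strand that is a graph it determines the point.
\<close>

definition abscissa :: "diagram \<Rightarrow> real \<Rightarrow> real" where
  "abscissa D t = chart_inv (curve D t) $ 1"

end

locale graph_strand = chart \<phi> U V + regular D for \<phi> U V and D +
  fixes a b :: real and g :: "real \<Rightarrow> real"
  assumes ab: "a < b"
    and g: "\<And>x. (g has_real_derivative deriv g x) (at x)"
    and image: "curve D ` {a..b} = \<phi> ` graph_in_disk g"
begin

abbreviation "X \<equiv> abscissa D"

lemma graph_point:
  assumes "t \<in> {a..b}"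
  shows "curve D t = \<phi> (vector [X t, g (X t)])" "vector [X t, g (X t)] \<in> (cball 0 1 :: plane set)"
proof -
  have "curve D t \<in> \<phi> ` graph_in_disk g" using image assms by blast
  then obtain x where x: "curve D t = \<phi> (vector [x, g x])" "vector [x, g x] \<in> (cball 0 1 :: plane set)"
    by (auto simp: graph_in_disk_def)
  then have "X t = x" using disk_subset by (simp add: abscissa_def subset_iff)
  then show "curve D t = \<phi> (vector [X t, g (X t)])" "vector [X t, g (X t)] \<in> (cball 0 1 :: plane set)"
    using x by simp_all
qed

lemma graph_point_exists:
  assumes "vector [x, g x] \<in> (cball 0 1 :: plane set)"
  obtains t where "t \<in> {a..b}" "curve D t = \<phi> (vector [x, g x])" "X t = x"
proof -
  have "\<phi> (vector [x, g x]) \<in> curve D ` {a..b}"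
    unfolding image using assms by (auto simp: graph_in_disk_def)
  then obtain t where t: "t \<in> {a..b}" "curve D t = \<phi> (vector [x, g x])" by auto
  moreover have "X t = x" using t(2) assms disk_subset by (simp add: abscissa_def subset_iff)
  ultimately show ?thesis using that by blast
qed

lemma abscissa_differentiable:
  assumes "t \<in> {a..b}"
  shows "\<exists>c. (X has_real_derivative c) (at t)"
proof -
  have "curve D t \<in> V" using graph_point[OF assms] disk_subset chart_in by (metis subsetD)
  from diff_chain_at[OF curve_derivative[unfolded has_vector_derivative_def] chart_inv_derivative[OF this]]
  have "(chart_inv \<circ> curve D) differentiable (at t)" by (auto simp: differentiable_def)
  then have "((\<lambda>x. (chart_inv \<circ> curve D) x $ 1)) differentiable (at t)"
    unfolding differentiable_def using bounded_linear.has_derivative[OF bounded_linear_vec_nth] by blast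
  then show ?thesis unfolding abscissa_def[abs_def] comp_def real_differentiable_def .
qed

lemma graph_velocity:
  assumes t: "t \<in> {a<..<b}" and c: "(X has_real_derivative c) (at t)"
  shows "velocity D t = d\<phi> (vector [X t, g (X t)]) (c *\<^sub>R vector [1, deriv g (X t)])" "c \<noteq> 0"
proof -
  let ?z = "vector [X t, g (X t)] :: plane"
  have z: "?z \<in> U" using graph_point(2)[of t] t disk_subset by auto
  have v: "vector [x, y] = x *\<^sub>R (axis 1 1 :: plane) + y *\<^sub>R axis 2 1" for x y
    by (simp add: vec_eq_iff forall_2 axis_def)
  have gX: "((\<lambda>s. g (X s)) has_real_derivative deriv g (X t) * c) (at t)"
    by (rule DERIV_chain2[OF g c])
  have "((\<lambda>s. vector [X s, g (X s)] :: plane) has_vector_derivative c *\<^sub>R vector [1, deriv g (X t)]) (at t)"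
    unfolding v using c gX
    by (auto intro!: derivative_eq_intros simp: has_real_derivative_iff_has_vector_derivative algebra_simps)
  from diff_chain_at[OF this[unfolded has_vector_derivative_def] chart_derivative[OF z]]
  have "((\<lambda>s. \<phi> (vector [X s, g (X s)])) has_derivative
      (\<lambda>h. d\<phi> ?z (h *\<^sub>R c *\<^sub>R vector [1, deriv g (X t)]))) (at t)"
    by (simp add: comp_def)
  then have "(curve D has_derivative (\<lambda>h. d\<phi> ?z (h *\<^sub>R c *\<^sub>R vector [1, deriv g (X t)]))) (at t)"
    by (rule has_derivative_transform_within_open[OF _ open_greaterThanLessThan t])
      (simp add: graph_point(1))
  then have "(curve D has_vector_derivative d\<phi> ?z (c *\<^sub>R vector [1, deriv g (X t)])) (at t)"
    using has_derivative_linear[OF chart_derivative[OF z]]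
    by (simp add: has_vector_derivative_def linear_scale)
  then show vel: "velocity D t = d\<phi> ?z (c *\<^sub>R vector [1, deriv g (X t)])"
    using curve_derivative vector_derivative_unique_at by blast
  show "c \<noteq> 0"
  proof
    assume "c = 0"
    then have "velocity D t = 0"
      using vel has_derivative_linear[OF chart_derivative[OF z]] by (simp add: linear_0)
    then show False using velocity_nonzero by blast
  qed
qed

lemma abscissa_continuous: "continuous_on {a..b} X"
proof (rule continuous_at_imp_continuous_on, rule ballI)
  fix t assume "t \<in> {a..b}"
  then show "isCont X t" using abscissa_differentiable DERIV_isCont by blast
qed

text \<open>
  If the abscissa returned to a value, then by Rolle's theorem its derivative would vanish in between, and
  with it the velocity of the curve.
\<close>

lemma abscissa_inj: "inj_on X {a..b}"
proof (rule linorder_inj_onI')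
  fix s t assume st: "s \<in> {a..b}" "t \<in> {a..b}" "s < t"
  show "X s \<noteq> X t"
  proof
    assume eq: "X s = X t"
    have "continuous_on {s..t} X" using abscissa_continuous st by (auto elim: continuous_on_subset)
    moreover have "X differentiable (at x)" if "s < x" "x < t" for x
      using abscissa_differentiable[of x] st that real_differentiable_def by auto
    ultimately obtain z where z: "s < z" "z < t" "DERIV X z :> 0"
      using Rolle[OF st(3) eq] by blast
    then show False using graph_velocity(2)[of z 0] st by auto
  qed
qed

text \<open>
  The direction of a strand, and hence its contribution to the signs of crossings, can be read off from
  its end points.
\<close>

lemma sgn_abscissa_derivative:
  assumes t: "t \<in> {a<..<b}" and c: "(X has_real_derivative c) (at t)"
  shows "sgn c = sgn (X b - X a)"
proof -
  have mono: "(X p < X q \<and> X q < X r) \<or> (X r < X q \<and> X q < X p)" if "a \<le> p" "p < q" "q < r" "r \<le> b" for p q r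
  proof (rule continuous_inj_imp_mono[of p q r X])
    show "continuous_on {p..r} X" using abscissa_continuous that by (auto elim: continuous_on_subset)
    show "inj_on X {p..r}" using abscissa_inj that by (auto elim: inj_on_subset)
  qed (use that in auto)
  have c0: "c \<noteq> 0" using graph_velocity(2)[OF t c] .
  have 1: "(X a < X t \<and> X t < X b) \<or> (X b < X t \<and> X t < X a)" using mono[of a t b] t by auto
  show ?thesis
  proof (cases "c > 0")
    case True
    then obtain d where d: "d > 0" "\<And>h. 0 < h \<Longrightarrow> h < d \<Longrightarrow> X t < X (t + h)"
      using DERIV_pos_inc_right[OF c] by blast
    define h where "h = min (d / 2) ((b - t) / 2)"
    have h: "0 < h" "h < d" "t + h < b" using d t by (auto simp: h_def min_def field_simps)
    then have "X t < X (t + h)" using d by blast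
    then have "X t < X b" using mono[of t "t + h" b] h t by auto
    then show ?thesis using 1 True by auto
  next
    case False
    then obtain d where d: "d > 0" "\<And>h. 0 < h \<Longrightarrow> h < d \<Longrightarrow> X (t + h) < X t"
      using DERIV_neg_dec_right[OF c] c0 by force
    define h where "h = min (d / 2) ((b - t) / 2)"
    have h: "0 < h" "h < d" "t + h < b" using d t by (auto simp: h_def min_def field_simps)
    then have "X (t + h) < X t" using d by blast
    then have "X b < X t" using mono[of t "t + h" b] h t by auto
    then show ?thesis using 1 False c0 by auto
  qed
qed

lemma curve_inj_on_strand:
  assumes "s \<in> {a..b}" "t \<in> {a..b}" "curve D s = curve D t"
  shows "s = t"
  using inj_onD[OF abscissa_inj _ assms(1,2)] assms(3) by (simp add: abscissa_def)

end

text \<open>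
  In the model, the velocities are multiples of \<open>(1, g')\<close> for the two graphs, so that their
  determinant is the product of the two factors and the difference of the slopes.
\<close>

lemma (in chart) graph_crossing_sign:
  assumes s: "graph_strand \<phi> U V D a b g" "s \<in> {a<..<b}"
    and u: "graph_strand \<phi> U V D a' b' g'" "u \<in> {a'<..<b'}"
    and su: "curve D s = curve D u"
  shows "crossing_sign D s u = sgn (det (matrix (d\<phi> 0))) * sgn (abscissa D b - abscissa D a) *
    sgn (abscissa D b' - abscissa D a') * sgn (deriv g' (abscissa D s) - deriv g (abscissa D s))"
proof -
  interpret s: graph_strand \<phi> U V D a b g by (rule s(1))
  interpret u: graph_strand \<phi> U V D a' b' g' by (rule u(1))
  let ?x = "abscissa D s"
  let ?z = "vector [?x, g ?x] :: plane"
  have x: "abscissa D u = ?x" using su by (simp add: abscissa_def)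
  have z: "?z \<in> cball 0 1" "vector [?x, g' ?x] \<in> (cball 0 1 :: plane set)"
    using s.graph_point(2)[of s] s(2) u.graph_point(2)[of u] u(2) x by auto
  have "\<phi> ?z = \<phi> (vector [?x, g' ?x])"
    using s.graph_point(1)[of s] s(2) u.graph_point(1)[of u] u(2) x su by auto
  then have z': "vector [?x, g' ?x] = ?z"
    using z disk_subset chart_inv_chart by (metis subsetD)
  obtain c where c: "(abscissa D has_real_derivative c) (at s)"
    using s.abscissa_differentiable[of s] s(2) by auto
  obtain d where d: "(abscissa D has_real_derivative d) (at u)"
    using u.abscissa_differentiable[of u] u(2) by auto
  have vs: "velocity D s = d\<phi> ?z (c *\<^sub>R vector [1, deriv g ?x])"
    using s.graph_velocity(1)[OF s(2) c] .
  have vu: "velocity D u = d\<phi> ?z (d *\<^sub>R vector [1, deriv g' ?x])"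
    using u.graph_velocity(1)[OF u(2) d] x z' by simp
  have "linear (d\<phi> ?z)"
    using has_derivative_linear[OF chart_derivative] z disk_subset by blast
  then have "det (vector [velocity D s, velocity D u] :: real^2^2) =
      det (matrix (d\<phi> ?z)) * c * d * (deriv g' ?x - deriv g ?x)"
    unfolding vs vu by (simp add: det_linear_image) (simp add: det_vector_2 algebra_simps)
  then show ?thesis
    unfolding crossing_sign_def
    using s.sgn_abscissa_derivative[OF s(2) c] u.sgn_abscissa_derivative[OF u(2) d] sgn_det_chart[OF z(1)]
    by (simp add: sgn_mult)
qed

context strand_family
begin

lemma gap_before:
  assumes q: "q < n"
  obtains c where "c < a q" "\<And>t. c < t \<Longrightarrow> t < a q \<Longrightarrow> t \<notin> covered"
proof
  define r where "r = (if q = 0 then n - 1 else q - 1)"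
  define k where "k = (if q = 0 then - 1 else 0 :: int)"
  have r: "r < n" "k < 0 \<or> k = 0 \<and> r < q" using q by (auto simp: r_def k_def)
  have ends: "b r + of_int k \<in> strand r k" "a q \<in> strand q 0"
    using strand_less[of r] strand_less[of q] q r(1) by (auto simp: strand_def)
  show "b r + of_int k < a q" using strand_separated[OF r(1) q r(2) ends] .
  fix t assume t: "b r + of_int k < t" "t < a q"
  show "t \<notin> covered"
  proof
    assume "t \<in> covered"
    then obtain p l where p: "p < n" "t \<in> strand p l" by (auto simp: covered_def)
    have "l < k \<or> l = k \<and> p < r \<or> l = k \<and> p = r \<or> 0 < l \<or> 0 = l \<and> q < p \<or> 0 = l \<and> q = p"
      using p(1) q by (auto simp: r_def k_def split: if_splits)
    then show False
      using strand_separated[OF p(1) r(1) _ p(2) ends(1)] strand_separated[OF q p(1) _ ends(2) p(2)] t p(2)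
      by (auto simp: strand_def)
  qed
qed

lemma gap_after:
  assumes q: "q < n"
  obtains c where "b q < c" "\<And>t. b q < t \<Longrightarrow> t < c \<Longrightarrow> t \<notin> covered"
proof
  define r where "r = (if q = n - 1 then 0 else q + 1)"
  define k where "k = (if q = n - 1 then 1 else 0 :: int)"
  have r: "r < n" "0 < k \<or> 0 = k \<and> q < r" using q by (auto simp: r_def k_def)
  have ends: "a r + of_int k \<in> strand r k" "b q \<in> strand q 0"
    using strand_less[of r] strand_less[of q] q r(1) by (auto simp: strand_def)
  show "b q < a r + of_int k" using strand_separated[OF q r(1) r(2) ends(2,1)] .
  fix t assume t: "b q < t" "t < a r + of_int k"
  show "t \<notin> covered"
  proof
    assume "t \<in> covered"
    then obtain p l where p: "p < n" "t \<in> strand p l" by (auto simp: covered_def)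
    have "k < l \<or> k = l \<and> r < p \<or> l = k \<and> p = r \<or> l < 0 \<or> l = 0 \<and> p < q \<or> l = 0 \<and> q = p"
      using p(1) q by (auto simp: r_def k_def split: if_splits)
    then show False
      using strand_separated[OF r(1) p(1) _ ends(1) p(2)] strand_separated[OF p(1) q _ p(2) ends(2)] t p(2)
      by (auto simp: strand_def)
  qed
qed

end

section \<open>Changes inside a disk\<close>

lemma finite_lifts:
  assumes "finite S"
  shows "finite (lifts S \<inter> {x..y})"
proof -
  have "lifts S \<inter> {x..y} \<subseteq> (\<Union>z\<in>S. (\<lambda>k. z + of_int k) ` {\<lceil>x - z\<rceil>..\<lfloor>y - z\<rfloor>})"
  proof
    fix w assume w: "w \<in> lifts S \<inter> {x..y}"
    then obtain z k where z: "w = z + of_int k" "z \<in> S" by (auto simp: lifts_def)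
    then have "k \<in> {\<lceil>x - z\<rceil>..\<lfloor>y - z\<rfloor>}" using w by (auto simp: ceiling_le_iff le_floor_iff)
    with z show "w \<in> (\<Union>z\<in>S. (\<lambda>k. z + of_int k) ` {\<lceil>x - z\<rceil>..\<lfloor>y - z\<rfloor>})" by blast
  qed
  then show ?thesis by (rule finite_subset) (use assms in auto)
qed

locale disk_change =
  chart \<phi> U V + D: regular D + E: regular E + strand_family n a b
  for \<phi> U V and D E :: diagram and n a b +
  assumes changed: "changed_in_disk \<phi> n a b D E"
begin

lemma in_disk: "curve D t \<in> \<phi> ` cball 0 1 \<longleftrightarrow> t \<in> covered" "curve E t \<in> \<phi> ` cball 0 1 \<longleftrightarrow> t \<in> covered"
proof -
  have "strands_in_disk \<phi> n a b D" "strands_in_disk \<phi> n a b E"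
    using changed unfolding changed_in_disk_def by auto
  then show "curve D t \<in> \<phi> ` cball 0 1 \<longleftrightarrow> t \<in> covered" "curve E t \<in> \<phi> ` cball 0 1 \<longleftrightarrow> t \<in> covered"
    unfolding strands_in_disk_def covered_lifts by auto
qed

lemma in_open_disk:
  assumes "F \<in> {D, E}" and q: "q < n" "t \<in> {a q..b q}" and "curve F t \<in> \<phi> ` ball 0 1"
  shows "t \<in> {a q<..<b q}"
proof -
  have "t \<in> lifts (\<Union>i<n. {a i<..<b i})"
  proof -
    have "strands_in_disk \<phi> n a b F"
      using assms(1) changed unfolding changed_in_disk_def by auto
    then show ?thesis using assms(4) unfolding strands_in_disk_def by blast
  qed
  then obtain y k r where r: "t = y + of_int k" "r < n" "y \<in> {a r<..<b r}"
    by (auto simp: lifts_def)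
  then have "t \<in> strand r k" by (auto simp: strand_def)
  then have "r = q" "k = 0" using strand_unique[OF r(2) q(1), of t k 0] q(2) by (auto simp: strand_0)
  then show ?thesis using r by simp
qed

lemma outside:
  assumes "t \<notin> covered"
  shows "curve E t = curve D t" "t \<in> over E \<longleftrightarrow> t \<in> over D"
proof -
  have "\<forall>t. t \<notin> covered \<longrightarrow> curve E t = curve D t \<and> (t \<in> over E \<longleftrightarrow> t \<in> over D)"
    using changed unfolding changed_in_disk_def covered_lifts by simp
  then show "curve E t = curve D t" "t \<in> over E \<longleftrightarrow> t \<in> over D" using assms by auto
qed

lemma outside_velocity:
  assumes "t \<notin> covered"
  shows "velocity E t = velocity D t"
proof -
  have "continuous_on (cball 0 1) \<phi>"
    using chart_derivative disk_subset
    by (intro continuous_at_imp_continuous_on) (blast intro: has_derivative_continuous)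
  then have "closed (\<phi> ` cball 0 1)"
    by (intro compact_imp_closed compact_continuous_image) auto
  moreover have "continuous_on UNIV (curve D)"
    using D.curve_derivative has_vector_derivative_continuous
    by (intro continuous_at_imp_continuous_on) blast
  ultimately have "closed (curve D -` (\<phi> ` cball 0 1))" by (rule closed_vimage)
  moreover have "curve D -` (\<phi> ` cball 0 1) = covered" using in_disk(1) by auto
  ultimately have "open (- covered)" by (simp add: open_Compl)
  then have "(curve E has_derivative (\<lambda>h. h *\<^sub>R velocity D t)) (at t)"
    using assms
    by (intro has_derivative_transform_within_open[OF D.curve_derivative[of t, unfolded has_vector_derivative_def]])
      (auto simp: outside(1))
  then show ?thesis
    unfolding velocity_def[of E] by (intro vector_derivative_at) (simp add: has_vector_derivative_def)
qed

text \<open>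
  Immediately before and after a strand the curves agree, so they agree at the end points by continuity.
\<close>

lemma endpoints:
  assumes q: "q < n"
  shows "curve E (a q) = curve D (a q)" "curve E (b q) = curve D (b q)"
proof -
  have cont: "isCont (curve D) t" "isCont (curve E) t" for t
    using D.curve_derivative E.curve_derivative has_vector_derivative_continuous by blast+
  obtain c where c: "c < a q" "\<And>t. c < t \<Longrightarrow> t < a q \<Longrightarrow> t \<notin> covered" by (rule gap_before[OF q]) (rule that)
  have "\<forall>\<^sub>F t in at_left (a q). curve D t = curve E t"
    using c outside(1) by (auto simp: eventually_at_left_field)
  moreover have "(curve D \<longlongrightarrow> curve D (a q)) (at_left (a q))"
    using cont(1) by (simp add: isCont_def filterlim_at_split)
  ultimately have "(curve E \<longlongrightarrow> curve D (a q)) (at_left (a q))"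
    using tendsto_cong by blast
  moreover have "(curve E \<longlongrightarrow> curve E (a q)) (at_left (a q))"
    using cont(2) by (simp add: isCont_def filterlim_at_split)
  ultimately show "curve E (a q) = curve D (a q)"
    using tendsto_unique trivial_limit_at_left_real by blast
  obtain c where c: "b q < c" "\<And>t. b q < t \<Longrightarrow> t < c \<Longrightarrow> t \<notin> covered" by (rule gap_after[OF q]) (rule that)
  have "\<forall>\<^sub>F t in at_right (b q). curve D t = curve E t"
    using c outside(1) by (auto simp: eventually_at_right_field)
  moreover have "(curve D \<longlongrightarrow> curve D (b q)) (at_right (b q))"
    using cont(1) by (simp add: isCont_def filterlim_at_split)
  ultimately have "(curve E \<longlongrightarrow> curve D (b q)) (at_right (b q))"
    using tendsto_cong by blast
  moreover have "(curve E \<longlongrightarrow> curve E (b q)) (at_right (b q))"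
    using cont(2) by (simp add: isCont_def filterlim_at_split)
  ultimately show "curve E (b q) = curve D (b q)"
    using tendsto_unique trivial_limit_at_right_real by blast
qed

lemma abscissa_endpoints:
  assumes "q < n"
  shows "abscissa E (a q) = abscissa D (a q)" "abscissa E (b q) = abscissa D (b q)"
  using endpoints[OF assms] by (simp_all add: abscissa_def)

definition outer_arrows :: "(real \<times> real) set" where
  "outer_arrows = {(s, u) \<in> arrows D. s \<notin> covered \<and> u \<notin> covered}"

text \<open>
  Confining both parameters to the window selects one representative of each arrow inside the disk.
\<close>

definition inner_arrows :: "diagram \<Rightarrow> (real \<times> real) set" where
  "inner_arrows F = {(s, u) \<in> arrows F. s \<in> window \<and> u \<in> window}"

lemma outer_disjoint: "Field outer_arrows \<inter> covered = {}"
  by (auto simp: outer_arrows_def Field_def)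

lemma covered_window:
  assumes "x \<in> covered"
  obtains y k where "y \<in> window" "x = y + of_int k"
proof -
  obtain q k where q: "q < n" "x \<in> strand q k" using assms by (auto simp: covered_def)
  then have "x - of_int k \<in> {a q..b q}" by (auto simp: strand_def)
  then show ?thesis using that[of "x - of_int k" k] windowI[OF q(1)] by simp
qed

lemma outer_arrows_E: "outer_arrows = {(s, u) \<in> arrows E. s \<notin> covered \<and> u \<notin> covered}"
proof -
  have "(s, u) \<in> arrows D \<longleftrightarrow> (s, u) \<in> arrows E" if "s \<notin> covered" "u \<notin> covered" for s u
    using outside[OF that(1)] outside[OF that(2)] by (simp add: arrows_def meets_def)
  then show ?thesis unfolding outer_arrows_def by blast
qed

text \<open>
  A point of the curve lies in the disk if and only if its parameter belongs to a strand. Hence the two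
  parameters of a crossing are either both in strands or both outside.
\<close>

lemma arrows_split:
  assumes "F = D \<or> F = E"
  shows "arrows F = outer_arrows \<union> translates (inner_arrows F)"
proof -
  have F: "regular_diagram F" using assms D.regular E.regular by blast
  then interpret F: regular F by (simp add: regular_def)
  have outer: "outer_arrows = {(s, u) \<in> arrows F. s \<notin> covered \<and> u \<notin> covered}"
    using assms outer_arrows_E outer_arrows_def by blast
  have in_disk: "curve F t \<in> \<phi> ` cball 0 1 \<longleftrightarrow> t \<in> covered" for t
    using assms in_disk by blast
  show ?thesis
  proof
    show "outer_arrows \<union> translates (inner_arrows F) \<subseteq> arrows F"
      using F.periodic_arrows unfolding outer
      by (auto simp: inner_arrows_def periodic_arrows_def elim!: translatesE)
    show "arrows F \<subseteq> outer_arrows \<union> translates (inner_arrows F)"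
    proof (rule subrelI)
      fix s u assume su: "(s, u) \<in> arrows F"
      then have "curve F s = curve F u" by (simp add: arrows_def meets_def)
      then have cov: "s \<in> covered \<longleftrightarrow> u \<in> covered" using in_disk by metis
      show "(s, u) \<in> outer_arrows \<union> translates (inner_arrows F)"
      proof (cases "s \<in> covered")
        case True
        then obtain y k z l where y: "y \<in> window" "s = y + of_int k" "z \<in> window" "u = z + of_int l"
          using cov covered_window by metis
        then have "(y, z) \<in> arrows F" using su F.periodic_arrows by (simp add: periodic_arrows_def)
        then have "(y, z) \<in> inner_arrows F" using y by (simp add: inner_arrows_def)
        then show ?thesis using translatesI[of y z _ k l] y by simp
      next
        case False
        then show ?thesis using cov su by (simp add: outer)
      qed
    qed
  qed
qed

lemmas arrows_D = arrows_split[OF disjI1[OF refl]] and arrows_E = arrows_split[OF disjI2[OF refl]]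

lemma outer_sign:
  assumes "(s, u) \<in> outer_arrows"
  shows "crossing_sign D s u = crossing_sign E s u"
  using assms outside_velocity[of s] outside_velocity[of u]
  by (simp add: outer_arrows_def crossing_sign_def)

lemma in_window_strand:
  assumes "x \<in> window"
  obtains q where "q < n" "x \<in> {a q..b q}"
proof -
  have "\<exists>q<n. x \<in> {a q..b q}" using assms by (auto simp: window_def)
  then show ?thesis using that by blast
qed

lemma window_int_diff:
  assumes "x \<in> window" "y \<in> window" "x - y \<in> \<int>"
  shows "x = y"
proof -
  obtain q where q: "q < n" "x \<in> {a q..b q}" using assms(1) by (rule in_window_strand)
  obtain r where r: "r < n" "y \<in> {a r..b r}" using assms(2) by (rule in_window_strand)
  note qr = q r
  obtain k where k: "x - y = of_int k" using assms(3) by (auto elim: Ints_cases)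
  then have "y \<in> strand q (- k)" using qr by (auto simp: strand_def)
  then have "- k = 0" using strand_unique(2)[OF qr(1,3)] qr(4) by (metis strand_0)
  then show ?thesis using k by simp
qed

lemma inner_arrowI:
  assumes F: "F = D \<or> F = E" and su: "s \<in> window" "u \<in> window" "s \<noteq> u" "curve F s = curve F u"
  shows "(s, u) \<in> inner_arrows F \<longleftrightarrow> s \<in> over F"
proof -
  have "meets F s u" using su window_int_diff by (auto simp: meets_def)
  then show ?thesis using su by (simp add: inner_arrows_def arrows_def)
qed

lemma inner_arrowD:
  assumes "(s, u) \<in> inner_arrows F"
  shows "s \<in> window" "u \<in> window" "s \<noteq> u" "curve F s = curve F u" "s \<in> over F"
  using assms by (auto simp: inner_arrows_def arrows_def meets_def)

lemma locally_finite_change: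
  assumes "finite (inner_arrows D)" "finite (inner_arrows E)"
  shows "locally_finite (arrows E) \<longleftrightarrow> locally_finite (arrows D)"
proof -
  have lf: "locally_finite R \<longleftrightarrow> locally_finite outer_arrows"
    if "R = outer_arrows \<union> translates K" "finite K" for R K
  proof -
    have "Field (translates K) \<subseteq> lifts (Field K)"
      by (auto simp: Field_def lifts_def translates_def)
    then have "finite (Field (translates K) \<inter> {x..y})" for x y
      by (intro finite_subset[OF _ finite_lifts[OF finite_Field[OF that(2)], of x y]]) blast
    then show ?thesis
      unfolding locally_finite_def that(1) Field_Un Int_Un_distrib2 by simp
  qed
  show ?thesis using lf[OF arrows_D assms(1)] lf[OF arrows_E assms(2)] by simp
qed

end

section \<open>The kink and the bigon\<close>

lemma disk_changeI:
  assumes DE: "regular_diagram D" "regular_diagram E"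
    and ch: "changed_in_disk \<phi> n a b D E" and n: "0 < n"
  obtains U V where "disk_change \<phi> U V D E n a b"
proof -
  obtain U V where UV: "cball 0 1 \<subseteq> U" "diffeomorphism U V \<phi>"
    using ch unfolding changed_in_disk_def by blast
  have s: "strands_in_disk \<phi> n a b D" using ch unfolding changed_in_disk_def by blast
  have "strand_family n a b"
    using s n unfolding strands_in_disk_def by unfold_locales auto
  then have "disk_change \<phi> U V D E n a b"
    using UV DE ch by (intro disk_change.intro disk_change_axioms.intro chart.intro regular.intro)
  then show ?thesis by (rule that)
qed

context disk_change
begin

lemma abscissa_eq: "curve F s = curve F u \<Longrightarrow> abscissa F s = abscissa F u"
  by (simp add: abscissa_def)

lemma kink_invariants:
  assumes p: "p = 3 \<or> p = - 3" and n: "n = 1"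
    and inj: "inj_on (curve D) {a 0..b 0}"
    and kink: "card {(s, t). a 0 \<le> s \<and> s < t \<and> t \<le> b 0 \<and> curve E s = curve E t} = 1"
  shows "figure_count p E = figure_count p D" "locally_finite (arrows E) \<longleftrightarrow> locally_finite (arrows D)"
proof -
  have "{..<n} = {0}" using n by auto
  then have window: "window = {a 0..b 0}" by (simp add: window_def)
  have D0: "inner_arrows D = {}"
  proof (rule equals0I)
    fix x assume "x \<in> inner_arrows D"
    then obtain s u where su: "(s, u) \<in> inner_arrows D" by (cases x) auto
    from inner_arrowD[OF su] show False using inj_onD[OF inj] by (auto simp: window)
  qed
  obtain z where "{(s, t). a 0 \<le> s \<and> s < t \<and> t \<le> b 0 \<and> curve E s = curve E t} = {z}"
    using kink by (rule card_1_singletonE)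
  then obtain s1 t1 where st: "{(s, t). a 0 \<le> s \<and> s < t \<and> t \<le> b 0 \<and> curve E s = curve E t} = {(s1, t1)}"
    by (cases z) simp
  have st1: "a 0 \<le> s1" "s1 < t1" "t1 \<le> b 0" "curve E s1 = curve E t1" using st by auto
  have only: "s = s1 \<and> t = t1" if "a 0 \<le> s" "s < t" "t \<le> b 0" "curve E s = curve E t" for s t
    using that st by blast
  obtain s0 u0 where su0: "inner_arrows E = {(s0, u0)}" "s0 \<in> {a 0..b 0}" "u0 \<in> {a 0..b 0}"
  proof -
    have pairs: "(s, u) = (s1, t1) \<or> (s, u) = (t1, s1)" if "(s, u) \<in> inner_arrows E" for s u
      using inner_arrowD[OF that] only[of s u] only[of u s] by (cases s u rule: linorder_cases) (auto simp: window)
    have mem: "(s1, t1) \<in> inner_arrows E \<longleftrightarrow> s1 \<in> over E" "(t1, s1) \<in> inner_arrows E \<longleftrightarrow> t1 \<in> over E"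
      using inner_arrowI[of E s1 t1] inner_arrowI[of E t1 s1] st1 by (auto simp: window)
    have "meets E s1 t1" using window_int_diff[of s1 t1] st1 by (auto simp: meets_def window)
    then have ov: "s1 \<in> over E \<longleftrightarrow> t1 \<notin> over E" by (rule E.over_under)
    show ?thesis
    proof (cases "s1 \<in> over E")
      case True
      then have "inner_arrows E = {(s1, t1)}" using pairs mem ov by auto
      then show ?thesis using that[of s1 t1] st1 by simp
    next
      case False
      then have "inner_arrows E = {(t1, s1)}" using pairs mem ov by auto
      then show ?thesis using that[of t1 s1] st1 by simp
    qed
  qed
  have R: "arrows E = outer_arrows \<union> translates {(s0, u0)}" using arrows_E su0(1) by simp
  have RD: "arrows D = outer_arrows" using arrows_D D0 by (simp add: translates_def)
  have "0 < n" by (simp add: n)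
  from pattern_count_kink[OF R p outer_disjoint this su0(2,3), of "crossing_sign E" "crossing_sign D" 0]
  show "figure_count p E = figure_count p D"
    using outer_sign unfolding figure_count_def RD by simp
  show "locally_finite (arrows E) \<longleftrightarrow> locally_finite (arrows D)"
    using locally_finite_change D0 su0(1) by simp
qed

lemma graph_strandI:
  assumes F: "F = D \<or> F = E" and q: "q < n" and g: "\<And>x. g differentiable (at x)"
    and image: "curve F ` {a q..b q} = \<phi> ` graph_in_disk g"
  shows "graph_strand \<phi> U V F (a q) (b q) g"
proof -
  have "regular_diagram F" using F D.regular E.regular by blast
  moreover have "(g has_real_derivative deriv g x) (at x)" for x
    using g DERIV_deriv_iff_real_differentiable by blast
  ultimately show ?thesis
    using strand_less[OF q] image chart_axioms
    by (intro graph_strand.intro graph_strand_axioms.intro regular.intro)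
qed

text \<open>
  The chart is injective on the disk, so that points of the curve can be compared in the model.
\<close>

lemma graph_crossing_ordinates:
  assumes s: "graph_strand \<phi> U V F x1 y1 g" "s \<in> {x1..y1}"
    and u: "graph_strand \<phi> U V F x2 y2 g'" "u \<in> {x2..y2}"
  shows "curve F s = curve F u \<longleftrightarrow> abscissa F s = abscissa F u \<and> g (abscissa F s) = g' (abscissa F u)"
proof
  assume eq: "curve F s = curve F u"
  then have x: "abscissa F s = abscissa F u" by (rule abscissa_eq)
  have "\<phi> (vector [abscissa F s, g (abscissa F s)]) = \<phi> (vector [abscissa F u, g' (abscissa F u)])"
    using graph_strand.graph_point(1)[OF s] graph_strand.graph_point(1)[OF u] eq by simp
  then have "vector [abscissa F s, g (abscissa F s)] = (vector [abscissa F u, g' (abscissa F u)] :: plane)"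
    using graph_strand.graph_point(2)[OF s] graph_strand.graph_point(2)[OF u] disk_subset chart_inv_chart
    by (metis subsetD)
  then have "g (abscissa F s) = g' (abscissa F u)" by (metis vector_2(2))
  with x show "abscissa F s = abscissa F u \<and> g (abscissa F s) = g' (abscissa F u)" by simp
next
  assume eq: "abscissa F s = abscissa F u \<and> g (abscissa F s) = g' (abscissa F u)"
  have "curve F s = \<phi> (vector [abscissa F s, g (abscissa F s)])"
    by (rule graph_strand.graph_point(1)[OF s])
  also have "\<dots> = \<phi> (vector [abscissa F u, g' (abscissa F u)])"
    unfolding conjunct2[OF eq] by (simp add: conjunct1[OF eq])
  also have "\<dots> = curve F u" by (rule graph_strand.graph_point(1)[OF u, symmetric])
  finally show "curve F s = curve F u" .
qed

lemma graph_point_inside: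
  assumes F: "F = D \<or> F = E" and q: "q < n"
    and g: "graph_strand \<phi> U V F (a q) (b q) g" and x: "vector [x, g x] \<in> (ball 0 1 :: plane set)"
  obtains t where "t \<in> {a q<..<b q}" "abscissa F t = x"
proof -
  have "vector [x, g x] \<in> (cball 0 1 :: plane set)" using x by auto
  then obtain t where t: "t \<in> {a q..b q}" "curve F t = \<phi> (vector [x, g x])" "abscissa F t = x"
    using graph_strand.graph_point_exists[OF g] by blast
  then have "t \<in> {a q<..<b q}" using in_open_disk[of F q t] F q x by blast
  then show ?thesis using that t(3) by blast
qed

end

lemma norm_vector_2: "norm (vector [x, y] :: plane) = sqrt (x\<^sup>2 + y\<^sup>2)"
  by (simp add: norm_vec_def L2_set_def sum_2)

lemma in_ball_vector: "x\<^sup>2 + y\<^sup>2 < 1 \<Longrightarrow> vector [x, y] \<in> (ball 0 1 :: plane set)"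
  using real_sqrt_less_mono[of "x\<^sup>2 + y\<^sup>2" 1] by (simp add: norm_vector_2)

text \<open>
  As \<open>h\<close> is positive far away and has no further zeros, it is positive to the left of the
  first zero and to the right of the second one.
\<close>

lemma two_zeros:
  assumes h: "smooth_on UNIV h" "\<And>x. \<bar>x\<bar> \<ge> 1/2 \<Longrightarrow> h x = (1/2 :: real)"
    and zeros: "card {x. h x = 0} = 2"
  obtains x1 x2 :: real where "{x. h x = 0} = {x1, x2}" "x1 < x2" "\<bar>x1\<bar> < 1/2" "\<bar>x2\<bar> < 1/2"
    "deriv h x1 \<le> 0" "0 \<le> deriv h x2"
proof -
  obtain x y where xy: "{x. h x = 0} = {x, y}" "x \<noteq> y" using zeros by (auto simp: card_2_iff)
  define x1 where "x1 = min x y"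
  define x2 where "x2 = max x y"
  have x12: "{x. h x = 0} = {x1, x2}" "x1 < x2"
    using xy by (auto simp: x1_def x2_def min_def max_def)
  have small: "\<bar>z\<bar> < 1/2" if "h z = 0" for z using h(2)[of z] that by force
  have DERIV: "(h has_real_derivative deriv h z) (at z)" for z
    using smooth_on_differentiable[OF h(1), of z] DERIV_deriv_iff_real_differentiable by blast
  have cont: "isCont h z" for z using DERIV DERIV_isCont by blast
  have left: "h z > 0" if "z < x1" for z
  proof (rule ccontr)
    assume "\<not> h z > 0"
    define w where "w = min z (- 1)"
    have "h w = 1/2" "w \<le> z" by (auto simp: w_def h(2))
    then obtain v where "w \<le> v" "v \<le> z" "h v = 0"
      using IVT2[of h z 0 w] \<open>\<not> h z > 0\<close> cont by auto
    then have "v \<in> {x1, x2}" using x12(1) by blast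
    then show False using \<open>v \<le> z\<close> that x12(2) by auto
  qed
  have right: "h z > 0" if "x2 < z" for z
  proof (rule ccontr)
    assume "\<not> h z > 0"
    define w where "w = max z 1"
    have "h w = 1/2" "z \<le> w" by (auto simp: w_def h(2))
    then obtain v where "z \<le> v" "v \<le> w" "h v = 0"
      using IVT[of h z 0 w] \<open>\<not> h z > 0\<close> cont by auto
    then have "v \<in> {x1, x2}" using x12(1) by blast
    then show False using \<open>z \<le> v\<close> that x12(2) by auto
  qed
  have h0: "h x1 = 0" "h x2 = 0" using x12(1) by auto
  have "deriv h x1 \<le> 0"
  proof (rule ccontr)
    assume "\<not> deriv h x1 \<le> 0"
    then obtain d where "d > 0" "\<And>e. 0 < e \<Longrightarrow> e < d \<Longrightarrow> h (x1 - e) < h x1"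
      using DERIV_pos_inc_left[OF DERIV, of x1] by force
    from this(2)[of "d / 2"] \<open>d > 0\<close> left[of "x1 - d / 2"] show False by (simp add: h0)
  qed
  moreover have "0 \<le> deriv h x2"
  proof (rule ccontr)
    assume "\<not> 0 \<le> deriv h x2"
    then obtain d where "d > 0" "\<And>e. 0 < e \<Longrightarrow> e < d \<Longrightarrow> h x2 > h (x2 + e)"
      using DERIV_neg_dec_right[OF DERIV, of x2] by force
    from this(2)[of "d / 2"] \<open>d > 0\<close> right[of "x2 + d / 2"] show False by (simp add: h0)
  qed
  ultimately show ?thesis using that[OF x12] small h0 by blast
qed

context disk_change
begin

lemma window_2: "n = 2 \<Longrightarrow> x \<in> window \<longleftrightarrow> x \<in> {a 0..b 0} \<or> x \<in> {a 1..b 1}"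
  unfolding window_def by (auto simp: less_2_cases_iff)

text \<open>
  The slopes of \<open>h\<close> at its two zeros have opposite signs by \<open>two_zeros\<close>, neither
  being zero by transversality, whereas all other factors of the signs of the two crossings agree.
  Finiteness enters because cancellation is only meaningful in a finite sum.
\<close>

lemma bigon_invariants:
  assumes p: "p = 3 \<or> p = - 3" and n: "n = 2"
    and h: "smooth_on UNIV h" "\<And>x. \<bar>x\<bar> \<ge> 1/2 \<Longrightarrow> h x = 1/2" "card {x. h x = 0} = 2"
    and D_images: "curve D ` {a 0..b 0} = \<phi> ` graph_in_disk (\<lambda>x. 0)"
      "curve D ` {a 1..b 1} = \<phi> ` graph_in_disk (\<lambda>x. 1/2)"
    and E_images: "curve E ` {a 0..b 0} = \<phi> ` graph_in_disk (\<lambda>x. 0)"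
      "curve E ` {a 1..b 1} = \<phi> ` graph_in_disk h"
    and over: "strand_over E {a 0..b 0} {a 1..b 1} \<or> strand_over E {a 1..b 1} {a 0..b 0}"
  shows "locally_finite (arrows E) \<longleftrightarrow> locally_finite (arrows D)"
    "locally_finite (arrows D) \<Longrightarrow> figure_count p E = figure_count p D"
proof -
  have lt: "0 < n" "1 < n" by (simp_all add: n)
  have h_diff: "h differentiable (at x)" for x using smooth_on_differentiable[OF h(1)] by simp
  have D0: "graph_strand \<phi> U V D (a 0) (b 0) (\<lambda>x. 0)" and D1: "graph_strand \<phi> U V D (a 1) (b 1) (\<lambda>x. 1/2)"
    and E0: "graph_strand \<phi> U V E (a 0) (b 0) (\<lambda>x. 0)" and E1: "graph_strand \<phi> U V E (a 1) (b 1) h"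
    using D_images E_images lt h_diff by (auto intro!: graph_strandI)
  have inner_D: "inner_arrows D = {}"
  proof (rule equals0I)
    fix x assume "x \<in> inner_arrows D"
    then obtain s u where "(s, u) \<in> inner_arrows D" by (cases x) auto
    note su = inner_arrowD[OF this]
    show False
      using su(1,2)[unfolded window_2[OF n]] su(3,4) graph_strand.curve_inj_on_strand[OF D0, of s u]
        graph_strand.curve_inj_on_strand[OF D1, of s u]
        graph_crossing_ordinates[OF D0 _ D1, of s u] graph_crossing_ordinates[OF D1 _ D0, of s u] by auto
  qed
  obtain x1 x2 where x: "{x. h x = 0} = {x1, x2}" "x1 < x2" "\<bar>x1\<bar> < 1/2" "\<bar>x2\<bar> < 1/2"
    "deriv h x1 \<le> 0" "0 \<le> deriv h x2"
    by (rule two_zeros[OF h])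
  have h0: "h y = 0 \<longleftrightarrow> y = x1 \<or> y = x2" for y using x(1) by blast
  have ball: "vector [y, 0] \<in> (ball 0 1 :: plane set)" if "\<bar>y\<bar> < 1/2" for y
  proof (rule in_ball_vector)
    have "\<bar>y\<bar>\<^sup>2 < 1\<^sup>2" using that by (intro power_strict_mono) auto
    then show "y\<^sup>2 + 0\<^sup>2 < 1" by simp
  qed
  have E_F: "E = D \<or> E = E" by simp
  obtain s1 where s1: "s1 \<in> {a 0<..<b 0}" "abscissa E s1 = x1"
    by (rule graph_point_inside[OF E_F lt(1) E0 ball[OF x(3)]])
  obtain s2 where s2: "s2 \<in> {a 0<..<b 0}" "abscissa E s2 = x2"
    by (rule graph_point_inside[OF E_F lt(1) E0 ball[OF x(4)]])
  have ball_h: "vector [x1, h x1] \<in> (ball 0 1 :: plane set)" "vector [x2, h x2] \<in> (ball 0 1 :: plane set)"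
    using ball x(3,4) h0[of x1] h0[of x2] by simp_all
  obtain u1 where u1: "u1 \<in> {a 1<..<b 1}" "abscissa E u1 = x1"
    by (rule graph_point_inside[OF E_F lt(2) E1 ball_h(1)])
  obtain u2 where u2: "u2 \<in> {a 1<..<b 1}" "abscissa E u2 = x2"
    by (rule graph_point_inside[OF E_F lt(2) E1 ball_h(2)])
  have in_strand: "s1 \<in> {a 0..b 0}" "s2 \<in> {a 0..b 0}" "u1 \<in> {a 1..b 1}" "u2 \<in> {a 1..b 1}"
    using s1 s2 u1 u2 by auto
  have ne: "s1 \<noteq> s2" "u1 \<noteq> u2" using s1 s2 u1 u2 x(2) by auto
  have inj: "s = t" if "abscissa E s = abscissa E t" "s \<in> {a 0..b 0} \<and> t \<in> {a 0..b 0} \<or> s \<in> {a 1..b 1} \<and> t \<in> {a 1..b 1}" for s t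
    using that inj_onD[OF graph_strand.abscissa_inj[OF E0]] inj_onD[OF graph_strand.abscissa_inj[OF E1]] by blast
  have crossing: "curve E s = curve E u \<longleftrightarrow> (s, u) \<in> {(s1, u1), (s2, u2)}"
    if su: "s \<in> {a 0..b 0}" "u \<in> {a 1..b 1}" for s u
  proof
    assume "curve E s = curve E u"
    then have "abscissa E s = abscissa E u" "h (abscissa E u) = 0"
      using graph_crossing_ordinates[OF E0 su(1) E1 su(2)] by auto
    then show "(s, u) \<in> {(s1, u1), (s2, u2)}"
      using inj[of s s1] inj[of s s2] inj[of u u1] inj[of u u2] in_strand su s1 s2 u1 u2 h0 by auto
  next
    assume "(s, u) \<in> {(s1, u1), (s2, u2)}"
    then show "curve E s = curve E u"
      using graph_crossing_ordinates[OF E0 su(1) E1 su(2)] s1 s2 u1 u2 h0 by auto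
  qed
  have eq: "curve E s1 = curve E u1" "curve E s2 = curve E u2"
    using crossing in_strand by auto
  have pairs: "(s, u) \<in> {(s1, u1), (s2, u2), (u1, s1), (u2, s2)}" if su: "(s, u) \<in> inner_arrows E" for s u
    using inner_arrowD[OF su] crossing[of s u] crossing[of u s]
      graph_strand.curve_inj_on_strand[OF E0, of s u] graph_strand.curve_inj_on_strand[OF E1, of s u]
    unfolding window_2[OF n] by auto
  have su_ne: "s \<noteq> u" if "s \<in> {a 0..b 0}" "u \<in> {a 1..b 1}" for s u
    using interval_unique[OF lt that(1)] that(2) by auto
  have mem: "(s, u) \<in> inner_arrows E \<longleftrightarrow> s \<in> over E" "(u, s) \<in> inner_arrows E \<longleftrightarrow> u \<in> over E"
    if "s \<in> {a 0..b 0}" "u \<in> {a 1..b 1}" "curve E s = curve E u" for s u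
    using inner_arrowI[of E s u] inner_arrowI[of E u s] that su_ne[OF that(1,2)] window_2[OF n] by auto
  have sign: "crossing_sign E s1 u1 = - crossing_sign E s2 u2" "crossing_sign E u1 s1 = - crossing_sign E u2 s2"
  proof -
    define c where "c = sgn (det (matrix (d\<phi> 0))) * sgn (abscissa E (b 0) - abscissa E (a 0)) *
      sgn (abscissa E (b 1) - abscissa E (a 1))"
    have c: "crossing_sign E s u = c * sgn (deriv h (abscissa E s))"
      if "s \<in> {a 0<..<b 0}" "u \<in> {a 1<..<b 1}" "curve E s = curve E u" for s u
      using graph_crossing_sign[OF E0 that(1) E1 that(2,3)] by (simp add: c_def)
    have meets: "meets E s1 u1" "meets E s2 u2"
      using eq in_strand su_ne window_int_diff window_2[OF n] by (auto simp: meets_def)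
    have "crossing_sign E s1 u1 \<noteq> 0" "crossing_sign E s2 u2 \<noteq> 0"
      using E.transversal[OF meets(1)] E.transversal[OF meets(2)] by (simp_all add: crossing_sign_def sgn_0_0)
    then have "deriv h x1 \<noteq> 0" "deriv h x2 \<noteq> 0"
      using c[OF s1(1) u1(1) eq(1)] c[OF s2(1) u2(1) eq(2)] s1(2) s2(2) by auto
    then have "deriv h x1 < 0" "0 < deriv h x2" using x(5,6) by auto
    then show opposite: "crossing_sign E s1 u1 = - crossing_sign E s2 u2"
      using c[OF s1(1) u1(1) eq(1)] c[OF s2(1) u2(1) eq(2)] s1 s2 by simp
    have swap: "crossing_sign E u s = - crossing_sign E s u" for s u
      unfolding crossing_sign_def det_vector_2 sgn_minus[symmetric] by (simp add: algebra_simps)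
    show "crossing_sign E u1 s1 = - crossing_sign E u2 s2"
      unfolding swap[of u1 s1] swap[of u2 s2] opposite ..
  qed
  \<comment> \<open>Which of the two strands is over decides the direction of both arrows.\<close>
  have inner_E: "inner_arrows E = {(s1, u1), (s2, u2)} \<or> inner_arrows E = {(u1, s1), (u2, s2)}"
    using over
  proof
    assume "strand_over E {a 0..b 0} {a 1..b 1}"
    then have "s1 \<in> over E" "u1 \<notin> over E" "s2 \<in> over E" "u2 \<notin> over E"
      using in_strand eq unfolding strand_over_def by blast+
    then have "inner_arrows E = {(s1, u1), (s2, u2)}"
      using pairs mem[OF in_strand(1,3) eq(1)] mem[OF in_strand(2,4) eq(2)] by auto
    then show ?thesis ..
  next
    assume "strand_over E {a 1..b 1} {a 0..b 0}"
    then have "s1 \<notin> over E" "u1 \<in> over E" "s2 \<notin> over E" "u2 \<in> over E"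
      using in_strand eq unfolding strand_over_def by metis+
    then have "inner_arrows E = {(u1, s1), (u2, s2)}"
      using pairs mem[OF in_strand(1,3) eq(1)] mem[OF in_strand(2,4) eq(2)] by auto
    then show ?thesis ..
  qed
  then have "finite (inner_arrows E)" by auto
  then show lf: "locally_finite (arrows E) \<longleftrightarrow> locally_finite (arrows D)"
    using locally_finite_change inner_D by simp
  have RD: "arrows D = outer_arrows" using arrows_D inner_D by (simp add: translates_def)
  have odd: "odd p" using p by auto
  assume "locally_finite (arrows D)"
  then have lfE: "locally_finite (arrows E)" using lf by simp
  have "pattern_count p (crossing_sign E) (arrows E) (a 0) = pattern_count p (crossing_sign D) outer_arrows (a 0)"
    using inner_E
  proof
    assume "inner_arrows E = {(s1, u1), (s2, u2)}"
    then have R: "arrows E = outer_arrows \<union> translates {(s1, u1), (s2, u2)}" using arrows_E by simp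
    show ?thesis
      by (rule pattern_count_bigon[OF R odd outer_disjoint lt _ in_strand(1,2) ne(1) in_strand(3,4) ne(2)
            E.periodic_arrows E.periodic_sign lfE E.Domain_Range _ sign(1)])
        (simp_all add: outer_sign)
  next
    assume "inner_arrows E = {(u1, s1), (u2, s2)}"
    then have R: "arrows E = outer_arrows \<union> translates {(u1, s1), (u2, s2)}" using arrows_E by simp
    show ?thesis
      by (rule pattern_count_bigon[OF R odd outer_disjoint lt(2,1) _ in_strand(3,4) ne(2) in_strand(1,2) ne(1)
            E.periodic_arrows E.periodic_sign lfE E.Domain_Range _ sign(2)])
        (simp_all add: outer_sign)
  qed
  then show "figure_count p E = figure_count p D"
    using E.figure_count_base[of p "a 0"] D.figure_count_base[of p "a 0"] RD by simp
qed

end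

section \<open>The triangle\<close>

definition model_line :: "(real \<Rightarrow> real) \<Rightarrow> nat \<Rightarrow> real \<Rightarrow> real" where
  "model_line h j = (if j = 0 then (\<lambda>x. x) else if j = 1 then (\<lambda>x. - x) else h)"

text \<open>
  The slopes of the two diagonals; the slope of \<open>h\<close> lies strictly between them, so that 0 may
  stand for it when slopes are compared.
\<close>

definition model_slope :: "nat \<Rightarrow> real" where
  "model_slope j = (if j = 0 then 1 else if j = 1 then - 1 else 0)"

lemma omega3_model_line: "omega3_model h j = graph_in_disk (model_line h j)"
  by (simp add: omega3_model_def model_line_def)

text \<open>
  The function \<open>x - h x\<close> is strictly increasing and changes its sign between -1/2 and 1/2.
\<close>

lemma contraction_meets_diagonal:
  assumes h: "\<And>x. (h has_real_derivative h' x) (at x)" "\<And>x. \<bar>h' x\<bar> < 1" "\<And>x. \<bar>x\<bar> \<ge> 1/2 \<Longrightarrow> h x = 0"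
  shows "\<exists>x. (\<forall>y. h y = y \<longleftrightarrow> y = x) \<and> \<bar>x\<bar> < (1/2 :: real)"
proof -
  let ?f = "\<lambda>x. x - h x"
  have deriv: "(?f has_real_derivative 1 - h' x) (at x)" for x
    using h(1) by (auto intro!: derivative_eq_intros)
  have mono: "?f x < ?f y" if "x < y" for x y
  proof (rule DERIV_pos_imp_increasing[OF that])
    fix z
    have "1 - h' z > 0" using h(2)[of z] by linarith
    then show "\<exists>d. (?f has_real_derivative d) (at z) \<and> d > 0" using deriv by blast
  qed
  have "\<exists>x. - 1/2 \<le> x \<and> x \<le> 1/2 \<and> ?f x = 0"
    using deriv DERIV_isCont by (intro IVT) (auto simp: h(3))
  then obtain x where x: "?f x = 0" by blast
  have "h y = y \<longleftrightarrow> y = x" for y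
    using mono[of x y] mono[of y x] x by (cases x y rule: linorder_cases) auto
  moreover have "\<bar>x\<bar> < 1/2"
    using h(3)[of x] x by (cases "\<bar>x\<bar> \<ge> 1/2") auto
  ultimately show ?thesis by blast
qed

lemma model_line_differentiable:
  assumes "omega3_function h"
  shows "model_line h j differentiable (at x)"
  using assms smooth_on_differentiable[of UNIV h x]
  by (auto simp: model_line_def omega3_function_def)

lemma model_lines_meet:
  assumes h: "omega3_function h" and jk: "j < 3" "k < 3" "j \<noteq> k"
  shows "\<exists>x. (\<forall>y. model_line h j y = model_line h k y \<longleftrightarrow> y = x) \<and> \<bar>x\<bar> < 1/2 \<and>
    \<bar>model_line h j x\<bar> < 1/2"
proof -
  have d: "(h has_real_derivative deriv h x) (at x)" for x
    using h smooth_on_differentiable[of UNIV h x] DERIV_deriv_iff_real_differentiable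
    by (auto simp: omega3_function_def)
  have h1: "\<bar>deriv h x\<bar> < 1" "\<bar>x\<bar> \<ge> 1/2 \<Longrightarrow> h x = 0" for x
    using h by (auto simp: omega3_function_def)
  obtain x where x: "\<And>y. h y = y \<longleftrightarrow> y = x" "\<bar>x\<bar> < 1/2"
    using contraction_meets_diagonal[OF d h1] by blast
  have "((\<lambda>x. - h x) has_real_derivative - deriv h x) (at x)" for x
    using d by (auto intro!: derivative_eq_intros)
  then obtain x' where x': "\<And>y. - h y = y \<longleftrightarrow> y = x'" "\<bar>x'\<bar> < 1/2"
    using contraction_meets_diagonal[of "\<lambda>x. - h x" "\<lambda>x. - deriv h x"] h1 by auto
  have hx: "h x = x" "h x' = - x'" using x(1)[of x] x'(1)[of x'] by auto
  have y: "y = h y \<longleftrightarrow> y = x" "- y = h y \<longleftrightarrow> y = x'" "h y = - y \<longleftrightarrow> y = x'" for y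
    using x(1)[of y] x'(1)[of y] by auto
  consider "j = 0" "k = 1" | "j = 1" "k = 0" | "j = 0" "k = 2" | "j = 2" "k = 0" | "j = 1" "k = 2" | "j = 2" "k = 1"
    using jk by linarith
  then show ?thesis
  proof cases
    case 1
    then show ?thesis by (intro exI[of _ 0]) (auto simp: model_line_def)
  next
    case 2
    then show ?thesis by (intro exI[of _ 0]) (auto simp: model_line_def)
  next
    case 3
    then show ?thesis using x by (intro exI[of _ x]) (auto simp: model_line_def y)
  next
    case 4
    then show ?thesis using x(2) by (intro exI[of _ x]) (auto simp: model_line_def x(1) hx(1))
  next
    case 5
    then show ?thesis using x' by (intro exI[of _ x']) (auto simp: model_line_def y)
  next
    case 6
    then show ?thesis using x'(2) by (intro exI[of _ x']) (auto simp: model_line_def y hx(2))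
  qed
qed

lemma model_line_slopes:
  assumes h: "omega3_function h" and jk: "j < 3" "k < 3"
  shows "sgn (deriv (model_line h k) x - deriv (model_line h j) x) = sgn (model_slope k - model_slope j)"
proof -
  have "\<bar>deriv h x\<bar> < 1" using h by (simp add: omega3_function_def)
  then have "deriv h x < 1" "- 1 < deriv h x" by auto
  moreover have "j = 0 \<or> j = 1 \<or> j = 2" "k = 0 \<or> k = 1 \<or> k = 2" using jk by auto
  ultimately show ?thesis
    by (elim disjE) (simp_all add: model_line_def model_slope_def)
qed

context disk_change
begin

text \<open>
  The formula for the signs refers to the end points of the strands and to \<open>\<pi>\<close> only. It
  is therefore the same before and after the move.
\<close>

lemma triangle_crossings:
  assumes F: "F = D \<or> F = E" and n: "n = 3" and ml: "m = 1 \<and> l = 2 \<or> m = 2 \<and> l = 1"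
    and h: "omega3_function h" and \<pi>: "bij_betw \<pi> {..<3} {..<3 :: nat}"
    and images: "\<And>i. i < 3 \<Longrightarrow> curve F ` {a i..b i} = \<phi> ` omega3_model h (\<pi> i)"
    and over: "strand_over F {a 0..b 0} {a m..b m}" "strand_over F {a 0..b 0} {a l..b l}"
      "strand_over F {a m..b m} {a l..b l}"
  obtains X where "strand_points X" "inner_arrows F = triangle X m l"
    "\<And>q r. q < 3 \<Longrightarrow> r < 3 \<Longrightarrow> q \<noteq> r \<Longrightarrow> crossing_sign F (X q r) (X r q) =
      sgn (det (matrix (d\<phi> 0))) * sgn (abscissa D (b q) - abscissa D (a q)) *
      sgn (abscissa D (b r) - abscissa D (a r)) * sgn (model_slope (\<pi> r) - model_slope (\<pi> q))"
proof -
  interpret F: regular F using F D.regular_axioms E.regular_axioms by blast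
  define g where "g = (\<lambda>q. model_line h (\<pi> q))"
  have \<pi>3: "\<pi> q < 3" if "q < 3" for q using bij_betwE[OF \<pi>] that by auto
  have \<pi>_inj: "\<pi> q \<noteq> \<pi> r" if "q < 3" "r < 3" "q \<noteq> r" for q r
    using inj_onD[OF bij_betw_imp_inj_on[OF \<pi>], of q r] that by auto
  have G: "graph_strand \<phi> U V F (a q) (b q) (g q)" if q: "q < 3" for q
    unfolding g_def using q n images[OF q] omega3_model_line model_line_differentiable[OF h]
    by (intro graph_strandI[OF F]) auto
  define x where "x = (\<lambda>q r. SOME x. (\<forall>y. g q y = g r y \<longleftrightarrow> y = x) \<and> \<bar>x\<bar> < 1/2 \<and> \<bar>g q x\<bar> < 1/2)"
  have x: "(\<forall>y. g q y = g r y \<longleftrightarrow> y = x q r) \<and> \<bar>x q r\<bar> < 1/2 \<and> \<bar>g q (x q r)\<bar> < 1/2"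
    if "q < 3" "r < 3" "q \<noteq> r" for q r
    unfolding x_def g_def
    by (rule someI_ex) (rule model_lines_meet[OF h \<pi>3[OF that(1)] \<pi>3[OF that(2)] \<pi>_inj[OF that]])
  have meet_iff: "g q y = g r y \<longleftrightarrow> y = x q r" if "q < 3" "r < 3" "q \<noteq> r" for q r y
    using x[OF that] by blast
  have x_sym: "x r q = x q r" if "q < 3" "r < 3" "q \<noteq> r" for q r
    using meet_iff[OF that, of "x q r"] meet_iff[OF that(2,1) that(3)[symmetric], of "x q r"] by simp
  define X where "X = (\<lambda>q r. SOME t. t \<in> {a q<..<b q} \<and> abscissa F t = x q r)"
  have X_ex: "\<exists>t. t \<in> {a q<..<b q} \<and> abscissa F t = x q r" if qr: "q < 3" "r < 3" "q \<noteq> r" for q r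
  proof -
    have sq: "z\<^sup>2 < 1/4" if "\<bar>z\<bar> < 1/2" for z :: real
      using power_strict_mono[OF that, of 2] by (simp add: power2_eq_square)
    have "vector [x q r, g q (x q r)] \<in> (ball 0 1 :: plane set)"
      using sq[of "x q r"] sq[of "g q (x q r)"] x[OF qr] by (intro in_ball_vector) linarith
    then obtain t where "t \<in> {a q<..<b q}" "abscissa F t = x q r"
      using graph_point_inside[OF F _ G[OF qr(1)]] qr(1) n by auto
    then show ?thesis by blast
  qed
  have X: "X q r \<in> {a q<..<b q}" "abscissa F (X q r) = x q r" if "q < 3" "r < 3" "q \<noteq> r" for q r
    using someI_ex[OF X_ex[OF that]] unfolding X_def by auto
  have X_in: "X q r \<in> {a q..b q}" if "q < 3" "r < 3" "q \<noteq> r" for q r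
    using X(1)[OF that] by auto
  have crossing: "curve F s = curve F u \<longleftrightarrow> s = X q r \<and> u = X r q"
    if qr: "q < 3" "r < 3" "q \<noteq> r" and su: "s \<in> {a q..b q}" "u \<in> {a r..b r}" for q r s u
  proof -
    have "curve F s = curve F u \<longleftrightarrow> abscissa F s = abscissa F u \<and> g q (abscissa F s) = g r (abscissa F u)"
      by (rule graph_crossing_ordinates[OF G[OF qr(1)] su(1) G[OF qr(2)] su(2)])
    also have "\<dots> \<longleftrightarrow> abscissa F s = x q r \<and> abscissa F u = x q r"
      using meet_iff[OF qr, of "abscissa F s"] meet_iff[OF qr, of "abscissa F u"] by auto
    also have "\<dots> \<longleftrightarrow> abscissa F s = abscissa F (X q r) \<and> abscissa F u = abscissa F (X r q)"
      using X(2)[OF qr] X(2)[OF qr(2,1) qr(3)[symmetric]] x_sym[OF qr] by simp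
    also have "\<dots> \<longleftrightarrow> s = X q r \<and> u = X r q"
      using inj_on_eq_iff[OF graph_strand.abscissa_inj[OF G[OF qr(1)]] su(1) X_in[OF qr]]
        inj_on_eq_iff[OF graph_strand.abscissa_inj[OF G[OF qr(2)]] su(2) X_in[OF qr(2,1) qr(3)[symmetric]]]
      by simp
    finally show ?thesis .
  qed
  have meet: "curve F (X q r) = curve F (X r q)" if "q < 3" "r < 3" "q \<noteq> r" for q r
    using crossing[OF that X_in[OF that] X_in[OF that(2,1) that(3)[symmetric]]] by simp
  have X_win: "X q r \<in> window" if "q < 3" "r < 3" "q \<noteq> r" for q r
    using windowI[OF _ X_in[OF that]] that(1) n by simp
  have apart: "s \<noteq> u" if "q < 3" "r < 3" "q \<noteq> r" "s \<in> {a q..b q}" "u \<in> {a r..b r}" for q r s u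
    using interval_unique[of q r s] that n by auto
  \<comment> \<open>Two crossings at the same point of a strand would be a triple point of the curve.\<close>
  have pts: "strand_points X"
    unfolding strand_points_def
  proof (intro allI impI conjI)
    fix q r assume "q < n" "r < n" and qr: "q \<noteq> r"
    then have q: "q < 3" "r < 3" "q \<noteq> r" and q_sym: "r < 3" "q < 3" "r \<noteq> q" using n by auto
    show "X q r \<in> {a q..b q}" using X_in[OF q] .
    fix r' assume "r' < n" "r' \<noteq> q" and eq: "X q r = X q r'"
    then have r': "q < 3" "r' < 3" "q \<noteq> r'" and r'_sym: "r' < 3" "q < 3" "r' \<noteq> q" using n q by auto
    show "r = r'"
    proof (rule ccontr)
      assume ne: "r \<noteq> r'"
      note in_r = X_in[OF q_sym] X_in[OF r'_sym]
      note win = X_win[OF q_sym] X_win[OF q] X_win[OF r'_sym]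
      have "curve F (X r q) = curve F (X q r)" "curve F (X q r) = curve F (X r' q)"
        using meet[OF q] meet[OF r'] eq by simp_all
      moreover have "X r q \<noteq> X q r" by (rule apart[OF q_sym in_r(1) X_in[OF q]])
      moreover have "X q r \<noteq> X r' q" by (rule apart[OF r' X_in[OF q] in_r(2)])
      ultimately have "meets F (X r q) (X q r)" "meets F (X q r) (X r' q)"
        using window_int_diff[OF win(1,2)] window_int_diff[OF win(2,3)] unfolding meets_def by blast+
      then have "X r q - X r' q \<in> \<int>" by (rule F.no_triple)
      then have "X r q = X r' q" by (rule window_int_diff[OF win(1,3)])
      then show False using apart[OF q(2) r'(2) ne in_r] by blast
    qed
  qed
  have over': "s \<in> over F \<and> u \<notin> over F"
    if "(q, r) \<in> {(0, m), (0, l), (m, l)}" "s \<in> {a q..b q}" "u \<in> {a r..b r}" "curve F s = curve F u" for q r s u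
  proof -
    from that(1) consider "q = 0" "r = m" | "q = 0" "r = l" | "q = m" "r = l" by auto
    then show ?thesis
      by cases (use that(2-) over in \<open>simp_all add: strand_over_def\<close>)
  qed
  have pair_lt: "q < 3" "r < 3" "q \<noteq> r" if "(q, r) \<in> {(0, m), (0, l), (m, l)}" for q r
    using that ml by auto
  have inner: "inner_arrows F = triangle X m l"
  proof
    show "inner_arrows F \<subseteq> triangle X m l"
    proof (rule subrelI)
      fix s u assume "(s, u) \<in> inner_arrows F"
      note su = inner_arrowD[OF this]
      obtain q where q: "q < n" "s \<in> {a q..b q}" using su(1) by (rule in_window_strand)
      obtain r where r: "r < n" "u \<in> {a r..b r}" using su(2) by (rule in_window_strand)
      note q = q[unfolded n] and r = r[unfolded n]
      have qr: "q \<noteq> r"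
        using graph_strand.curve_inj_on_strand[OF G[OF q(1)] q(2), of u] r su(3,4) by auto
      have eq: "s = X q r" "u = X r q" using crossing[OF q(1) r(1) qr q(2) r(2)] su(4) by auto
      have "(r, q) \<notin> {(0, m), (0, l), (m, l)}"
        using over'[of r q u s] q r su(4,5) by auto
      then have "(q, r) \<in> {(0, m), (0, l), (m, l)}" using q(1) r(1) qr ml by auto
      then show "(s, u) \<in> triangle X m l" unfolding eq triangle_def by auto
    qed
    show "triangle X m l \<subseteq> inner_arrows F"
    proof (rule subrelI)
      fix s u assume "(s, u) \<in> triangle X m l"
      then obtain q r where qr: "(q, r) \<in> {(0, m), (0, l), (m, l)}" "s = X q r" "u = X r q"
        by (rule triangleE)
      note lt = pair_lt[OF qr(1)]
      note lt' = lt(2,1) lt(3)[symmetric]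
      show "(s, u) \<in> inner_arrows F"
        unfolding qr(2,3)
        using inner_arrowI[OF F X_win[OF lt] X_win[OF lt'] apart[OF lt X_in[OF lt] X_in[OF lt']] meet[OF lt]]
          over'[OF qr(1) X_in[OF lt] X_in[OF lt'] meet[OF lt]] by blast
    qed
  qed
  have ends: "abscissa F (a q) = abscissa D (a q)" "abscissa F (b q) = abscissa D (b q)" if "q < 3" for q
    using F abscissa_endpoints[of q] that n by auto
  have "crossing_sign F (X q r) (X r q) =
      sgn (det (matrix (d\<phi> 0))) * sgn (abscissa D (b q) - abscissa D (a q)) *
      sgn (abscissa D (b r) - abscissa D (a r)) * sgn (model_slope (\<pi> r) - model_slope (\<pi> q))"
    if qr: "q < 3" "r < 3" "q \<noteq> r" for q r
    using graph_crossing_sign[OF G[OF qr(1)] X(1)[OF qr] G[OF qr(2)] X(1)[OF qr(2,1) qr(3)[symmetric]] meet[OF qr]]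
      model_line_slopes[OF h \<pi>3[OF qr(1)] \<pi>3[OF qr(2)]] ends[OF qr(1)] ends[OF qr(2)]
    by (simp add: g_def)
  then show ?thesis by (rule that[OF pts inner])
qed

text \<open>
  Here \<open>p = 3\<close> belongs to the cyclic order top, middle, bottom of a descending move and
  \<open>p = -3\<close> to that of an ascending one.
\<close>

lemma triangle_invariants:
  assumes n: "n = 3" and ml: "m = 1 \<and> l = 2 \<and> p = 3 \<or> m = 2 \<and> l = 1 \<and> p = - 3"
    and h: "omega3_function h" "omega3_function h'" and \<pi>: "bij_betw \<pi> {..<3} {..<3 :: nat}"
    and images: "\<And>i. i < 3 \<Longrightarrow> curve D ` {a i..b i} = \<phi> ` omega3_model h (\<pi> i)"
      "\<And>i. i < 3 \<Longrightarrow> curve E ` {a i..b i} = \<phi> ` omega3_model h' (\<pi> i)"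
    and over: "\<And>F. F \<in> {D, E} \<Longrightarrow> strand_over F {a 0..b 0} {a m..b m} \<and>
      strand_over F {a 0..b 0} {a l..b l} \<and> strand_over F {a m..b m} {a l..b l}"
  shows "figure_count p E = figure_count p D" "locally_finite (arrows E) \<longleftrightarrow> locally_finite (arrows D)"
proof -
  have ml': "m = 1 \<and> l = 2 \<or> m = 2 \<and> l = 1" using ml by blast
  have overD: "strand_over D {a 0..b 0} {a m..b m}" "strand_over D {a 0..b 0} {a l..b l}"
      "strand_over D {a m..b m} {a l..b l}"
    and overE: "strand_over E {a 0..b 0} {a m..b m}" "strand_over E {a 0..b 0} {a l..b l}"
      "strand_over E {a m..b m} {a l..b l}"
    using over[of D] over[of E] by auto
  obtain X where X: "strand_points X" "inner_arrows D = triangle X m l"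
    "\<And>q r. q < 3 \<Longrightarrow> r < 3 \<Longrightarrow> q \<noteq> r \<Longrightarrow> crossing_sign D (X q r) (X r q) =
      sgn (det (matrix (d\<phi> 0))) * sgn (abscissa D (b q) - abscissa D (a q)) *
      sgn (abscissa D (b r) - abscissa D (a r)) * sgn (model_slope (\<pi> r) - model_slope (\<pi> q))"
    by (rule triangle_crossings[OF disjI1[OF refl] n ml' h(1) \<pi> images(1) overD], assumption, rule that)
  obtain Y where Y: "strand_points Y" "inner_arrows E = triangle Y m l"
    "\<And>q r. q < 3 \<Longrightarrow> r < 3 \<Longrightarrow> q \<noteq> r \<Longrightarrow> crossing_sign E (Y q r) (Y r q) =
      sgn (det (matrix (d\<phi> 0))) * sgn (abscissa D (b q) - abscissa D (a q)) *
      sgn (abscissa D (b r) - abscissa D (a r)) * sgn (model_slope (\<pi> r) - model_slope (\<pi> q))"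
    by (rule triangle_crossings[OF disjI2[OF refl] n ml' h(2) \<pi> images(2) overE], assumption, rule that)
  have R: "arrows D = outer_arrows \<union> translates (triangle X m l)"
    and R': "arrows E = outer_arrows \<union> translates (triangle Y m l)"
    using arrows_D arrows_E X(2) Y(2) by simp_all
  have "crossing_sign E (Y q r) (Y r q) = crossing_sign D (X q r) (X r q)"
    if "q < n" "r < n" "q \<noteq> r" for q r
    using X(3)[of q r] Y(3)[of q r] that n by simp
  then have "pattern_count p (crossing_sign D) (arrows D) (a 0) = pattern_count p (crossing_sign E) (arrows E) (a 0)"
    using pattern_count_triangle[OF n R R' ml outer_disjoint X(1) Y(1) D.periodic_sign E.periodic_sign]
      outer_sign by simp
  then show "figure_count p E = figure_count p D"
    using E.figure_count_base[of p "a 0"] D.figure_count_base[of p "a 0"] by simp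
  show "locally_finite (arrows E) \<longleftrightarrow> locally_finite (arrows D)"
    using X(2) Y(2) by (intro locally_finite_change) (simp_all add: triangle_def)
qed

end

section \<open>The figure eight diagram\<close>

text \<open>
  The crossings in the order of the Gauss code, continued periodically. Underpasses are at even places.
\<close>

definition label :: "int \<Rightarrow> nat" where
  "label i = [1, 2, 3, 1, 4, 3, 2, 4] ! nat (i mod 8)"

definition label_sign :: "int \<Rightarrow> real" where
  "label_sign i = (if label i = 2 \<or> label i = 3 then 1 else - 1)"

lemma mod_8_cases: "(i :: int) mod 8 \<in> {0, 1, 2, 3, 4, 5, 6, 7}"
proof -
  have "0 \<le> i mod 8" "i mod 8 < 8" by simp_all
  then show ?thesis by simp presburger
qed

lemma label_values:
  "label (- 3) = 3" "label (- 1) = 4" "label 0 = 1" "label 1 = 2" "label 2 = 3" "label 3 = 1"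
  "label 4 = 4" "label 5 = 3" "label 6 = 2" "label 7 = 4" "label 8 = 1" "label 9 = 2"
  "label 10 = 3" "label 12 = 4"
  by (simp_all add: label_def)

lemma label_mod_8: "label (i + k) = label (i mod 8 + k)"
  by (simp add: label_def mod_add_left_eq)

lemma even_mod_8:
  assumes "even (i :: int)"
  shows "i mod 8 = 0 \<or> i mod 8 = 2 \<or> i mod 8 = 4 \<or> i mod 8 = 6"
  using assms by presburger

lemma label_partner:
  assumes "even i"
  shows "label (i + 3) = label i"
  using even_mod_8[OF assms] label_mod_8[of i 3] label_mod_8[of i 0]
  by (elim disjE) (simp_all add: label_values)

lemma label_no_reverse_partner:
  assumes "even i"
  shows "label (i - 3) \<noteq> label i"
  using even_mod_8[OF assms] label_mod_8[of i "- 3"] label_mod_8[of i 0]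
  by (elim disjE) (simp_all add: label_values)

lemma label_sign_product:
  assumes "even c"
  shows "label_sign c * label_sign (c + 2) * label_sign (c + 4) * label_sign (c + 6) = 1"
  using even_mod_8[OF assms] label_mod_8[of c 0] label_mod_8[of c 2] label_mod_8[of c 4] label_mod_8[of c 6]
  by (elim disjE) (simp_all add: label_sign_def label_values)

lemma label_sign_product_back:
  assumes "even c"
  shows "label_sign c * label_sign (c - 2) * label_sign (c - 4) * label_sign (c - 6) = 1"
  using label_sign_product[of "c - 6"] assms by (simp add: mult_ac)

text \<open>
  The crossing parameters of a figure eight diagram, enumerated along the line.
\<close>

locale figure_eight_code = regular D for D +
  fixes T :: "int \<Rightarrow> real"
  assumes T_less: "i < j \<Longrightarrow> T i < T j"
    and T_period: "T (i + 8 * k) = T i + of_int k"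
    and T_range: "{u. \<exists>s. meets D s u} = range T"
    and T_finite: "finite (range T \<inter> {x..y})"
    and T_over: "T i \<in> over D \<longleftrightarrow> odd i"
    and T_curve: "curve D (T i) = curve D (T j) \<longleftrightarrow> label i = label j"
    and T_sign: "odd i \<Longrightarrow> even j \<Longrightarrow> label i = label j \<Longrightarrow> crossing_sign D (T i) (T j) = label_sign j"

lemma figure_eight_code_exists:
  assumes "figure_eight D"
  obtains T where "figure_eight_code D T"
proof -
  have D: "regular_diagram D" using assms regular_of_knot_diagram by (simp add: figure_eight_def)
  interpret regular D by (rule regular.intro[OF D])
  define code :: "(nat \<times> bool) list" where
    "code = [(1, False), (2, True), (3, False), (1, True), (4, False), (3, True), (2, False), (4, True)]"
  have len: "length code = 8" by (simp add: code_def)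
  define \<epsilon> :: "nat \<Rightarrow> real" where "\<epsilon> = (\<lambda>c. if c = 2 \<or> c = 3 then 1 else - 1)"
  have "has_gauss_code D code \<epsilon>" using assms by (simp add: figure_eight_def code_def \<epsilon>_def)
  then obtain t where t: "\<forall>i j. i < j \<and> j < 8 \<longrightarrow> t i < t j" "t 7 < t 0 + 1"
      "{u. \<exists>s. meets D s u} = lifts (t ` {..<8})"
      "\<forall>i<8. t i \<in> over D \<longleftrightarrow> snd (code ! i)"
      "\<forall>i<8. \<forall>j<8. curve D (t i) = curve D (t j) \<longleftrightarrow> fst (code ! i) = fst (code ! j)"
      "\<forall>i<8. \<forall>j<8. fst (code ! i) = fst (code ! j) \<and> snd (code ! i) \<and> \<not> snd (code ! j) \<longrightarrow>
          crossing_sign D (t i) (t j) = \<epsilon> (fst (code ! i))"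
    unfolding has_gauss_code_def len by auto
  define pos where "pos i = nat (i mod 8)" for i :: int
  have pos: "pos i < 8" for i by (simp add: pos_def nat_less_iff)
  have code: "fst (code ! pos i) = label i" "snd (code ! pos i) \<longleftrightarrow> odd i" for i
  proof -
    have "map fst code = [1, 2, 3, 1, 4, 3, 2, 4]" by (simp add: code_def)
    then show "fst (code ! pos i) = label i" using pos[of i] len nth_map[of "pos i" code fst]
      by (simp add: label_def pos_def)
    have "odd i \<longleftrightarrow> odd (i mod 8)" by presburger
    then show "snd (code ! pos i) \<longleftrightarrow> odd i"
      using mod_8_cases[of i] by (auto simp: pos_def code_def numeral_eq_Suc)
  qed
  define T where "T i = t (pos i) + of_int (i div 8)" for i
  have "figure_eight_code D T"
  proof (intro figure_eight_code.intro figure_eight_code_axioms.intro regular_axioms)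
    show "T (i + 8 * k) = T i + of_int k" for i k by (simp add: T_def pos_def)
    have step: "T i < T (i + 1)" for i
    proof (cases "i mod 8 = 7")
      case True
      then have "(i + 1) mod 8 = 0" "(i + 1) div 8 = i div 8 + 1" by presburger+
      then show ?thesis using t(2) True by (simp add: T_def pos_def)
    next
      case False
      then have "(i + 1) mod 8 = i mod 8 + 1" "(i + 1) div 8 = i div 8" by presburger+
      moreover have "0 \<le> i mod 8" by simp
      ultimately have "pos (i + 1) = Suc (pos i)" "(i + 1) div 8 = i div 8"
        by (simp_all add: pos_def Suc_nat_eq_nat_zadd1)
      then show ?thesis using t(1) pos[of "i + 1"] by (simp add: T_def)
    qed
    show "T i < T j" if "i < j" for i j
      using that
    proof (induction j rule: int_gr_induct)
      case (step j)
      then show ?case using \<open>\<And>i. T i < T (i + 1)\<close>[of j] by linarith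
    qed (rule step)
    show range: "{u. \<exists>s. meets D s u} = range T"
    proof -
      have "lifts (t ` {..<8}) = range T"
      proof
        show "lifts (t ` {..<8}) \<subseteq> range T"
        proof
          fix x assume "x \<in> lifts (t ` {..<8})"
          then obtain i k where "i < 8" "x = t i + of_int k" by (auto simp: lifts_def)
          then have "x = T (int i + 8 * k)" by (simp add: T_def pos_def)
          then show "x \<in> range T" by blast
        qed
        show "range T \<subseteq> lifts (t ` {..<8})"
          using pos by (auto simp: lifts_def T_def)
      qed
      then show ?thesis using t(3) by simp
    qed
    show "finite (range T \<inter> {x..y})" for x y
      using finite_lifts[of "t ` {..<8}" x y] t(3) range by simp
    show "T i \<in> over D \<longleftrightarrow> odd i" for i
      using t(4) pos code by (simp add: T_def)
    show "curve D (T i) = curve D (T j) \<longleftrightarrow> label i = label j" for i j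
      using t(5) pos code by (simp add: T_def)
    show "crossing_sign D (T i) (T j) = label_sign j" if "odd i" "even j" "label i = label j" for i j
      using t(6) pos code that periodic_sign
      by (simp add: T_def periodic_sign_def label_sign_def \<epsilon>_def)
  qed
  then show ?thesis by (rule that)
qed

context figure_eight_code
begin

lemma T_less_iff: "T i < T j \<longleftrightarrow> i < j"
  using T_less[of i j] T_less[of j i] by (cases i j rule: linorder_cases) auto

lemma T_inj: "T i = T j \<longleftrightarrow> i = j"
  using T_less[of i j] T_less[of j i] by (cases i j rule: linorder_cases) auto

lemma T_arrow:
  assumes "odd i" "even j" "label i = label j"
  shows "(T i, T j) \<in> arrows D"
proof -
  have "T i - T j \<notin> \<int>"
  proof
    assume "T i - T j \<in> \<int>"
    then obtain k where "T i - T j = of_int k" by (auto elim: Ints_cases)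
    then have "T i = T (j + 8 * k)" by (simp add: T_period)
    then have "i = j + 8 * k" by (simp add: T_inj)
    then show False using assms(1,2) by presburger
  qed
  then show ?thesis using assms T_curve T_over by (simp add: arrows_def meets_def)
qed

lemma Field_range: "Field (arrows D) \<subseteq> range T"
proof -
  have "Field (arrows D) \<subseteq> {u. \<exists>s. meets D s u}"
    using meets_sym by (fastforce simp: Field_def arrows_def)
  then show ?thesis using T_range by simp
qed

lemma locally_finite_figure_eight: "locally_finite (arrows D)"
  unfolding locally_finite_def
proof (intro allI)
  fix x y
  show "finite (Field (arrows D) \<inter> {x..y})"
    by (rule finite_subset[OF _ T_finite[of x y]]) (use Field_range in auto)
qed

text \<open>
  A period of an occurrence uses eight crossing points, which are all that there are. So an occurrence is
  the whole diagram, and only its starting place is free.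
\<close>

lemma occurrence_shift:
  assumes t: "t \<in> occurrences p (arrows D)" and p: "odd p"
  shows "\<exists>c. even c \<and> (\<forall>i. t i = T (i + c))"
proof -
  have "\<exists>j. t i = T j" for i
    using occurrences_Field[OF t p, of i] Field_range by blast
  then obtain f where f: "\<And>i. t i = T (f i)" by metis
  have less: "f i < f (i + 1)" for i
    using occurrences_less[OF t, of i "i + 1"] by (simp add: f T_less_iff)
  have f8: "f (i + 8) = f i + 8" for i
  proof -
    have "T (f (i + 8)) = T (f i + 8 * 1)"
      using occurrences_period[OF t, of i 1] T_period[of "f i" 1] by (simp add: f[symmetric])
    then show ?thesis by (simp add: T_inj)
  qed
  \<comment> \<open>Eight steps, each of length at least one, add up to eight.\<close>
  have step: "f (i + 1) = f i + 1" for i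
    using less[of i] less[of "i + 1"] less[of "i + 2"] less[of "i + 3"] less[of "i + 4"] less[of "i + 5"]
      less[of "i + 6"] less[of "i + 7"] f8[of i] by (simp add: add.assoc)
  have shift: "f i = i + f 0" for i
  proof (induction i rule: int_induct[where k = 0])
    case (step1 i)
    then show ?case using step[of i] by simp
  next
    case (step2 i)
    then show ?case using step[of "i - 1"] by simp
  qed simp
  have "t 0 \<notin> over D"
    using occurrences_Range[OF t, of 0] not_over_if_Range by simp
  then have "even (f 0)" by (simp add: f T_over)
  moreover have "t i = T (i + f 0)" for i using f[of i] unfolding shift[of i] .
  ultimately show ?thesis by blast
qed

lemma occurrences_T: "T \<in> occurrences 3 (arrows D)"
  unfolding occurrences_def
proof (intro CollectI conjI allI impI)
  show "T i < T (i + 1)" "T (i + 8) = T i + 1" for i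
    using T_less[of i "i + 1"] T_period[of i 1] by simp_all
  show "(T (i + 3), T i) \<in> arrows D" if "even i" for i
    using that label_partner by (intro T_arrow) auto
qed

lemma weight_occurrence:
  assumes t: "t \<in> occurrences 3 (arrows D)"
  shows "weight 3 (crossing_sign D) t = 1"
proof -
  obtain c where c: "even c" "\<And>i. t i = T (i + c)" using occurrence_shift[OF t] by auto
  have "crossing_sign D (t (i + 3)) (t i) = label_sign (c + i)" if "even i" for i
  proof -
    have "crossing_sign D (T (i + 3 + c)) (T (i + c)) = label_sign (i + c)"
      using that c(1) label_partner[of "i + c"] by (intro T_sign) (auto simp: algebra_simps)
    then show ?thesis by (simp add: c(2) add.commute)
  qed
  from this[of 0] this[of 2] this[of 4] this[of 6]
  show ?thesis using label_sign_product[OF c(1)] by (simp add: weight_def mult.assoc)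
qed

lemma no_reverse_occurrence: "occurrences (- 3) (arrows D) = {}"
proof (rule equals0I)
  fix t assume t: "t \<in> occurrences (- 3) (arrows D)"
  obtain c where c: "even c" "\<And>i. t i = T (i + c)" using occurrence_shift[OF t] by auto
  have "(t (0 + - 3), t 0) \<in> arrows D" by (rule occurrences_arrow[OF t]) simp
  then have "curve D (T (c - 3)) = curve D (T c)"
    using c(2)[of "- 3"] c(2)[of 0] by (simp add: arrows_def meets_def)
  then show False using T_curve label_no_reverse_partner[OF c(1)] by simp
qed

end

lemma count_of_unit_weights:
  assumes D: "regular_diagram D" and fin: "locally_finite (arrows D)" and p: "odd p"
    and unit: "\<And>t. t \<in> occurrences p (arrows D) \<Longrightarrow> weight p (crossing_sign D) t = 1"
    and t: "t \<in> occurrences p (arrows D)"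
  shows "figure_count p D \<noteq> 0"
proof -
  let ?B = "based_occurrences p (arrows D) (t 0)"
  have "figure_count p D = (\<Sum>t\<in>?B. 1)"
    unfolding regular.figure_count_base[OF regular.intro[OF D], of p "t 0"] pattern_count_def
    by (intro sum.cong) (auto simp: based_occurrences_def unit)
  also have "\<dots> = real (card ?B)" by simp
  also have "\<dots> \<noteq> 0"
    using finite_based_occurrences[OF fin p, of "t 0"] t by (auto simp: based_occurrences_def)
  finally show ?thesis .
qed

section \<open>Reversing the orientation\<close>

lemma reverse_velocity:
  assumes "regular_diagram D"
  shows "(curve (reverse_diagram D) has_vector_derivative - velocity D (- t)) (at t)"
    "velocity (reverse_diagram D) t = - velocity D (- t)"
proof -
  have "((\<lambda>t :: real. - t) has_vector_derivative - 1) (at t)"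
    by (auto intro!: derivative_eq_intros)
  from vector_diff_chain_at[OF this regular.curve_derivative[OF regular.intro[OF assms]]]
  show 1: "(curve (reverse_diagram D) has_vector_derivative - velocity D (- t)) (at t)"
    by (simp add: reverse_diagram_def comp_def)
  then show "velocity (reverse_diagram D) t = - velocity D (- t)"
    unfolding velocity_def[of "reverse_diagram D"] by (rule vector_derivative_at)
qed

lemma reverse_meets: "meets (reverse_diagram D) s t \<longleftrightarrow> meets D (- s) (- t)"
proof -
  have "- s - - t \<in> \<int> \<longleftrightarrow> s - t \<in> \<int>"
    by (metis Ints_minus minus_diff_eq minus_minus diff_minus_eq_add add.commute uminus_add_conv_diff)
  then show ?thesis by (simp add: meets_def reverse_diagram_def)
qed

lemma reverse_arrows: "(s, u) \<in> arrows (reverse_diagram D) \<longleftrightarrow> (- s, - u) \<in> arrows D"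
  by (simp add: arrows_def reverse_meets) (simp add: reverse_diagram_def)

lemma reverse_sign:
  assumes "regular_diagram D"
  shows "crossing_sign (reverse_diagram D) s u = crossing_sign D (- s) (- u)"
  by (simp add: crossing_sign_def reverse_velocity(2)[OF assms] det_vector_2)

lemma reverse_occurrences:
  assumes "t \<in> occurrences p (arrows (reverse_diagram D))"
  shows "(\<lambda>i. - t (- i)) \<in> occurrences (- p) (arrows D)"
  unfolding occurrences_def
proof (intro CollectI conjI allI impI)
  fix i
  show "- t (- i) < - t (- (i + 1))"
    using occurrences_less[OF assms, of "- (i + 1)" "- i"] by simp
  show "- t (- (i + 8)) = - t (- i) + 1"
    using occurrences_period[OF assms, of "- (i + 8)" 1] by simp
  assume "even i"
  then have "(t (- i + p), t (- i)) \<in> arrows (reverse_diagram D)"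
    by (intro occurrences_arrow[OF assms]) simp
  then show "(- t (- (i + - p)), - t (- i)) \<in> arrows D" by (simp add: reverse_arrows)
qed

lemma reverse_regular:
  assumes D: "regular_diagram D"
  shows "regular_diagram (reverse_diagram D)"
  unfolding regular_diagram_def
proof (intro conjI allI impI)
  interpret regular D by (rule regular.intro[OF D])
  let ?R = "reverse_diagram D"
  fix r s t
  show "curve ?R differentiable (at t)"
    using reverse_velocity(1)[OF D] differentiableI_vector by blast
  have minus: "- (t + 1) = - t + of_int (- 1)" by simp
  show "curve ?R (t + 1) = curve ?R t" "t + 1 \<in> over ?R \<longleftrightarrow> t \<in> over ?R"
    unfolding reverse_diagram_def by (simp_all only: minus diagram.simps curve_translate over_translate mem_Collect_eq)
  show "velocity ?R t \<noteq> 0"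
    using velocity_nonzero by (simp add: reverse_velocity(2)[OF D])
  show "det (vector [velocity ?R s, velocity ?R t] :: real^2^2) \<noteq> 0" if "meets ?R s t"
    using transversal that by (simp add: reverse_velocity(2)[OF D] reverse_meets det_vector_2)
  show "r - t \<in> \<int>" if "meets ?R r s \<and> meets ?R s t"
  proof -
    have "- r - - t \<in> \<int>"
      by (rule no_triple[of "- r" "- s" "- t"]) (use that in \<open>simp_all add: reverse_meets\<close>)
    then have "- (- r - - t) \<in> \<int>" by (rule Ints_minus)
    then show ?thesis by simp
  qed
  show "s \<in> over ?R \<longleftrightarrow> t \<notin> over ?R" if "meets ?R s t"
    using that over_under by (simp add: reverse_meets) (simp add: reverse_diagram_def)
qed

text \<open>
  Reversal turns the pattern \<open>p\<close> into \<open>-p\<close>, and every occurrence in either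
  diagram is a rotation of the whole diagram, with weight \<open>(- 1) * 1 * (- 1) * 1\<close>.
\<close>

lemma figure_eight_counts:
  assumes "figure_eight d"
  shows "figure_count 3 d \<noteq> 0" "figure_count (- 3) d = 0" "locally_finite (arrows d)"
    "figure_count 3 (reverse_diagram d) = 0"
    "locally_finite (arrows (reverse_diagram d)) \<Longrightarrow> figure_count (- 3) (reverse_diagram d) \<noteq> 0"
proof -
  obtain T where T: "figure_eight_code d T" using figure_eight_code_exists[OF assms] .
  interpret figure_eight_code d T by (rule T)
  let ?r = "reverse_diagram d"
  show fin: "locally_finite (arrows d)" by (rule locally_finite_figure_eight)
  show "figure_count 3 d \<noteq> 0"
    by (rule count_of_unit_weights[OF regular fin _ weight_occurrence occurrences_T]) simp_all
  show "figure_count (- 3) d = 0"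
    by (simp add: figure_count_def pattern_count_def based_occurrences_def no_reverse_occurrence)
  have "occurrences 3 (arrows ?r) = {}"
    using reverse_occurrences[of _ 3 d] no_reverse_occurrence by auto
  then show "figure_count 3 ?r = 0"
    by (simp add: figure_count_def pattern_count_def based_occurrences_def)
  assume fin': "locally_finite (arrows ?r)"
  have unit: "weight (- 3) (crossing_sign ?r) t = 1" if t: "t \<in> occurrences (- 3) (arrows ?r)" for t
  proof -
    have t': "(\<lambda>i. - t (- i)) \<in> occurrences 3 (arrows d)" using reverse_occurrences[OF t] by simp
    obtain c where c: "even c" "\<And>i. - t (- i) = T (i + c)" using occurrence_shift[OF t'] by auto
    have "crossing_sign ?r (t (i - 3)) (t i) = label_sign (c - i)" if i: "even i" for i
    proof -
      have "crossing_sign d (T (c - i + 3)) (T (c - i)) = label_sign (c - i)"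
        using i c(1) label_partner[of "c - i"] by (intro T_sign) auto
      moreover have "- t (i - 3) = T (c - i + 3)" "- t i = T (c - i)"
        using c(2)[of "3 - i"] c(2)[of "- i"] by (simp_all add: algebra_simps)
      ultimately show ?thesis by (simp add: reverse_sign[OF regular])
    qed
    from this[of 0] this[of 2] this[of 4] this[of 6]
    show ?thesis using label_sign_product_back[OF c(1)] by (simp add: weight_def mult.assoc)
  qed
  have "(\<lambda>i. - T (- i)) \<in> occurrences (- 3) (arrows ?r)"
    unfolding occurrences_def
  proof (intro CollectI conjI allI impI)
    fix i :: int
    show "- T (- i) < - T (- (i + 1))" by (simp add: T_less_iff)
    show "- T (- (i + 8)) = - T (- i) + 1" using T_period[of "- (i + 8)" 1] by simp
    assume "even i"
    then have "(T (- i + 3), T (- i)) \<in> arrows d" by (intro occurrences_arrow[OF occurrences_T]) simp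
    then show "(- T (- (i + - 3)), - T (- i)) \<in> arrows ?r" by (simp add: reverse_arrows)
  qed
  then show "figure_count (- 3) ?r \<noteq> 0"
    by (intro count_of_unit_weights[OF reverse_regular[OF regular] fin' _ unit]) simp_all
qed

section \<open>Moves and the pattern count\<close>

text \<open>
  That a diagram has finitely many crossings is known for the figure eight diagram, and is passed on from
  one diagram to the next together with the count.
\<close>

definition preserves_count :: "int \<Rightarrow> diagram \<Rightarrow> diagram \<Rightarrow> bool" where
  "preserves_count p D E \<longleftrightarrow> (locally_finite (arrows E) \<longleftrightarrow> locally_finite (arrows D)) \<and>
     (locally_finite (arrows D) \<longrightarrow> figure_count p E = figure_count p D)"

lemma preserves_count_sym: "preserves_count p D E \<Longrightarrow> preserves_count p E D"
  by (auto simp: preserves_count_def)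

lemma omega1_preserves_count:
  assumes "regular_diagram D" "regular_diagram E" "omega1 D E" "p = 3 \<or> p = - 3"
  shows "preserves_count p D E"
proof -
  obtain \<phi> a b where ch: "changed_in_disk \<phi> 1 a b D E" and 1: "inj_on (curve D) {a 0..b 0}"
      "card {(s, t). a 0 \<le> s \<and> s < t \<and> t \<le> b 0 \<and> curve E s = curve E t} = 1"
    using assms(3) unfolding omega1_def by (elim exE conjE) (rule that)
  obtain U V where "disk_change \<phi> U V D E 1 a b"
    using disk_changeI[OF assms(1,2) ch] by auto
  from disk_change.kink_invariants[OF this assms(4) refl 1]
  show ?thesis by (simp add: preserves_count_def)
qed

lemma omega2_preserves_count:
  assumes "regular_diagram D" "regular_diagram E" "omega2 D E" "p = 3 \<or> p = - 3"
  shows "preserves_count p D E"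
proof -
  obtain \<phi> a b h where ch: "changed_in_disk \<phi> 2 a b D E"
    and h: "smooth_on UNIV h" "\<forall>x. \<bar>x\<bar> \<ge> 1/2 \<longrightarrow> h x = 1/2" "card {x. h x = 0} = 2"
    and im: "curve D ` {a 0..b 0} = \<phi> ` graph_in_disk (\<lambda>x. 0)"
      "curve D ` {a 1..b 1} = \<phi> ` graph_in_disk (\<lambda>x. 1/2)"
      "curve E ` {a 0..b 0} = \<phi> ` graph_in_disk (\<lambda>x. 0)"
      "curve E ` {a 1..b 1} = \<phi> ` graph_in_disk h"
    and over: "strand_over E {a 0..b 0} {a 1..b 1} \<or> strand_over E {a 1..b 1} {a 0..b 0}"
    using assms(3) unfolding omega2_def by (elim exE conjE) (rule that)
  obtain U V where c: "disk_change \<phi> U V D E 2 a b"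
    using disk_changeI[OF assms(1,2) ch] by auto
  have h2: "h x = 1/2" if "\<bar>x\<bar> \<ge> 1/2" for x using h(2) that by blast
  show ?thesis
    using disk_change.bigon_invariants[OF c assms(4) refl h(1) h2 h(3) im over]
    by (simp add: preserves_count_def)
qed

lemma omega3_preserves_count:
  assumes "regular_diagram D" "regular_diagram E" "omega3 m l D E"
    and ml: "m = 1 \<and> l = 2 \<and> p = 3 \<or> m = 2 \<and> l = 1 \<and> p = - 3"
  shows "preserves_count p D E"
proof -
  obtain \<phi> a b h h' \<pi> where ch: "changed_in_disk \<phi> 3 a b D E"
    and h: "omega3_function h" "omega3_function h'" and \<pi>: "bij_betw \<pi> {..<3} {..<3 :: nat}"
    and im: "\<forall>i<3. curve D ` {a i..b i} = \<phi> ` omega3_model h (\<pi> i)"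
      "\<forall>i<3. curve E ` {a i..b i} = \<phi> ` omega3_model h' (\<pi> i)"
    and over: "\<forall>F\<in>{D, E}. strand_over F {a 0..b 0} {a m..b m} \<and>
      strand_over F {a 0..b 0} {a l..b l} \<and> strand_over F {a m..b m} {a l..b l}"
    using assms(3) unfolding omega3_def by (elim exE conjE) (rule that)
  obtain U V where c: "disk_change \<phi> U V D E 3 a b"
    using disk_changeI[OF assms(1,2) ch] by auto
  show ?thesis
    using disk_change.triangle_invariants[OF c refl ml h \<pi> im[rule_format] over[rule_format]]
    by (simp add: preserves_count_def)
qed

lemma move_preserves_count:
  assumes D: "regular_diagram D" and E: "regular_diagram E" and "move k D E"
    and p: "p = 3 \<and> k \<noteq> Omega3 Ascending \<or> p = - 3 \<and> k \<noteq> Omega3 Descending"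
  shows "preserves_count p D E"
proof -
  obtain D' E' where m: "same_diagram D D'" "basic_move k D' E'" "same_diagram E' E"
    using assms(3) unfolding move_def by blast
  have DD: "reparametrized D D'" and EE: "reparametrized E E'"
    using m reparametrized_of_same_diagram reparametrized_sym by blast+
  note D' = reparametrized_invariants[OF DD D] and E' = reparametrized_invariants[OF EE E]
  have "preserves_count p D' E'"
  proof (cases k)
    case Plane_Diffeo
    then have "plane_diffeo_move D' E'" using m(2) by simp
    then show ?thesis
      using plane_diffeo_invariants[OF D'(1)] by (simp add: preserves_count_def)
  next
    case Omega1
    then show ?thesis
      using m(2) p omega1_preserves_count D'(1) E'(1) preserves_count_sym by (metis basic_move.simps(2))
  next
    case Omega2
    then show ?thesis
      using m(2) p omega2_preserves_count D'(1) E'(1) preserves_count_sym by (metis basic_move.simps(3))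
  next
    case (Omega3 r)
    then show ?thesis
      using m(2) p omega3_preserves_count[OF D'(1) E'(1)] by (cases r) auto
  qed
  then show ?thesis using D'(2,3) E'(2,3) by (simp add: preserves_count_def)
qed

lemma preserves_count_chain:
  assumes "\<And>i. i < n \<Longrightarrow> preserves_count p (Ds i) (Ds (Suc i))"
  shows "preserves_count p (Ds 0) (Ds n)"
  using assms by (induction n) (auto simp: preserves_count_def less_Suc_eq)

theorem theorem1:
  fixes d :: diagram
    and n :: nat
    and Ds :: "nat \<Rightarrow> diagram"
    and ks :: "nat \<Rightarrow> move_kind"
  assumes "figure_eight d"
    and "\<And>i. i \<le> n \<Longrightarrow> knot_diagram (Ds i)"
    and "same_diagram d (Ds 0)"
    and "same_diagram (Ds n) (reverse_diagram d)"
    and "\<And>i. i < n \<Longrightarrow> move (ks i) (Ds i) (Ds (Suc i))"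
  shows "(\<exists>i<n. ks i = Omega3 Ascending) \<and> (\<exists>i<n. ks i = Omega3 Descending) \<and>
    card {i. i < n \<and> (\<exists>r. ks i = Omega3 r)} \<ge> 2"
proof -
  have reg: "regular_diagram (Ds i)" if "i \<le> n" for i
    using assms(2)[OF that] by (rule regular_of_knot_diagram)
  have d: "regular_diagram d"
    using assms(1) by (simp add: figure_eight_def regular_of_knot_diagram)
  note start = reparametrized_invariants[OF reparametrized_of_same_diagram[OF assms(3)] d]
  note finish = reparametrized_invariants[OF reparametrized_of_same_diagram[OF assms(4)] reg[OF order_refl]]
  note counts = figure_eight_counts[OF assms(1)]
  have chain: "preserves_count p (Ds 0) (Ds n)"
    if "\<And>i. i < n \<Longrightarrow> p = 3 \<and> ks i \<noteq> Omega3 Ascending \<or> p = - 3 \<and> ks i \<noteq> Omega3 Descending" for p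
    using that assms(5) reg by (intro preserves_count_chain move_preserves_count) auto
  have ascending: "\<exists>i<n. ks i = Omega3 Ascending"
  proof (rule ccontr)
    assume "\<not> ?thesis"
    then have "preserves_count 3 (Ds 0) (Ds n)" by (intro chain) auto
    then show False using start finish counts by (simp add: preserves_count_def)
  qed
  have descending: "\<exists>i<n. ks i = Omega3 Descending"
  proof (rule ccontr)
    assume "\<not> ?thesis"
    then have "preserves_count (- 3) (Ds 0) (Ds n)" by (intro chain) auto
    then show False using start finish counts by (simp add: preserves_count_def)
  qed
  obtain i j where ij: "i < n" "ks i = Omega3 Ascending" "j < n" "ks j = Omega3 Descending"
    using ascending descending by blast
  then have "i \<noteq> j" by auto
  then have "2 = card {i, j}" by simp
  also have "\<dots> \<le> card {i. i < n \<and> (\<exists>r. ks i = Omega3 r)}"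
    using ij by (intro card_mono) auto
  finally show ?thesis using ascending descending by blast
qed

end
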